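(* Let $n\ge2$ and $\pi\in\mathcal{S}_n$. Let $N_-(\pi)$ be the minimal number of distinct letters of a sequence $w\in\mathbb{N}^\infty$ with $\mathrm{Pat}(w,\Sigma,n)=\pi$ (with respect to the alternating lexicographical order). Then \[ N_-(\pi)=\lfloor B_-(\pi)\rfloor+1=\max_{1\le j<n}z_j+1+\epsilon, \] where $\epsilon=1$ if $\pi$ is collapsed or $a=\overline{c0}$ with $c=\max_{1\le j<n}z_j$, and $\epsilon=0$ otherwise. Moreover, $N_-(\pi)\le n-1$ for all $\pi\in\mathcal{S}_n$ with $n\ge3$, and for $n\ge4$ equality holds if and only if $\pi\in\{12\cdots n,\ 12\cdots(n{-}2)n(n{-}1),\ n(n{-}1)\cdots1,\ n(n{-}1)\cdots312\}$. Finally, for $n\ge3$, \[ \max_{\pi\in\mathcal{S}_n}B_-(\pi)=b\big((n{-}2)(n{-}3)\cdots1\overline{0}\big)\in(n-2,n-1), \] and the maximum is attained only for $\pi=n(n{-}1)\cdots1$ if $n$ is even, and only for $\pi=n(n{-}1)\cdots312$ if $n$ is odd.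
   Context: $\mathbb{N}=\{0,1,2,\dots\}$; $\mathcal{S}_n$ the symmetric group; permutations written in one-line notation. Alternating lexicographical order on sequences/equal-length words: $v<w$ if for some $k$, $v_{[1,k)}=w_{[1,k)}$ and $v_k<w_k$ for odd $k$, $w_k<v_k$ for even $k$. Notation $w_{[i,j)}=w_i\cdots w_{j-1}$, $w_{[i,\infty)}=w_iw_{i+1}\cdots$, $\overline v=vvv\cdots$. $\Sigma$ is the shift on $\mathbb{N}^\infty$; $\mathrm{Pat}(w,\Sigma,n)=\pi$ means $w_{[\pi^{-1}(1),\infty)}<w_{[\pi^{-1}(2),\infty)}<\cdots<w_{[\pi^{-1}(n),\infty)}$. For an ordered set $X$ and $f:X\to X$, $\mathrm{Pat}(x,f,n)=\pi$ means $\pi(i)<\pi(j)$ iff $f^{i-1}(x)<f^{j-1}(x)$ (iterates distinct), $\mathcal{A}(f)$ is the set of such patterns. $T_{-\beta}:(0,1]\to(0,1]$, $x\mapsto\lfloor\beta x\rfloor+1-\beta x$ ($\beta>1$), $B_-(\pi)=\inf\{\beta>1:\pi\in\mathcal{A}(T_{-\beta})\}$. $\widehat w=\sup_k w_{[k,\infty)}$. $\varphi$: $0\mapsto1$, $1\mapsto100$, fixed point $u$. For $w$ with $\widehat w=w$: if $w>u$, $b(w)$ is the largest positive solution $x>1$ (which exists) of $1+\sum_{k\ge1}\frac{w_k+1}{(-x)^k}=0$; if $w\le u$, $b(w)=1$. For $\pi$: $m=\pi^{-1}(n)$; $\ell=\pi^{-1}(\pi(n)-1)$ if $\pi(n)\ne1$;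 $r=\pi^{-1}(\pi(n)+1)$ if $\pi(n)\ne n$; $z_j=\#\{1\le i<\pi(j):\ (i\ne\pi(n)\ne i+1$ and $\pi(\pi^{-1}(i)+1)<\pi(\pi^{-1}(i+1)+1))$ or $(i+1=\pi(n)\ne n$ and $\pi(\ell+1)<\pi(r+1))\}$ for $1\le j<n$. $\pi$ is collapsed if $\pi(n)\notin\{1,n\}$ and $z_{[\ell,n)}=z_{[r,n)}z_{[r,n)}$ or $z_{[r,n)}=z_{[\ell,n)}z_{[\ell,n)}$; then $z^{(i)}_j=z_j+1$ if ($\pi(j)\ge\pi(r+i)$, $i$ even) or ($\pi(j)\ge\pi(\ell+i)$, $i$ odd), else $z_j$ ($0\le i<|r-\ell|$). The sequence $a$ is: $z_{[m,n)}\overline{z_{[\ell,n)}}$ if $n-m$ even, $\pi(n)\ne1$, not collapsed; $\overline{z_{[m,n)}0}$ if $n-m$ even and $\pi(n)=1$; $\min_{0\le i<|r-\ell|}z^{(i)}_{[m,n)}\overline{z^{(i)}_{[\ell,n)}}$ if $n-m$ even and collapsed; $z_{[m,n)}\overline{z_{[r,n)}}$ if $n-m$ odd and not collapsed; $\min_{0\le i<|r-\ell|}z^{(i)}_{[m,n)}\overline{z^{(i)}_{[r,n)}}$ if $n-m$ odd and collapsed (minima in the alternating lexicographical order). *)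

theory Defs
  imports "HOL-Analysis.Analysis" "HOL-Library.Stream" "HOL-Combinatorics.Permutations"
begin

text \<open>
  Sequences in \<open>\<nat>\<^sup>\<infinity>\<close> are streams of natural numbers; since \<open>!!\<close> counts from 0,
  the letter \<open>w\<^sub>k\<close> is \<open>w !! (k - 1)\<close>, the tail of \<open>w\<close> from position \<open>k\<close> on is
  \<open>sdrop (k - 1) w\<close>, and the periodic sequence with period \<open>v\<close> is \<open>cycle v\<close>.
  Permutations in \<open>S\<^sub>n\<close> are functions with \<open>\<pi> permutes {1..n}\<close>.
\<close>

text \<open>The (0-based) index \<open>k\<close> is even iff the position \<open>k + 1\<close> is odd.\<close>

definition alt_less :: "nat stream \<Rightarrow> nat stream \<Rightarrow> bool" where
  "alt_less v w \<longleftrightarrow>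
     (\<exists>k. stake k v = stake k w \<and> (if even k then v !! k < w !! k else w !! k < v !! k))"

definition alt_le :: "nat stream \<Rightarrow> nat stream \<Rightarrow> bool" where
  "alt_le v w \<longleftrightarrow> alt_less v w \<or> v = w"

lemma stream_eqI:
  assumes "\<And>i. v !! i = w !! i"
  shows "v = w"
  using assms by (metis smap_alt stream.map_ident)

lemma stake_eq_iff: "stake k v = stake k w \<longleftrightarrow> (\<forall>i<k. v !! i = w !! i)"
  by (metis length_stake nth_equalityI stake_nth)

lemma alt_less_irrefl: "\<not> alt_less v v"
  by (auto simp: alt_less_def)

lemma alt_less_trans:
  assumes "alt_less u v" "alt_less v w"
  shows "alt_less u w"
proof -
  obtain k where k: "\<forall>i<k. u !! i = v !! i"
    "if even k then u !! k < v !! k else v !! k < u !! k"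
    using assms(1) by (auto simp: alt_less_def stake_eq_iff)
  obtain l where l: "\<forall>i<l. v !! i = w !! i"
    "if even l then v !! l < w !! l else w !! l < v !! l"
    using assms(2) by (auto simp: alt_less_def stake_eq_iff)
  have "\<forall>i<min k l. u !! i = w !! i"
    using k(1) l(1) by auto
  moreover have "if even (min k l) then u !! min k l < w !! min k l else w !! min k l < u !! min k l"
    using k l by (cases k l rule: linorder_cases) (auto simp: min_def split: if_splits)
  ultimately show ?thesis
    unfolding alt_less_def stake_eq_iff by blast
qed

lemma alt_less_linear: "alt_less v w \<or> v = w \<or> alt_less w v"
proof (cases "v = w")
  case False
  then have ex: "\<exists>k. v !! k \<noteq> w !! k"
    by (metis stream_eqI)
  define k where "k = (LEAST k. v !! k \<noteq> w !! k)"
  have "v !! k \<noteq> w !! k"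
    unfolding k_def using ex by (rule LeastI_ex)
  moreover have "\<forall>i<k. v !! i = w !! i"
    unfolding k_def using not_less_Least by blast
  ultimately show ?thesis
    unfolding alt_less_def stake_eq_iff by (metis linorder_neqE_nat)
qed simp

interpretation alt: linorder alt_le alt_less
  by unfold_locales
    (use alt_less_irrefl alt_less_trans alt_less_linear in \<open>unfold alt_le_def, blast+\<close>)

text \<open>The supremum \<open>sup\<^sub>k w\<^bsub>[k,\<infinity>)\<^esub>\<close>.\<close>

definition alt_hat :: "nat stream \<Rightarrow> nat stream" where
  "alt_hat w = alt.Least (\<lambda>s. \<forall>k. alt_le (sdrop k w) s)"


lemma alt_hat_eq_self:
  assumes "\<And>k. alt_le (sdrop k w) w"
  shows "alt_hat w = w"
  unfolding alt_hat_def
proof (rule alt.Least_equality)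
  show "alt_le w s" if "\<forall>k. alt_le (sdrop k w) s" for s
    using that[rule_format, of 0] by simp
qed (use assms in blast)

lemma alt_hat_staircase:
  assumes "n \<ge> 3"
  shows "alt_hat (rev [1..<n - 1] @- cycle [0]) = rev [1..<n - 1] @- cycle [0]" (is "alt_hat ?w = ?w")
proof (rule alt_hat_eq_self)
  fix k
  have c: "cycle [0::nat] !! i = 0" for i
    by (induction i) (simp_all add: cycle.sel)
  have w: "?w !! i = n - 2 - i" for i
    by (cases "i < n - 2") (auto simp: shift_snth_less shift_snth_ge rev_nth c)
  show "alt_le (sdrop k ?w) ?w"
  proof (cases "k = 0")
    case False
    then have "sdrop k ?w !! 0 < ?w !! 0"
      unfolding sdrop_snth w using assms by simp
    then have "alt_less (sdrop k ?w) ?w"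
      unfolding alt_less_def by (intro exI[of _ 0]) simp
    then show ?thesis
      by (simp add: alt_le_def)
  qed (simp add: alt_le_def)
qed

definition is_shift_pat :: "nat stream \<Rightarrow> nat \<Rightarrow> (nat \<Rightarrow> nat) \<Rightarrow> bool" where
  "is_shift_pat w n \<pi> \<longleftrightarrow> \<pi> permutes {1..n} \<and>
     (\<forall>i\<in>{1..<n}. alt_less (sdrop (inv \<pi> i - 1) w) (sdrop (inv \<pi> (i + 1) - 1) w))"

text \<open>Sequences with infinitely many letters, whose \<open>card\<close> would be 0, are excluded.\<close>

definition N_minus :: "nat \<Rightarrow> (nat \<Rightarrow> nat) \<Rightarrow> nat" where
  "N_minus n \<pi> = (LEAST k. \<exists>w. is_shift_pat w n \<pi> \<and> finite (sset w) \<and> card (sset w) = k)"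

definition is_pat :: "'a::linorder \<Rightarrow> ('a \<Rightarrow> 'a) \<Rightarrow> nat \<Rightarrow> (nat \<Rightarrow> nat) \<Rightarrow> bool" where
  "is_pat x f n \<pi> \<longleftrightarrow> \<pi> permutes {1..n} \<and>
     inj_on (\<lambda>i. (f ^^ (i - 1)) x) {1..n} \<and>
     (\<forall>i\<in>{1..n}. \<forall>j\<in>{1..n}. \<pi> i < \<pi> j \<longleftrightarrow> (f ^^ (i - 1)) x < (f ^^ (j - 1)) x)"

text \<open>
  The length \<open>n\<close> of a permutation cannot be read off the function \<open>\<pi>\<close>, so the set of
  allowed patterns of \<open>f : X \<rightarrow> X\<close> is split according to \<open>n\<close>.
\<close>

definition allowed_pats :: "'a::linorder set \<Rightarrow> ('a \<Rightarrow> 'a) \<Rightarrow> nat \<Rightarrow> (nat \<Rightarrow> nat) set" where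
  "allowed_pats X f n = {\<pi>. \<exists>x\<in>X. is_pat x f n \<pi>}"

definition T_minus :: "real \<Rightarrow> real \<Rightarrow> real" where
  "T_minus \<beta> x = of_int \<lfloor>\<beta> * x\<rfloor> + 1 - \<beta> * x"

definition B_minus :: "nat \<Rightarrow> (nat \<Rightarrow> nat) \<Rightarrow> real" where
  "B_minus n \<pi> = Inf {\<beta>. \<beta> > 1 \<and> \<pi> \<in> allowed_pats {0<..1} (T_minus \<beta>) n}"

definition one_line :: "nat \<Rightarrow> (nat \<Rightarrow> nat) \<Rightarrow> nat list" where
  "one_line n \<pi> = map \<pi> [1..<n + 1]"

definition phi :: "nat \<Rightarrow> nat list" where
  "phi x = (if x = 0 then [1] else [1, 0, 0])"

definition u_word :: "nat stream" where
  "u_word = (THE u. flat (smap phi u) = u)"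

lemma flat_phi_shift: "flat (smap phi (xs @- s)) = concat (map phi xs) @- flat (smap phi s)"
  by (induction xs) (auto simp: phi_def)

fun phi_iter :: "nat \<Rightarrow> nat list" where
  "phi_iter 0 = [1]"
| "phi_iter (Suc k) = concat (map phi (phi_iter k))"

lemma phi_iter_Suc: "\<exists>ys. ys \<noteq> [] \<and> phi_iter (Suc k) = phi_iter k @ ys"
proof (induction k)
  case (Suc k)
  then obtain ys where ys: "ys \<noteq> []" "phi_iter (Suc k) = phi_iter k @ ys"
    by blast
  have "phi_iter (Suc (Suc k)) = phi_iter (Suc k) @ concat (map phi ys)"
    using ys(2) by (metis concat_append map_append phi_iter.simps(2))
  moreover have "concat (map phi ys) \<noteq> []"
    using ys(1) by (cases ys) (auto simp: phi_def)
  ultimately show ?case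
    by blast
qed (simp add: phi_def)

lemma length_phi_iter: "k < length (phi_iter k)"
proof (induction k)
  case (Suc k)
  obtain ys where "ys \<noteq> []" "phi_iter (Suc k) = phi_iter k @ ys"
    using phi_iter_Suc by blast
  then have "length (phi_iter (Suc k)) = length (phi_iter k) + length ys" "length ys > 0"
    by simp_all
  then show ?case
    using Suc by linarith
qed simp

lemma phi_iter_nth:
  assumes "k \<le> l" "i < length (phi_iter k)"
  shows "i < length (phi_iter l) \<and> phi_iter l ! i = phi_iter k ! i"
  using assms(1)
proof (induction l rule: dec_induct)
  case (step l)
  obtain ys where "phi_iter (Suc l) = phi_iter l @ ys"
    using phi_iter_Suc by blast
  then show ?case
    using step by (simp add: nth_append del: phi_iter.simps)
qed (use assms in simp)

lemma phi_iter_prefix: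
  assumes "\<And>i. i < length (phi_iter k) \<Longrightarrow> s !! i = phi_iter k ! i"
  shows "s = phi_iter k @- sdrop (length (phi_iter k)) s"
proof -
  have "stake (length (phi_iter k)) s = phi_iter k"
    using assms by (intro nth_equalityI) auto
  then show ?thesis
    by (metis stake_sdrop)
qed

lemma ex1_u_word: "\<exists>!u. flat (smap phi u) = u"
proof
  define u where "u = smap (\<lambda>k. phi_iter k ! k) nats"
  have u: "u !! i = phi_iter k ! i" if "i < length (phi_iter k)" for i k
  proof -
    have "phi_iter i ! i = phi_iter (max i k) ! i" "phi_iter k ! i = phi_iter (max i k) ! i"
      using phi_iter_nth[of i "max i k" i] phi_iter_nth[of k "max i k" i] length_phi_iter that
      by auto
    then show ?thesis
      by (simp add: u_def)
  qed
  show "flat (smap phi u) = u"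
  proof (rule stream_eqI)
    fix i
    have "u = phi_iter i @- sdrop (length (phi_iter i)) u"
      by (rule phi_iter_prefix) (rule u)
    then have "flat (smap phi u) = phi_iter (Suc i) @- flat (smap phi (sdrop (length (phi_iter i)) u))"
      by (metis flat_phi_shift phi_iter.simps(2))
    then show "flat (smap phi u) !! i = u !! i"
      using u[of i "Suc i"] length_phi_iter[of "Suc i"] by (simp add: shift_snth_less del: phi_iter.simps)
  qed
  show "v = u" if v: "flat (smap phi v) = v" for v
  proof -
    have "\<exists>s. v = phi_iter k @- s" for k
    proof (induction k)
      case 0
      have "shd v = 1"
        by (subst v[symmetric]) (simp add: phi_def)
      then have "v = [1] @- stl v"
        by (cases v) simp
      then show ?case
        by (metis phi_iter.simps(1))
    next
      case (Suc k)
      then show ?case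
        using v flat_phi_shift by (metis phi_iter.simps(2))
    qed
    then show ?thesis
      using u length_phi_iter by (intro stream_eqI) (metis shift_snth_less)
  qed
qed

lemma u_word_fixed: "flat (smap phi u_word) = u_word"
  unfolding u_word_def by (rule theI'[OF ex1_u_word])

text \<open>
  \<open>b(w)\<close> is defined for \<open>alt_hat w = w\<close> only. Since \<open>w !! k\<close> is the letter at
  position \<open>k + 1\<close>, the summand for \<open>k\<close> is the one for \<open>k + 1\<close> in
  \<open>1 + \<Sum>\<^bsub>k\<ge>1\<^esub> (w\<^sub>k + 1) / (-x)\<^sup>k\<close>.
\<close>

definition b_seq :: "nat stream \<Rightarrow> real" where
  "b_seq w =
     (if alt_hat w = w then
        if alt_less u_word w then
          GREATEST x. x > 1 \<and> 1 + (\<Sum>k. (real (w !! k) + 1) / (- x) ^ (k + 1)) = 0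
        else 1
      else undefined)"

definition m_pos :: "nat \<Rightarrow> (nat \<Rightarrow> nat) \<Rightarrow> nat" where
  "m_pos n \<pi> = inv \<pi> n"

text \<open>The next two are meaningful only for \<open>\<pi> n \<noteq> 1\<close> and \<open>\<pi> n \<noteq> n\<close>, respectively.\<close>

definition l_pos :: "nat \<Rightarrow> (nat \<Rightarrow> nat) \<Rightarrow> nat" where
  "l_pos n \<pi> = inv \<pi> (\<pi> n - 1)"

definition r_pos :: "nat \<Rightarrow> (nat \<Rightarrow> nat) \<Rightarrow> nat" where
  "r_pos n \<pi> = inv \<pi> (\<pi> n + 1)"

definition z_seq :: "nat \<Rightarrow> (nat \<Rightarrow> nat) \<Rightarrow> nat \<Rightarrow> nat" where
  "z_seq n \<pi> j = card {i \<in> {1..<\<pi> j}.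
     (i \<noteq> \<pi> n \<and> \<pi> n \<noteq> i + 1 \<and> \<pi> (inv \<pi> i + 1) < \<pi> (inv \<pi> (i + 1) + 1)) \<or>
     (i + 1 = \<pi> n \<and> \<pi> n \<noteq> n \<and> \<pi> (l_pos n \<pi> + 1) < \<pi> (r_pos n \<pi> + 1))}"

text \<open>The word \<open>z\<^bsub>[i,j)\<^esub>\<close>:\<close>

definition seg :: "(nat \<Rightarrow> nat) \<Rightarrow> nat \<Rightarrow> nat \<Rightarrow> nat list" where
  "seg z i j = map z [i..<j]"

definition collapsed :: "nat \<Rightarrow> (nat \<Rightarrow> nat) \<Rightarrow> bool" where
  "collapsed n \<pi> \<longleftrightarrow> \<pi> n \<notin> {1, n} \<and>
     (let L = seg (z_seq n \<pi>) (l_pos n \<pi>) n; R = seg (z_seq n \<pi>) (r_pos n \<pi>) n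
      in L = R @ R \<or> R = L @ L)"

definition z_alt :: "nat \<Rightarrow> (nat \<Rightarrow> nat) \<Rightarrow> nat \<Rightarrow> nat \<Rightarrow> nat" where
  "z_alt n \<pi> i j =
     (if (even i \<and> \<pi> j \<ge> \<pi> (r_pos n \<pi> + i)) \<or> (odd i \<and> \<pi> j \<ge> \<pi> (l_pos n \<pi> + i))
      then z_seq n \<pi> j + 1 else z_seq n \<pi> j)"

definition a_seq :: "nat \<Rightarrow> (nat \<Rightarrow> nat) \<Rightarrow> nat stream" where
  "a_seq n \<pi> =
     (let m = m_pos n \<pi>; l = l_pos n \<pi>; r = r_pos n \<pi>;
          z = z_seq n \<pi>; zi = z_alt n \<pi>;
          I = {0..<nat \<bar>int r - int l\<bar>}
      in if even (n - m) then
           if \<pi> n = 1 then cycle (seg z m n @ [0])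
           else if collapsed n \<pi> then alt.Min ((\<lambda>i. seg (zi i) m n @- cycle (seg (zi i) l n)) ` I)
           else seg z m n @- cycle (seg z l n)
         else
           if collapsed n \<pi> then alt.Min ((\<lambda>i. seg (zi i) m n @- cycle (seg (zi i) r n)) ` I)
           else seg z m n @- cycle (seg z r n))"

definition epsilon :: "nat \<Rightarrow> (nat \<Rightarrow> nat) \<Rightarrow> nat" where
  "epsilon n \<pi> =
     (if collapsed n \<pi> \<or> a_seq n \<pi> = cycle [Max (z_seq n \<pi> ` {1..<n}), 0] then 1 else 0)"

end

(*
  A sequence realizing \<pi> has letters w_1 ... w_(n-1) that are monotone in the rank, with a jump
  between adjacent ranks whose successors are in the same order; z is the minimal such choice, and
  with max z + 1 letters it is the only one. The tail t = w_n w_(n+1) ... must then satisfy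
  L t < t < R t for L = z_l ... z_(n-1) and R = z_r ... z_(n-1), that is, lie strictly between the
  periodic sequences of L and R (one of the bounds is missing if \<pi>(n) is 1 or n). Such a t fails to
  exist on the letters 0, ..., max z only if these periodic sequences coincide, which means that
  \<pi> is collapsed, or if the only bound is the extremal sequence c 0 c 0 ... or 0 c 0 c ....

  For B, the digits of an orbit of T_(-\<beta>) give N <= floor B + 1. Conversely, a realization with N
  letters may be truncated and continued by 0 0 0 ...; then all its tails have values strictly inside
  the unit interval in base -N, and by continuity also in some smaller base, whence B < N.

  If N = n - 1, then the order of the first n - 2 positions is forced, which leaves four permutations.
  For all of them, and all permutations if n = 3, either an explicit eventually constant sequence
  with values strictly inside the unit interval in base -b, where b = b((n-2) ... 1 0 0 0 ...),
  shows B < b, or the digits n-2, ..., 1, 0 are forced and B = b.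
*)

theory Submission
  imports Defs
begin

section \<open>The alternating lexicographical order\<close>

text \<open>Dropping a letter reverses the alternating order, so equal letters must be followed by
  ranks in opposite order, and parities decide every construction. The condition L t < t has the
  unknown t on both sides; it is equivalent to a comparison of t with the periodic sequence of L, so
  that t is sought in an interval. If the two periodic bounds coincide, L and R commute and are
  powers of one word; the ranks at its block starts spiral around that of n, which leaves only L = R
  R or R = L L. For B, a description of all (-\<beta>)-expansions would involve the expansion of 1.
  Eventually constant sequences avoid it: the pattern depends on finitely many letters, the values
  of the tails obey a finite recursion, and the strict inequalities that turn letters into digits
  survive small changes of \<beta>. In base b the sequence (n-2) ... 1 0 0 0 ... has value 1, so the
  digit n - 2 may precede a value exactly if that value exceeds the one of (n-3) ... 1 0 0 0 ....
  Whether the pattern permits this depends on the parity of n, which selects the maximizing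
  permutation.\<close>

lemma alt_less_iff_first_diff:
  "alt_less v w \<longleftrightarrow> (\<exists>k. (\<forall>i<k. v !! i = w !! i) \<and>
     (if even k then v !! k < w !! k else w !! k < v !! k))"
  by (simp add: alt_less_def stake_eq_iff)

lemma alt_lessI:
  assumes "\<And>i. i < k \<Longrightarrow> v !! i = w !! i"
    and "if even k then v !! k < w !! k else w !! k < v !! k"
  shows "alt_less v w"
  using assms unfolding alt_less_iff_first_diff by blast

lemma alt_less_asym: "alt_less v w \<Longrightarrow> \<not> alt_less w v"
  using alt_less_irrefl alt_less_trans by blast

lemma first_diff_exists:
  fixes v w :: "'a stream"
  assumes "v \<noteq> w"
  obtains k where "\<forall>i<k. v !! i = w !! i" "v !! k \<noteq> w !! k"
proof -
  have ex: "\<exists>k. v !! k \<noteq> w !! k"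
    using assms by (metis smap_alt stream.map_ident)
  define k where "k = (LEAST k. v !! k \<noteq> w !! k)"
  have "v !! k \<noteq> w !! k"
    unfolding k_def using ex by (rule LeastI_ex)
  moreover have "\<forall>i<k. v !! i = w !! i"
    unfolding k_def using not_less_Least by blast
  ultimately show ?thesis
    using that by blast
qed

lemma alt_less_at_first_diff:
  assumes "\<forall>i<k. v !! i = w !! i" "v !! k \<noteq> w !! k"
  shows "alt_less v w \<longleftrightarrow> (if even k then v !! k < w !! k else w !! k < v !! k)"
proof
  assume "alt_less v w"
  then obtain j where j: "\<forall>i<j. v !! i = w !! i"
    "if even j then v !! j < w !! j else w !! j < v !! j"
    unfolding alt_less_iff_first_diff by blast
  have "v !! j \<noteq> w !! j"
    using j(2) by (auto split: if_splits)
  then have "j = k"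
    using assms j(1) by (metis linorder_neqE_nat)
  show "if even k then v !! k < w !! k else w !! k < v !! k"
    using j(2) unfolding \<open>j = k\<close> .
qed (use assms in \<open>auto intro: alt_lessI\<close>)

text \<open>Removing the first letter changes the parity of every position, hence the exchanged
  tails on the right.\<close>

lemma alt_less_SCons:
  "alt_less (x ## v) (y ## w) \<longleftrightarrow> x < y \<or> x = y \<and> alt_less w v"
proof (cases "x = y")
  case False
  have "alt_less (x ## v) (y ## w) \<longleftrightarrow> x < y"
    using alt_less_at_first_diff[of 0 "x ## v" "y ## w"] False by simp
  then show ?thesis
    using False by simp
next
  case True
  show ?thesis
  proof (cases "v = w")
    case True
    then show ?thesis
      using \<open>x = y\<close> by (simp add: alt_less_irrefl)
  next
    case False
    then obtain k where k: "\<forall>i<k. w !! i = v !! i" "w !! k \<noteq> v !! k"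
      by (metis first_diff_exists)
    have "\<forall>i<Suc k. (x ## v) !! i = (y ## w) !! i"
      using k(1) True by (auto simp: less_Suc_eq_0_disj)
    moreover have "(x ## v) !! Suc k \<noteq> (y ## w) !! Suc k"
      using k(2) by simp
    ultimately have "alt_less (x ## v) (y ## w) \<longleftrightarrow>
        (if even (Suc k) then v !! k < w !! k else w !! k < v !! k)"
      using alt_less_at_first_diff[of "Suc k" "x ## v" "y ## w"] by simp
    then show ?thesis
      using True alt_less_at_first_diff[OF k] by auto
  qed
qed

lemma alt_less_shift:
  "alt_less (xs @- v) (xs @- w) \<longleftrightarrow> (if even (length xs) then alt_less v w else alt_less w v)"
  by (induction xs arbitrary: v w) (auto simp: alt_less_SCons)

text \<open>A comparison is decided at the first difference; everything behind it may be altered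
  freely.\<close>

lemma alt_less_cong_prefix:
  assumes "alt_less v w" "\<forall>i<k. v !! i = w !! i" "v !! k \<noteq> w !! k"
    "\<forall>i\<le>k. v' !! i = v !! i" "\<forall>i\<le>k. w' !! i = w !! i"
  shows "alt_less v' w'"
  using assms alt_less_at_first_diff[OF assms(2,3)] by (intro alt_lessI[of k]) auto

lemma alt_less_smap_strict_mono:
  assumes "alt_less v w" "strict_mono_on A h" "sset v \<subseteq> A" "sset w \<subseteq> A"
  shows "alt_less (smap h v) (smap h w)"
proof -
  obtain k where k: "\<forall>i<k. v !! i = w !! i"
    "if even k then v !! k < w !! k else w !! k < v !! k"
    using assms(1) unfolding alt_less_iff_first_diff by blast
  have "v !! k \<in> A" "w !! k \<in> A"
    using assms(3,4) by (auto simp: sset_range)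
  then show ?thesis
    using k assms(2) by (intro alt_lessI[of k]) (auto simp: strict_mono_on_def)
qed

section \<open>Comparison with periodic and extremal sequences\<close>

lemma cycle_unfold: "xs \<noteq> [] \<Longrightarrow> cycle xs = xs @- cycle xs"
  by (rule cycle_decomp)

lemma stream_shift_fixed_unique:
  assumes "xs \<noteq> []" "s = xs @- s"
  shows "s = cycle xs"
proof (rule stream_eqI)
  fix i
  show "s !! i = cycle xs !! i"
  proof (induction i rule: less_induct)
    case (less i)
    show ?case
    proof (cases "i < length xs")
      case True
      then show ?thesis
        using assms cycle_unfold by (metis shift_snth_less)
    next
      case False
      then have "i - length xs < i"
        using assms(1) by (cases xs) auto
      then show ?thesis
        using False less[of "i - length xs"] assms cycle_unfold
        by (metis not_less shift_snth_ge)
    qed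
  qed
qed

text \<open>If \<open>t\<close> leaves \<open>cycle xs\<close> within the first period, then
  \<open>xs @- t\<close> and \<open>cycle xs\<close> agree up to that point. Otherwise
  \<open>t\<close> itself begins with \<open>xs\<close>, and removing this prefix affects both
  comparisons in the same way.\<close>

lemma alt_less_shift_iff_cycle:
  assumes "xs \<noteq> []"
  shows "(alt_less (xs @- t) t \<longleftrightarrow> alt_less (cycle xs) t) \<and>
    (alt_less t (xs @- t) \<longleftrightarrow> alt_less t (cycle xs))"
proof (cases "t = cycle xs")
  case True
  then show ?thesis
    using cycle_unfold[OF assms] by simp
next
  case False
  have *: "alt_less (xs @- t) t \<longleftrightarrow> alt_less (cycle xs) t"
    if "\<forall>i<k. t !! i = cycle xs !! i" "t !! k \<noteq> cycle xs !! k" for k t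
    using that
  proof (induction k arbitrary: t rule: less_induct)
    case (less k)
    show ?case
    proof (cases "k < length xs")
      case True
      have agree: "\<forall>i\<le>k. (xs @- t) !! i = cycle xs !! i"
        using True by (metis assms cycle_unfold le_less_trans shift_snth_less)
      then have d: "\<forall>i<k. (xs @- t) !! i = t !! i" "(xs @- t) !! k \<noteq> t !! k"
        "\<forall>i<k. cycle xs !! i = t !! i" "cycle xs !! k \<noteq> t !! k"
        using less.prems by auto
      show ?thesis
        using alt_less_at_first_diff[OF d(1,2)] alt_less_at_first_diff[OF d(3,4)] agree by auto
    next
      case False
      define s where "s = sdrop (length xs) t"
      have "stake (length xs) t = stake (length xs) (cycle xs)"
        unfolding stake_eq_iff using less.prems(1) False by auto
      also have "\<dots> = xs"
        by (metis assms cycle_unfold stake_shift length_stake stake_append append_Nil2 diff_self_eq_0 order_refl take_all stake.simps(1))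
      finally have t: "t = xs @- s"
        unfolding s_def by (metis stake_sdrop)
      have idx: "cycle xs !! (length xs + i) = cycle xs !! i" for i
        by (metis add_diff_cancel_left' assms cycle_unfold le_add1 shift_snth_ge)
      have sd: "\<forall>i<k - length xs. s !! i = cycle xs !! i" "s !! (k - length xs) \<noteq> cycle xs !! (k - length xs)"
      proof -
        show "\<forall>i<k - length xs. s !! i = cycle xs !! i"
        proof (intro allI impI)
          fix i assume "i < k - length xs"
          then have "t !! (length xs + i) = cycle xs !! (length xs + i)"
            using less.prems(1) by simp
          then show "s !! i = cycle xs !! i"
            by (simp add: idx s_def sdrop_snth)
        qed
        have "cycle xs !! k = cycle xs !! (k - length xs)"
          using idx[of "k - length xs"] False by simp
        moreover have "t !! k = s !! (k - length xs)"
          using False by (simp add: s_def sdrop_snth)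
        ultimately show "s !! (k - length xs) \<noteq> cycle xs !! (k - length xs)"
          using less.prems(2) by simp
      qed
      then have "s \<noteq> cycle xs"
        by auto
      then have "s \<noteq> xs @- s"
        using assms stream_shift_fixed_unique by blast
      have IH: "alt_less (xs @- s) s \<longleftrightarrow> alt_less (cycle xs) s"
        using less.IH[OF _ sd] False assms by (cases xs) auto
      \<comment> \<open>A prefix of odd length exchanges the two directions, so the opposite
        comparison is needed for \<open>s\<close> as well; it follows by totality, as
        \<open>s\<close> differs from both sequences.\<close>
      moreover have "alt_less s (xs @- s) \<longleftrightarrow> alt_less s (cycle xs)"
        using IH \<open>s \<noteq> cycle xs\<close> \<open>s \<noteq> xs @- s\<close> alt_less_linear alt_less_asym by metis
      moreover have "alt_less (xs @- t) t \<longleftrightarrow>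
          (if even (length xs) then alt_less (xs @- s) s else alt_less s (xs @- s))"
        using alt_less_shift[of xs "xs @- s" s] t by simp
      moreover have "alt_less (cycle xs) t \<longleftrightarrow>
          (if even (length xs) then alt_less (cycle xs) s else alt_less s (cycle xs))"
        using alt_less_shift[of xs "cycle xs" s] t cycle_unfold[OF assms] by simp
      ultimately show ?thesis
        by simp
    qed
  qed
  obtain k where "\<forall>i<k. t !! i = cycle xs !! i" "t !! k \<noteq> cycle xs !! k"
    using False first_diff_exists by blast
  then have 1: "alt_less (xs @- t) t \<longleftrightarrow> alt_less (cycle xs) t"
    using * by blast
  have "t \<noteq> xs @- t"
    using False assms stream_shift_fixed_unique by blast
  then show ?thesis
    using 1 False alt_less_linear alt_less_asym by metis
qed

lemmas alt_less_shift_self_iff = alt_less_shift_iff_cycle[THEN conjunct1]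
  and alt_less_self_shift_iff = alt_less_shift_iff_cycle[THEN conjunct2]

lemma cycle2: "cycle [a, b] = a ## cycle [b, a]"
  using cycle_Cons[of a "[b]"] by simp

lemma sdrop_cycle2: "sdrop k (cycle [a, b]) = (if even k then cycle [a, b] else cycle [b, a])"
proof (induction k arbitrary: a b)
  case (Suc k)
  then show ?case
    by (subst cycle2) simp
qed simp

lemma snth_cycle2: "cycle [a, b] !! k = (if even k then a else b)"
  using sdrop_cycle2[of k a b] by (metis cycle2 sdrop_simps(1) stream.sel(1))

lemma snth_cycle1: "cycle [a] !! k = a"
  by (induction k) (simp_all add: cycle.sel)

text \<open>The order favours large letters at even indices and small ones at odd indices, so
  \<open>c 0 c 0 ...\<close> is the largest sequence with letters up to \<open>c\<close>.\<close>

lemma cycle_max_not_less: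
  assumes "\<And>k. w !! k \<le> c"
  shows "\<not> alt_less (cycle [c, 0]) w"
proof
  assume "alt_less (cycle [c, 0]) w"
  then obtain k where "if even k then cycle [c, 0] !! k < w !! k else w !! k < cycle [c, 0] !! k"
    unfolding alt_less_iff_first_diff by blast
  then show False
    using assms[of k] by (auto simp: snth_cycle2 split: if_splits)
qed

lemma not_less_cycle_min:
  assumes "\<And>k. w !! k \<le> c"
  shows "\<not> alt_less w (cycle [0, c])"
proof
  assume "alt_less w (cycle [0, c])"
  then obtain k where "if even k then w !! k < cycle [0, c] !! k else cycle [0, c] !! k < w !! k"
    unfolding alt_less_iff_first_diff by blast
  then show False
    using assms[of k] by (auto simp: snth_cycle2 split: if_splits)
qed

lemma sdrop_length_cycle: "xs \<noteq> [] \<Longrightarrow> sdrop (length xs) (cycle xs) = cycle xs"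
  by (rule sdrop_cycle_eq)

text \<open>
  A point \<open>t\<close> close to \<open>cycle xs\<close> from above is obtained by following \<open>cycle xs\<close> for an even
  number of periods and then continuing with the largest sequence.
\<close>

lemma exists_between_cycle:
  assumes "xs \<noteq> []" "alt_less (cycle xs) Y" "\<And>k. cycle xs !! k \<le> c" "\<And>k. Y !! k \<le> c"
  obtains t where "alt_less (cycle xs) t" "alt_less t Y" "\<And>k. t !! k \<le> c"
proof -
  obtain k where k: "\<forall>i<k. cycle xs !! i = Y !! i" "cycle xs !! k \<noteq> Y !! k"
    using assms(2) first_diff_exists alt_less_irrefl by metis
  define t where "t = stake (2 * Suc k * length xs) (cycle xs) @- cycle [c, 0]"
  have len: "k < 2 * Suc k * length xs"
    using assms(1) by (cases xs) auto
  have "sdrop (j * length xs) (cycle xs) = cycle xs" for j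
    using assms(1) by (induction j) (simp_all add: sdrop_add[symmetric] sdrop_length_cycle)
  then have "cycle xs = stake (2 * Suc k * length xs) (cycle xs) @- cycle xs"
    by (metis stake_sdrop)
  \<comment> \<open>The existence of \<open>Y\<close> shows that \<open>cycle xs\<close> is not
    itself the largest sequence.\<close>
  moreover have "alt_less (cycle xs) (cycle [c, 0])"
    using assms(2) cycle_max_not_less[of Y c] cycle_max_not_less[of "cycle xs" c] assms(3,4) alt_less_linear
    by metis
  ultimately have 1: "alt_less (cycle xs) t"
    unfolding t_def by (smt (verit, best) alt_less_shift dvd_mult2 dvd_triv_left length_stake)
  have "\<forall>i\<le>k. t !! i = cycle xs !! i"
    unfolding t_def using len by (auto simp: shift_snth_less stake_nth simp del: mult_Suc_right)
  then have 2: "alt_less t Y"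
    using alt_less_cong_prefix[OF assms(2) k] by auto
  have "t !! i \<le> c" for i
    unfolding t_def using assms(3)
    by (cases "i < 2 * Suc k * length xs") (auto simp: shift_snth_less shift_snth_ge stake_nth snth_cycle2 simp del: mult_Suc_right)
  then show ?thesis
    using that 1 2 by blast
qed

text \<open>The first difference is at index \<open>q\<close>, where 1 meets 0. The parity of
  \<open>q\<close> will decide the order of the tails at \<open>n\<close> and \<open>n - 1\<close>
  in the downward patterns.\<close>

lemma alt_less_SCons_zero:
  "alt_less (replicate q 0 @- (1 ## s)) (0 ## replicate q 0 @- (1 ## s)) \<longleftrightarrow> odd q"
  "alt_less (0 ## replicate q 0 @- (1 ## s)) (replicate q 0 @- (1 ## s)) \<longleftrightarrow> even q"
  by (induction q) (auto simp: alt_less_SCons)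

section \<open>Patterns of sequences and the minimal word z\<close>

lemma card_filter_Suc:
  assumes "k \<ge> 1"
  shows "card {i \<in> {1..<Suc k}. P i} = card {i \<in> {1..<k}. P i} + (if P k then 1 else 0)"
proof -
  have "{i \<in> {1..<Suc k}. P i} = {i \<in> {1..<k}. P i} \<union> (if P k then {k} else {})"
    using assms by (auto simp: less_Suc_eq)
  moreover have "card ({i \<in> {1..<k}. P i} \<union> (if P k then {k} else {})) =
      card {i \<in> {1..<k}. P i} + (if P k then 1 else 0)"
    by auto
  ultimately show ?thesis
    by simp
qed

locale perm_pattern =
  fixes n :: nat and \<pi> :: "nat \<Rightarrow> nat"
  assumes n_ge: "n \<ge> 2" and perm: "\<pi> permutes {1..n}"
begin

abbreviation "z \<equiv> z_seq n \<pi>"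
abbreviation "l \<equiv> l_pos n \<pi>"
abbreviation "r \<equiv> r_pos n \<pi>"
abbreviation "m \<equiv> m_pos n \<pi>"

lemma pi_mem: "p \<in> {1..n} \<Longrightarrow> \<pi> p \<in> {1..n}"
  using permutes_in_image[OF perm] by blast

lemma pi_mem_lt: "p \<in> {1..<n} \<Longrightarrow> 1 \<le> \<pi> p \<and> \<pi> p \<le> n"
  using pi_mem[of p] by auto

lemma pi_n_mem: "1 \<le> \<pi> n \<and> \<pi> n \<le> n"
  using pi_mem[of n] n_ge by auto

lemma pi_inj: "\<pi> p = \<pi> q \<longleftrightarrow> p = q"
  using permutes_inj[OF perm] by (auto dest: injD)

lemma inv_mem: "i \<in> {1..n} \<Longrightarrow> inv \<pi> i \<in> {1..n}"
  using permutes_in_image[OF permutes_inv[OF perm]] by simp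

lemma pi_inv [simp]: "\<pi> (inv \<pi> i) = i" and inv_pi [simp]: "inv \<pi> (\<pi> i) = i"
  using permutes_inverses[OF perm] by auto

lemma l_props:
  assumes "\<pi> n \<noteq> 1"
  shows "l \<in> {1..<n}" "\<pi> l = \<pi> n - 1" "\<pi> l < \<pi> n"
proof -
  have "\<pi> n - 1 \<in> {1..n}"
    using assms pi_n_mem by auto
  then have "l \<in> {1..n}"
    unfolding l_pos_def by (rule inv_mem)
  moreover show p: "\<pi> l = \<pi> n - 1"
    by (simp add: l_pos_def)
  moreover show "\<pi> l < \<pi> n"
    using p pi_n_mem by linarith
  ultimately show "l \<in> {1..<n}"
    by (cases "l = n") auto
qed

lemma r_props:
  assumes "\<pi> n \<noteq> n"
  shows "r \<in> {1..<n}" "\<pi> r = \<pi> n + 1" "\<pi> n < \<pi> r"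
proof -
  have "\<pi> n + 1 \<in> {1..n}"
    using assms pi_n_mem by auto
  then have "r \<in> {1..n}"
    unfolding r_pos_def by (rule inv_mem)
  moreover show p: "\<pi> r = \<pi> n + 1"
    by (simp add: r_pos_def)
  moreover show "\<pi> n < \<pi> r"
    using p by linarith
  ultimately show "r \<in> {1..<n}"
    by (cases "r = n") auto
qed

lemma m_props: "m \<in> {1..n}" "\<pi> m = n"
  using n_ge inv_mem[of n] by (auto simp: m_pos_def)

text \<open>What the order of the tails demands of the first \<open>n - 1\<close> letters alone:
  compare first letters and, if they agree, the successors in the reversed order.\<close>

definition compat :: "(nat \<Rightarrow> nat) \<Rightarrow> bool" where
  "compat y \<longleftrightarrow> (\<forall>p\<in>{1..<n}. \<forall>q\<in>{1..<n}. \<pi> p < \<pi> q \<longrightarrow>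
     y p \<le> y q \<and> (y p = y q \<longrightarrow> \<pi> (Suc q) < \<pi> (Suc p)))"

lemma compatD:
  assumes "compat y" "p \<in> {1..<n}" "q \<in> {1..<n}" "\<pi> p < \<pi> q"
  shows "y p \<le> y q" "y p = y q \<Longrightarrow> \<pi> (Suc q) < \<pi> (Suc p)"
  using assms unfolding compat_def by blast+

abbreviation tail :: "nat stream \<Rightarrow> nat \<Rightarrow> nat stream" where
  "tail w p \<equiv> sdrop (p - 1) w"

lemma tail_Suc: "p \<ge> 1 \<Longrightarrow> tail w p = w !! (p - 1) ## tail w (Suc p)"
  by (metis One_nat_def Suc_le_D diff_Suc_1' sdrop_simps(1) sdrop_simps(2) stream.collapse)

lemma is_shift_patD:
  assumes "is_shift_pat w n \<pi>" "p \<in> {1..n}" "q \<in> {1..n}" "\<pi> p < \<pi> q"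
  shows "alt_less (tail w p) (tail w q)"
proof -
  have "alt_less (tail w (inv \<pi> i)) (tail w (inv \<pi> (Suc (i + d))))"
    if "i \<ge> 1" "Suc (i + d) \<le> n" for i d
    using that
  proof (induction d)
    case 0
    then show ?case
      using assms(1) by (auto simp: is_shift_pat_def)
  next
    case (Suc d)
    then have "alt_less (tail w (inv \<pi> i)) (tail w (inv \<pi> (Suc (i + d))))"
      by simp
    moreover have "alt_less (tail w (inv \<pi> (Suc (i + d)))) (tail w (inv \<pi> (Suc (Suc (i + d)))))"
      using assms(1) Suc.prems by (auto simp: is_shift_pat_def)
    ultimately show ?case
      unfolding add_Suc_right by (rule alt_less_trans)
  qed
  from this[of "\<pi> p" "\<pi> q - Suc (\<pi> p)"] show ?thesis
    using assms(2-4) pi_mem[of p] pi_mem[of q] by simp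
qed

lemma is_shift_patI:
  assumes "\<And>p q. p \<in> {1..n} \<Longrightarrow> q \<in> {1..n} \<Longrightarrow> \<pi> p < \<pi> q \<Longrightarrow> alt_less (tail w p) (tail w q)"
  shows "is_shift_pat w n \<pi>"
  unfolding is_shift_pat_def
proof (intro conjI ballI)
  fix i assume i: "i \<in> {1..<n}"
  show "alt_less (tail w (inv \<pi> i)) (tail w (inv \<pi> (i + 1)))"
    using i inv_mem[of i] inv_mem[of "i + 1"] by (intro assms) auto
qed (rule perm)

lemma is_shift_pat_compat:
  assumes "is_shift_pat w n \<pi>"
  shows "compat (\<lambda>j. w !! (j - 1))"
  unfolding compat_def
proof (intro ballI impI)
  fix p q assume pq: "p \<in> {1..<n}" "q \<in> {1..<n}" "\<pi> p < \<pi> q"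
  have "alt_less (w !! (p - 1) ## tail w (Suc p)) (w !! (q - 1) ## tail w (Suc q))"
    using is_shift_patD[OF assms, of p q] pq tail_Suc[of p w] tail_Suc[of q w] by simp
  then have *: "w !! (p - 1) < w !! (q - 1) \<or>
      w !! (p - 1) = w !! (q - 1) \<and> alt_less (tail w (Suc q)) (tail w (Suc p))"
    by (simp add: alt_less_SCons)
  have "\<pi> (Suc q) < \<pi> (Suc p)" if "w !! (p - 1) = w !! (q - 1)"
  proof (rule ccontr)
    assume "\<not> ?thesis"
    then have "\<pi> (Suc p) < \<pi> (Suc q)"
      using pq(3) pi_inj by (metis Suc_inject less_irrefl linorder_neqE_nat)
    then have "alt_less (tail w (Suc p)) (tail w (Suc q))"
      using is_shift_patD[OF assms, of "Suc p" "Suc q"] pq by simp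
    then show False
      using * that alt_less_asym by auto
  qed
  then show "w !! (p - 1) \<le> w !! (q - 1) \<and> (w !! (p - 1) = w !! (q - 1) \<longrightarrow> \<pi> (Suc q) < \<pi> (Suc p))"
    using * by auto
qed

text \<open>
  By induction on the first index where two tails differ: a wrong comparison with the tail at
  \<open>n\<close> yields one with a rank neighbour of \<open>n\<close>, which differs no later; a wrong comparison of two
  other tails passes to their successors.
\<close>

lemma tails_ordered:
  assumes y: "compat y" "\<And>j. j \<in> {1..<n} \<Longrightarrow> w !! (j - 1) = y j"
    and below: "\<And>p. p \<in> {1..<n} \<Longrightarrow> Suc (\<pi> p) = \<pi> n \<Longrightarrow> alt_less (tail w p) (tail w n)"
    and above: "\<And>p. p \<in> {1..<n} \<Longrightarrow> \<pi> p = Suc (\<pi> n) \<Longrightarrow> alt_less (tail w n) (tail w p)"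
  shows "is_shift_pat w n \<pi>"
proof -
  have diff: "\<not> alt_less (tail w q) (tail w p)"
    if "\<forall>i<k. tail w p !! i = tail w q !! i" "tail w p !! k \<noteq> tail w q !! k"
      "p \<in> {1..n}" "q \<in> {1..n}" "\<pi> p < \<pi> q" for k p q
    using that
  proof (induction k arbitrary: p q rule: less_induct)
    case (less k)
    have inner: "\<not> alt_less (tail w q) (tail w p)"
      if "\<forall>i<j. tail w p !! i = tail w q !! i" "tail w p !! j \<noteq> tail w q !! j"
        "p \<in> {1..<n}" "q \<in> {1..<n}" "\<pi> p < \<pi> q" "j \<le> k" for j p q
    proof
      assume "alt_less (tail w q) (tail w p)"
      then have "alt_less (y q ## tail w (Suc q)) (y p ## tail w (Suc p))"
        using that(3,4) y(2) tail_Suc[of p w] tail_Suc[of q w] by simp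
      then have eq: "y p = y q" and lt: "alt_less (tail w (Suc p)) (tail w (Suc q))"
        using compatD(1)[OF y(1) that(3,4,5)] by (auto simp: alt_less_SCons)
      have tl: "tail w p = y p ## tail w (Suc p)" "tail w q = y q ## tail w (Suc q)"
        using that(3,4) y(2) tail_Suc[of p w] tail_Suc[of q w] by simp_all
      have "j \<noteq> 0"
        using that(2) eq tl by (metis snth.simps(1) stream.sel(1))
      then obtain i where i: "j = Suc i"
        by (cases j) auto
      have "\<forall>x<i. tail w (Suc p) !! x = tail w (Suc q) !! x"
        using that(1) tl unfolding i by (metis Suc_less_eq snth_Stream)
      moreover have "tail w (Suc p) !! i \<noteq> tail w (Suc q) !! i"
        using that(2) tl unfolding i by (metis snth_Stream)
      moreover have "\<pi> (Suc q) < \<pi> (Suc p)"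
        by (rule compatD(2)[OF y(1) that(3,4,5) eq])
      ultimately have "\<not> alt_less (tail w (Suc p)) (tail w (Suc q))"
        using less.IH[of i "Suc q" "Suc p"] that(3,4,6) i by auto
      then show False
        using lt by contradiction
    qed
    consider "p \<noteq> n" "q \<noteq> n" | "q = n" "p \<noteq> n" | "p = n" "q \<noteq> n"
      using less.prems(5) by blast
    then show ?case
    proof cases
      case 1
      then show ?thesis
        using inner[of k p q] less.prems by auto
    next
      case 2
      show ?thesis
      proof
        assume wrong: "alt_less (tail w q) (tail w p)"
        have n1: "\<pi> n \<noteq> 1"
          using less.prems(3,5) 2 pi_mem[of p] by auto
        note l = l_props[OF n1]
        have "alt_less (tail w l) (tail w n)"
          using below l pi_n_mem n1 by auto
        moreover from this have "p \<noteq> l"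
          using wrong 2 alt_less_asym by blast
        then have "\<pi> p < \<pi> l"
          using less.prems(5) l(2) 2 pi_inj[of p l] by auto
        moreover have wl: "alt_less (tail w l) (tail w p)"
          using alt_less_trans calculation(1) wrong 2 by blast
        moreover obtain j where j: "\<forall>i<j. tail w p !! i = tail w l !! i" "tail w p !! j \<noteq> tail w l !! j"
          using wl alt_less_irrefl first_diff_exists by metis
        \<comment> \<open>Otherwise the tail at \<open>l\<close> agrees with the tail at
          \<open>p\<close> up to index \<open>k\<close> and inherits its wrong position relative to
          the tail at \<open>n\<close>.\<close>
        moreover have "j \<le> k"
        proof (rule ccontr)
          assume "\<not> j \<le> k"
          then have "\<forall>i\<le>k. tail w p !! i = tail w l !! i"
            using j(1) by auto
          then have "\<forall>i<k. tail w n !! i = tail w p !! i" "tail w n !! k \<noteq> tail w p !! k"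
            "\<forall>i\<le>k. tail w l !! i = tail w p !! i"
            using less.prems(1,2) 2 by simp_all
          then have "alt_less (tail w n) (tail w l)"
            using alt_less_cong_prefix[of "tail w n" "tail w p" k "tail w n" "tail w l"] wrong 2 by simp
          then show False
            using calculation(1) alt_less_asym by blast
        qed
        ultimately show False
          using inner[of j p l] l(1) 2 less.prems(3) by auto
      qed
    next
      case 3
      show ?thesis
      proof
        assume wrong: "alt_less (tail w q) (tail w p)"
        have n1: "\<pi> n \<noteq> n"
          using less.prems(4,5) 3 pi_mem[of q] by auto
        note r = r_props[OF n1]
        have "alt_less (tail w n) (tail w r)"
          using above r by auto
        moreover from this have "q \<noteq> r"
          using wrong 3 alt_less_asym by blast
        then have "\<pi> r < \<pi> q"
          using less.prems(5) r(2) 3 pi_inj[of q r] by auto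
        moreover have wl: "alt_less (tail w q) (tail w r)"
          using alt_less_trans calculation(1) wrong 3 by blast
        moreover obtain j where j: "\<forall>i<j. tail w r !! i = tail w q !! i" "tail w r !! j \<noteq> tail w q !! j"
          using wl alt_less_irrefl first_diff_exists by metis
        moreover have "j \<le> k"
        proof (rule ccontr)
          assume "\<not> j \<le> k"
          then have "\<forall>i\<le>k. tail w r !! i = tail w q !! i"
            using j(1) by auto
          then have "\<forall>i<k. tail w q !! i = tail w n !! i" "tail w q !! k \<noteq> tail w n !! k"
            "\<forall>i\<le>k. tail w r !! i = tail w q !! i"
            using less.prems(1,2) 3 by simp_all
          then have "alt_less (tail w r) (tail w n)"
            using alt_less_cong_prefix[of "tail w q" "tail w n" k "tail w r" "tail w n"] wrong 3 by simp
          then show False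
            using calculation(1) alt_less_asym by blast
        qed
        ultimately show False
          using inner[of j r q] r(1) 3 less.prems(4) by auto
      qed
    qed
  qed
  have wrong: "\<not> alt_less (tail w q) (tail w p)"
    if "p \<in> {1..n}" "q \<in> {1..n}" "\<pi> p < \<pi> q" for p q
  proof
    assume lt: "alt_less (tail w q) (tail w p)"
    then obtain k where "\<forall>i<k. tail w p !! i = tail w q !! i" "tail w p !! k \<noteq> tail w q !! k"
      using alt_less_irrefl first_diff_exists by metis
    then show False
      using diff that lt by blast
  qed
  \<comment> \<open>A tail equal to the one at \<open>n\<close> would lie on the wrong side of the
    tail at a rank neighbour of \<open>n\<close>.\<close>
  have neq_n: "tail w p \<noteq> tail w n" if "p \<in> {1..<n}" for p
  proof
    assume eq: "tail w p = tail w n"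
    have "\<pi> p \<noteq> \<pi> n"
      using that pi_inj by auto
    then consider "\<pi> p < \<pi> n" | "\<pi> n < \<pi> p"
      by linarith
    then show False
    proof cases
      case 1
      then have n1: "\<pi> n \<noteq> 1"
        using that pi_mem_lt[of p] by auto
      note l = l_props[OF n1]
      have "alt_less (tail w l) (tail w n)"
        using below l pi_n_mem n1 by auto
      moreover from this have "p \<noteq> l"
        using eq alt_less_irrefl by auto
      then have "\<pi> p < \<pi> l"
        using 1 l(2) pi_inj[of p l] by auto
      ultimately show False
        using wrong[of p l] that l(1) eq by auto
    next
      case 2
      then have n1: "\<pi> n \<noteq> n"
        using that pi_mem_lt[of p] by auto
      note r = r_props[OF n1]
      have "alt_less (tail w n) (tail w r)"
        using above r by auto
      moreover from this have "p \<noteq> r"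
        using eq alt_less_irrefl by auto
      then have "\<pi> r < \<pi> p"
        using 2 r(2) pi_inj[of p r] by auto
      ultimately show False
        using wrong[of r p] that r(1) eq by auto
    qed
  qed
  \<comment> \<open>Dropping \<open>n - q\<close> further letters moves an equality of tails at
    \<open>p < q\<close> to one between the tail at \<open>n\<close> and an earlier tail.\<close>
  have neq: "tail w p \<noteq> tail w q" if "p \<in> {1..n}" "q \<in> {1..n}" "p < q" for p q
  proof
    assume eq: "tail w p = tail w q"
    have "tail w (p + (n - q)) = sdrop (n - q) (tail w p)"
      using that by (simp add: sdrop_add)
    also have "\<dots> = tail w n"
      using that unfolding eq by (simp add: sdrop_add)
    finally have "tail w (p + (n - q)) = tail w n" .
    moreover have "p + (n - q) \<in> {1..<n}"
      using that by auto
    ultimately show False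
      using neq_n by blast
  qed
  show ?thesis
  proof (rule is_shift_patI)
    fix p q assume pq: "p \<in> {1..n}" "q \<in> {1..n}" "\<pi> p < \<pi> q"
    then have "tail w p \<noteq> tail w q"
      using neq[of p q] neq[of q p] by (cases p q rule: linorder_cases) auto
    then show "alt_less (tail w p) (tail w q)"
      using wrong[OF pq] alt_less_linear by blast
  qed
qed

text \<open>The ranks after which \<open>z\<close> jumps. Position \<open>n\<close> carries no
  letter of \<open>z\<close>, so the two gaps around its rank count as one, from \<open>l\<close> to
  \<open>r\<close>, which is charged to the rank \<open>\<pi> n - 1\<close>.\<close>

definition inc :: "nat \<Rightarrow> bool" where
  "inc i \<longleftrightarrow> (i \<noteq> \<pi> n \<and> \<pi> n \<noteq> i + 1 \<and> \<pi> (inv \<pi> i + 1) < \<pi> (inv \<pi> (i + 1) + 1)) \<or>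
     (i + 1 = \<pi> n \<and> \<pi> n \<noteq> n \<and> \<pi> (l + 1) < \<pi> (r + 1))"

lemma z_eq_card_inc: "z j = card {i \<in> {1..<\<pi> j}. inc i}"
  by (simp add: z_seq_def inc_def)

text \<open>Between \<open>\<pi> p\<close> and \<open>\<pi> q\<close> there can only be the rank of
  \<open>n\<close>; the two possibilities correspond to the two disjuncts of
  \<open>inc\<close>.\<close>

lemma z_adjacent:
  assumes p: "p \<in> {1..<n}" and q: "q \<in> {1..<n}" "\<pi> p < \<pi> q"
    and adj: "\<And>j. j \<in> {1..<n} \<Longrightarrow> \<not> (\<pi> p < \<pi> j \<and> \<pi> j < \<pi> q)"
  shows "z q = z p + (if \<pi> (Suc p) < \<pi> (Suc q) then 1 else 0)"
proof (cases "\<pi> q = Suc (\<pi> p)")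
  case True
  have "inv \<pi> (\<pi> p) = p" "inv \<pi> (Suc (\<pi> p)) = q"
    using True by (metis inv_pi)+
  moreover have "\<pi> p \<noteq> \<pi> n" "\<pi> n \<noteq> Suc (\<pi> p)"
    using p q True pi_inj by (metis atLeastLessThan_iff less_irrefl)+
  ultimately have "inc (\<pi> p) \<longleftrightarrow> \<pi> (Suc p) < \<pi> (Suc q)"
    by (auto simp: inc_def)
  then show ?thesis
    using pi_mem_lt[OF p] card_filter_Suc[of "\<pi> p" inc] unfolding z_eq_card_inc True by auto
next
  case False
  have n_between: "\<pi> n = i" if "\<pi> p < i" "i < \<pi> q" for i
  proof -
    have "i \<in> {1..n}"
      using that pi_mem_lt[OF q(1)] by auto
    then have "inv \<pi> i \<in> {1..n}"
      by (rule inv_mem)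
    then show ?thesis
      using adj[of "inv \<pi> i"] that by (cases "inv \<pi> i = n") auto
  qed
  have pn: "\<pi> n = Suc (\<pi> p)"
    using n_between[of "Suc (\<pi> p)"] False q(2) by simp
  have pq: "\<pi> q = Suc (Suc (\<pi> p))"
    using n_between[of "Suc (Suc (\<pi> p))"] pn False q(2) by linarith
  have "l = p" "r = q"
    unfolding l_pos_def r_pos_def using pn pq by (metis diff_Suc_1 inv_pi, metis Suc_eq_plus1 inv_pi)
  moreover have "\<pi> n \<noteq> n"
    using pq pn pi_mem_lt[OF q(1)] by auto
  ultimately have "inc (\<pi> p) \<longleftrightarrow> \<pi> (Suc p) < \<pi> (Suc q)" "\<not> inc (Suc (\<pi> p))"
    using pn by (auto simp: inc_def)
  then show ?thesis
    using pi_mem_lt[OF p] card_filter_Suc[of "\<pi> p" inc] card_filter_Suc[of "Suc (\<pi> p)" inc]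
    unfolding z_eq_card_inc pq by auto
qed

lemma z_lowest:
  assumes "q \<in> {1..<n}" "\<And>j. j \<in> {1..<n} \<Longrightarrow> \<not> \<pi> j < \<pi> q"
  shows "z q = 0"
proof -
  have "\<pi> n = i" if "i \<in> {1..<\<pi> q}" for i
  proof -
    have "i \<in> {1..n}"
      using that pi_mem_lt[OF assms(1)] by auto
    then have "inv \<pi> i \<in> {1..n}"
      by (rule inv_mem)
    then show ?thesis
      using assms(2)[of "inv \<pi> i"] that by (cases "inv \<pi> i = n") auto
  qed
  moreover have "\<not> inc (\<pi> n)"
    by (simp add: inc_def)
  ultimately have "{i \<in> {1..<\<pi> q}. inc i} = {}"
    by blast
  then show ?thesis
    unfolding z_eq_card_inc by (metis card.empty)
qed

text \<open>Here \<open>q'\<close> is the predecessor of \<open>q\<close> in rank among the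
  positions before \<open>n\<close>. This is the step of all inductions over ranks.\<close>

lemma z_step:
  assumes p: "p \<in> {1..<n}" and q: "q \<in> {1..<n}" "\<pi> p < \<pi> q"
  obtains q' where "q' \<in> {1..<n}" "\<pi> p \<le> \<pi> q'" "\<pi> q' < \<pi> q"
    "z q = z q' + (if \<pi> (Suc q') < \<pi> (Suc q) then 1 else 0)"
proof -
  define A where "A = {j \<in> {1..<n}. \<pi> j < \<pi> q}"
  have A: "finite A" "p \<in> A"
    using p q(2) by (auto simp: A_def)
  then have "Max (\<pi> ` A) \<in> \<pi> ` A"
    by (intro Max_in) auto
  then obtain q' where q': "q' \<in> A" "\<pi> q' = Max (\<pi> ` A)"
    by fastforce
  have max: "\<pi> j \<le> \<pi> q'" if "j \<in> A" for j
    using that A(1) q'(2) by simp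
  have "z q = z q' + (if \<pi> (Suc q') < \<pi> (Suc q) then 1 else 0)"
  proof (rule z_adjacent)
    show "\<not> (\<pi> q' < \<pi> j \<and> \<pi> j < \<pi> q)" if "j \<in> {1..<n}" for j
      using max[of j] that by (auto simp: A_def)
  qed (use q q'(1) in \<open>auto simp: A_def\<close>)
  then show ?thesis
    using that[of q'] q'(1) max[OF A(2)] by (auto simp: A_def)
qed

lemma compat_z: "compat z"
  unfolding compat_def
proof (intro ballI impI)
  fix p q assume p: "p \<in> {1..<n}" and q: "q \<in> {1..<n}" "\<pi> p < \<pi> q"
  then show "z p \<le> z q \<and> (z p = z q \<longrightarrow> \<pi> (Suc q) < \<pi> (Suc p))"
  proof (induction "\<pi> q" arbitrary: q rule: less_induct)
    case less
    obtain q' where q': "q' \<in> {1..<n}" "\<pi> p \<le> \<pi> q'" "\<pi> q' < \<pi> q"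
      "z q = z q' + (if \<pi> (Suc q') < \<pi> (Suc q) then 1 else 0)"
      using z_step less.prems by metis
    have "Suc q' \<noteq> Suc q"
      using q'(3) by auto
    then have ne: "\<pi> (Suc q') \<noteq> \<pi> (Suc q)"
      by (simp only: pi_inj not_False_eq_True)
    show ?case
    proof (cases "\<pi> p = \<pi> q'")
      case True
      then have "p = q'"
        by (simp only: pi_inj)
      then show ?thesis
        using q'(4) ne by auto
    next
      case False
      then have "z p \<le> z q' \<and> (z p = z q' \<longrightarrow> \<pi> (Suc q') < \<pi> (Suc p))"
        using less.hyps[OF q'(3) p q'(1)] q'(2) by simp
      then show ?thesis
        using q'(4) ne by (auto split: if_splits)
    qed
  qed
qed

text \<open>This is \<open>z q - z p \<le> y q - y p\<close> without subtraction: wherever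
  \<open>z\<close> jumps, compatibility forces \<open>y\<close> to increase too.\<close>

lemma z_minimal:
  assumes y: "compat y" and p: "p \<in> {1..<n}" and q: "q \<in> {1..<n}" "\<pi> p < \<pi> q"
  shows "y p + z q \<le> y q + z p"
  using q
proof (induction "\<pi> q" arbitrary: q rule: less_induct)
  case less
  obtain q' where q': "q' \<in> {1..<n}" "\<pi> p \<le> \<pi> q'" "\<pi> q' < \<pi> q"
    "z q = z q' + (if \<pi> (Suc q') < \<pi> (Suc q) then 1 else 0)"
    using z_step p less.prems by metis
  have "y p + z q' \<le> y q' + z p"
  proof (cases "\<pi> p = \<pi> q'")
    case True
    then have "p = q'"
      by (simp only: pi_inj)
    then show ?thesis
      by simp
  next
    case False
    then show ?thesis
      using less.hyps[OF q'(3) q'(1)] q'(2) by simp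
  qed
  moreover have "y q' + (if \<pi> (Suc q') < \<pi> (Suc q) then 1 else 0) \<le> y q"
    using compatD[OF y q'(1) less.prems(1) q'(3)] by (cases "y q' = y q") auto
  ultimately show ?case
    using q'(4) by linarith
qed

definition "c = Max (z ` {1..<n})"

lemma z_le_c: "j \<in> {1..<n} \<Longrightarrow> z j \<le> c"
  by (simp add: c_def)

lemma c_attained: obtains j where "j \<in> {1..<n}" "z j = c"
proof -
  have "c \<in> z ` {1..<n}"
    unfolding c_def using n_ge by (intro Max_in) auto
  then show ?thesis
    using that by fastforce
qed

lemma zero_attained:
  obtains j where "j \<in> {1..<n}" "z j = 0" "\<And>p. p \<in> {1..<n} \<Longrightarrow> \<pi> j \<le> \<pi> p"
proof -
  have "Min (\<pi> ` {1..<n}) \<in> \<pi> ` {1..<n}"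
    using n_ge by (intro Min_in) auto
  then obtain j where j: "j \<in> {1..<n}" "\<pi> j = Min (\<pi> ` {1..<n})"
    by fastforce
  then have "\<pi> j \<le> \<pi> p" if "p \<in> {1..<n}" for p
    using that by simp
  then show ?thesis
    using that[of j] j(1) z_lowest[of j] by (metis leD)
qed

lemma compat_ge_z:
  assumes y: "compat y" and q: "q \<in> {1..<n}"
  shows "z q \<le> y q"
proof -
  obtain j where j: "j \<in> {1..<n}" "z j = 0" "\<And>p. p \<in> {1..<n} \<Longrightarrow> \<pi> j \<le> \<pi> p"
    using zero_attained by blast
  show ?thesis
  proof (cases "q = j")
    case False
    then have "\<pi> j < \<pi> q"
      using j(3)[OF q] pi_inj[of q j] by linarith
    then show ?thesis
      using z_minimal[OF y j(1) q] j(2) by simp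
  qed (use j(2) in simp)
qed

text \<open>Above the rank of \<open>p\<close>, the word \<open>y\<close> still has to rise by at
  least as much as \<open>z\<close>, which reaches \<open>c\<close>. A bound of \<open>c\<close> on
  \<open>y\<close> therefore excludes \<open>z p < y p\<close>.\<close>

lemma compat_le_c_eq_z:
  assumes y: "compat y" "\<And>j. j \<in> {1..<n} \<Longrightarrow> y j \<le> c" and p: "p \<in> {1..<n}"
  shows "y p = z p"
proof -
  obtain j where j: "j \<in> {1..<n}" "z j = c"
    by (rule c_attained)
  have "y p \<le> z p"
  proof (cases "\<pi> p < \<pi> j")
    case True
    then show ?thesis
      using z_minimal[OF y(1) p j(1) True] y(2)[OF j(1)] j(2) by simp
  next
    case False
    then have "p = j \<or> \<pi> j < \<pi> p"
      using pi_inj[of p j] by auto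
    then have "z j \<le> z p"
      using compatD(1)[OF compat_z j(1) p] by auto
    then show ?thesis
      using y(2)[OF p] j(2) by simp
  qed
  then show ?thesis
    using compat_ge_z[OF y(1) p] by simp
qed

text \<open>Since \<open>z\<close> rises by at most one per rank step, some step between
  \<open>p\<close> and \<open>q\<close> leaves the value \<open>z p\<close>; by the definition of
  \<open>z\<close> the successors at this step are in the same order.\<close>

lemma z_level:
  assumes p: "p \<in> {1..<n}" and q: "q \<in> {1..<n}" "z p < z q"
  obtains p' q' where "p' \<in> {1..<n}" "q' \<in> {1..<n}" "z p' = z p" "z q' = Suc (z p)"
    "\<pi> p \<le> \<pi> p'" "\<pi> p' < \<pi> q'" "\<pi> q' \<le> \<pi> q" "\<pi> (Suc p') < \<pi> (Suc q')"
proof -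
  have lt: "\<pi> p < \<pi> q" if "q \<in> {1..<n}" "z p < z q" for q
  proof (rule ccontr)
    assume "\<not> \<pi> p < \<pi> q"
    then have "p = q \<or> \<pi> q < \<pi> p"
      using pi_inj[of p q] by auto
    then show False
      using compatD(1)[OF compat_z that(1) p] that(2) by auto
  qed
  have "\<exists>p' q'. p' \<in> {1..<n} \<and> q' \<in> {1..<n} \<and> z p' = z p \<and> z q' = Suc (z p) \<and>
    \<pi> p \<le> \<pi> p' \<and> \<pi> p' < \<pi> q' \<and> \<pi> q' \<le> \<pi> q \<and> \<pi> (Suc p') < \<pi> (Suc q')"
    using q
  proof (induction "\<pi> q" arbitrary: q rule: less_induct)
    case less
    obtain q' where q': "q' \<in> {1..<n}" "\<pi> p \<le> \<pi> q'" "\<pi> q' < \<pi> q"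
      "z q = z q' + (if \<pi> (Suc q') < \<pi> (Suc q) then 1 else 0)"
      using z_step p less.prems lt by metis
    show ?case
    proof (cases "z p < z q'")
      case True
      then show ?thesis
        using less.hyps[OF q'(3) q'(1)] q'(3) by (meson le_trans less_imp_le)
    next
      case False
      moreover have "z p \<le> z q'"
        using compatD(1)[OF compat_z p q'(1)] q'(2) pi_inj[of p q'] by (cases "p = q'") auto
      ultimately show ?thesis
        using q' less.prems by (intro exI[of _ q'] exI[of _ q]) (auto split: if_splits)
    qed
  qed
  then show ?thesis
    using that by blast
qed

lemma z_surj: "z ` {1..<n} = {0..c}"
proof
  show "z ` {1..<n} \<subseteq> {0..c}"
    using z_le_c by auto
  obtain j where j: "j \<in> {1..<n}" "z j = 0"
    using zero_attained by blast
  obtain k where k: "k \<in> {1..<n}" "z k = c"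
    by (rule c_attained)
  have "v \<le> c \<longrightarrow> v \<in> z ` {1..<n}" for v
  proof (induction v)
    case 0
    then show ?case
      using j by force
  next
    case (Suc v)
    show ?case
    proof
      assume "Suc v \<le> c"
      then obtain p where p: "p \<in> {1..<n}" "z p = v"
        using Suc by fastforce
      then show "Suc v \<in> z ` {1..<n}"
        using z_level[OF p(1) k(1)] k(2) \<open>Suc v \<le> c\<close> by (metis Suc_le_eq image_eqI)
    qed
  qed
  then show "{0..c} \<subseteq> z ` {1..<n}"
    by auto
qed

lemma c_le: "c \<le> n - 2"
proof -
  have "Suc c = card (z ` {1..<n})"
    using z_surj by simp
  also have "\<dots> \<le> n - 1"
    using card_image_le[of "{1..<n}" z] by simp
  finally show ?thesis
    by simp
qed


section \<open>The number of letters and continuations of the minimal word\<close>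

lemma N_minus_le:
  assumes "is_shift_pat w n \<pi>" "\<And>i. w !! i < k"
  shows "N_minus n \<pi> \<le> k"
proof -
  have sub: "sset w \<subseteq> {..<k}"
    using assms(2) by (auto simp: sset_range)
  then have "finite (sset w)" "card (sset w) \<le> k"
    using finite_subset[OF sub] card_mono[OF _ sub] by auto
  then show ?thesis
    unfolding N_minus_def using assms(1)
    by (intro le_trans[OF Least_le[of _ "card (sset w)"]]) blast+
qed

text \<open>A realization with the least number of letters may use large letters. Replacing each
  letter by its rank among those used is strictly increasing and keeps the pattern.\<close>

lemma N_minus_witness:
  assumes "is_shift_pat w0 n \<pi>" "\<And>i. w0 !! i < k"
  obtains w where "is_shift_pat w n \<pi>" "\<And>i. w !! i < N_minus n \<pi>"
proof -
  let ?P = "\<lambda>k. \<exists>w. is_shift_pat w n \<pi> \<and> finite (sset w) \<and> card (sset w) = k"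
  have "finite (sset w0)"
    using assms(2) finite_subset[of "sset w0" "{..<k}"] by (auto simp: sset_range)
  then have "?P (card (sset w0))"
    using assms(1) by blast
  then have "?P (N_minus n \<pi>)"
    unfolding N_minus_def by (rule LeastI)
  then obtain w where w: "is_shift_pat w n \<pi>" "finite (sset w)" "card (sset w) = N_minus n \<pi>"
    by blast
  define h where "h x = card {y \<in> sset w. y < x}" for x
  have mono: "strict_mono_on (sset w) h"
  proof (rule strict_mono_onI)
    fix x y assume "x \<in> sset w" "y \<in> sset w" "x < y"
    then show "h x < h y"
      unfolding h_def using w(2) by (intro psubset_card_mono) auto
  qed
  have "alt_less (tail (smap h w) p) (tail (smap h w) q)"
    if "p \<in> {1..n}" "q \<in> {1..n}" "\<pi> p < \<pi> q" for p q
    unfolding sdrop_smap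
    by (rule alt_less_smap_strict_mono[OF is_shift_patD[OF w(1) that] mono])
      (auto simp: sset_range sdrop_snth)
  then have "is_shift_pat (smap h w) n \<pi>"
    by (rule is_shift_patI)
  moreover have "smap h w !! i < N_minus n \<pi>" for i
  proof -
    have i: "w !! i \<in> sset w"
      by (auto simp: sset_range)
    have "{y \<in> sset w. y < w !! i} \<subset> sset w"
    proof (rule psubsetI)
      show "{y \<in> sset w. y < w !! i} \<noteq> sset w"
        using i by blast
    qed blast
    then have "h (w !! i) < N_minus n \<pi>"
      unfolding h_def w(3)[symmetric] by (rule psubset_card_mono[OF w(2)])
    then show ?thesis
      by simp
  qed
  ultimately show ?thesis
    by (rule that)
qed

lemma length_seg [simp]: "length (seg y i j) = j - i"
  by (simp add: seg_def)

lemma seg_nth: "i + k < j \<Longrightarrow> seg y i j ! k = y (i + k)"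
  by (simp add: seg_def)

lemma seg_append: "i \<le> j \<Longrightarrow> j \<le> k \<Longrightarrow> seg y i k = seg y i j @ seg y j k"
  unfolding seg_def map_append[symmetric] by (use upt_add_eq_append[of i j "k - j"] in simp)

lemma seg_Cons: "i < j \<Longrightarrow> seg y i j = y i # seg y (Suc i) j"
  by (simp add: seg_def upt_conv_Cons)

lemma seg_Nil [simp]: "seg y i i = []"
  by (simp add: seg_def)

lemma seg_neq_Nil: "i < j \<Longrightarrow> seg y i j \<noteq> []"
  by (simp add: seg_Cons)

lemma tail_seg:
  assumes "p \<in> {1..n}"
  shows "tail (seg y 1 n @- t) p = seg y p n @- t"
proof -
  have "seg y 1 n @- t = seg y 1 p @- seg y p n @- t"
    using assms seg_append[of 1 p n y] by simp
  then show ?thesis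
    using assms by (simp add: sdrop_shift)
qed

lemma snth_seg_shift:
  assumes "j \<in> {1..<n}"
  shows "(seg y 1 n @- t) !! (j - 1) = y j"
proof -
  have "j - 1 < length (seg y 1 n)"
    using assms by auto
  then show ?thesis
    using assms seg_nth[of 1 "j - 1" n y] by (simp add: shift_snth_less del: length_seg)
qed

lemma is_shift_pat_seg:
  assumes y: "compat y"
    and "\<And>p. p \<in> {1..<n} \<Longrightarrow> Suc (\<pi> p) = \<pi> n \<Longrightarrow> alt_less (seg y p n @- t) t"
    and "\<And>p. p \<in> {1..<n} \<Longrightarrow> \<pi> p = Suc (\<pi> n) \<Longrightarrow> alt_less t (seg y p n @- t)"
  shows "is_shift_pat (seg y 1 n @- t) n \<pi>"
  using n_ge assms(2,3) by (intro tails_ordered[OF y]) (auto simp: snth_seg_shift tail_seg simp del: One_nat_def)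

lemma is_shift_pat_cycle:
  assumes y: "compat y"
    and "\<pi> n \<noteq> 1 \<Longrightarrow> alt_less (cycle (seg y l n)) t"
    and "\<pi> n \<noteq> n \<Longrightarrow> alt_less t (cycle (seg y r n))"
  shows "is_shift_pat (seg y 1 n @- t) n \<pi>"
proof (rule is_shift_pat_seg[OF y])
  fix p assume p: "p \<in> {1..<n}" "Suc (\<pi> p) = \<pi> n"
  then have n1: "\<pi> n \<noteq> 1" and "\<pi> n - 1 = \<pi> p"
    using pi_mem_lt[OF p(1)] by auto
  then have "p = l"
    by (simp add: l_pos_def)
  then show "alt_less (seg y p n @- t) t"
    using n1 assms(2) alt_less_shift_self_iff[OF seg_neq_Nil[of p n y], of t] p(1) by simp
next
  fix p assume p: "p \<in> {1..<n}" "\<pi> p = Suc (\<pi> n)"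
  then have n1: "\<pi> n \<noteq> n" and "\<pi> n + 1 = \<pi> p"
    using pi_mem_lt[OF p(1)] by auto
  then have "p = r"
    by (simp add: r_pos_def)
  then show "alt_less t (seg y p n @- t)"
    using n1 assms(3) alt_less_self_shift_iff[OF seg_neq_Nil[of p n y], of t] p(1) by simp
qed

text \<open>The first \<open>n - 1\<close> letters given by \<open>z\<close> can be continued with letters up to \<open>k\<close>.\<close>

definition extendable :: "nat \<Rightarrow> bool" where
  "extendable k \<longleftrightarrow> (\<exists>t. (\<forall>i. t !! i \<le> k) \<and> (\<pi> n \<noteq> 1 \<longrightarrow> alt_less (cycle (seg z l n)) t) \<and>
     (\<pi> n \<noteq> n \<longrightarrow> alt_less t (cycle (seg z r n))))"

text \<open>With only \<open>c + 1\<close> letters, the first \<open>n - 1\<close> letters are forced to be those of \<open>z\<close>.\<close>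

lemma is_shift_pat_minimal_letters:
  assumes w: "is_shift_pat w n \<pi>" "\<And>i. w !! i \<le> c"
  shows "extendable c"
proof -
  define t where "t = tail w n"
  have z: "w !! (p - 1) = z p" if "p \<in> {1..<n}" for p
    using compat_le_c_eq_z[OF is_shift_pat_compat[OF w(1)] w(2) that] .
  have "stake (n - 1) w = seg z 1 n"
    by (intro nth_equalityI) (simp_all add: seg_nth z[of "Suc _", simplified] stake_nth)
  then have "w = seg z 1 n @- t"
    unfolding t_def by (metis stake_sdrop)
  then have tl: "tail w p = seg z p n @- t" if "p \<in> {1..n}" for p
    using tail_seg[OF that] by simp
  show ?thesis
    unfolding extendable_def
  proof (intro exI[of _ t] conjI allI impI)
    show "t !! i \<le> c" for i
      by (simp add: t_def sdrop_snth w(2))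
    show "alt_less (cycle (seg z l n)) t" if "\<pi> n \<noteq> 1"
      using is_shift_patD[OF w(1), of l n] l_props[OF that] tl[of l] n_ge
        alt_less_shift_self_iff[OF seg_neq_Nil, of l n] by (simp add: t_def)
    show "alt_less t (cycle (seg z r n))" if "\<pi> n \<noteq> n"
      using is_shift_patD[OF w(1), of n r] r_props[OF that] tl[of r] n_ge
        alt_less_self_shift_iff[OF seg_neq_Nil, of r n] by (simp add: t_def)
  qed
qed

lemma c_less_letters:
  assumes "is_shift_pat w n \<pi>" "\<And>i. w !! i < k"
  shows "c < k"
proof -
  obtain j where j: "j \<in> {1..<n}" "z j = c"
    by (rule c_attained)
  have "c \<le> w !! (j - 1)"
    using compat_ge_z[OF is_shift_pat_compat[OF assms(1)] j(1)] j(2) by simp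
  also have "\<dots> < k"
    by (rule assms(2))
  finally show ?thesis .
qed

lemma snth_cycle_le:
  assumes "xs \<noteq> []" "\<forall>x\<in>set xs. x \<le> k"
  shows "cycle xs !! i \<le> (k::nat)"
proof -
  have "cycle xs !! i \<in> set xs"
    using sset_cycle[OF assms(1)] snth_sset[of "cycle xs" i] by simp
  then show ?thesis
    using assms(2) by simp
qed

lemma snth_cycle_z_le:
  assumes "p \<in> {1..<n}"
  shows "cycle (seg z p n) !! i \<le> c"
  by (rule snth_cycle_le) (use assms z_le_c in \<open>auto simp: seg_neq_Nil seg_def\<close>)

lemma z_eq_order:
  assumes "p \<in> {1..<n}" "q \<in> {1..<n}" "p \<noteq> q" "z p = z q"
  shows "\<pi> p < \<pi> q \<longleftrightarrow> \<pi> (Suc q) < \<pi> (Suc p)"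
proof -
  have "\<pi> p < \<pi> q \<or> \<pi> q < \<pi> p"
    using assms(3) pi_inj[of p q] by linarith
  then show ?thesis
    using compatD(2)[OF compat_z assms(1,2)] compatD(2)[OF compat_z assms(2,1)] assms(4) by auto
qed

text \<open>Each common letter reverses the order of the ranks, so only the parity of the run
  matters.\<close>

lemma z_run_order:
  assumes "p \<noteq> q" "p \<ge> 1" "q \<ge> 1" "p + k \<le> n" "q + k \<le> n" "\<And>i. i < k \<Longrightarrow> z (p + i) = z (q + i)"
  shows "\<pi> p < \<pi> q \<longleftrightarrow> (if even k then \<pi> (p + k) < \<pi> (q + k) else \<pi> (q + k) < \<pi> (p + k))"
  using assms
proof (induction k)
  case (Suc k)
  have "\<pi> (p + k) < \<pi> (q + k) \<longleftrightarrow> \<pi> (Suc (q + k)) < \<pi> (Suc (p + k))"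
    "\<pi> (q + k) < \<pi> (p + k) \<longleftrightarrow> \<pi> (Suc (p + k)) < \<pi> (Suc (q + k))"
    using z_eq_order[of "p + k" "q + k"] z_eq_order[of "q + k" "p + k"] Suc.prems(1-5) Suc.prems(6)[of k]
    by auto
  then show ?case
    using Suc by simp
qed simp

end

section \<open>Equal periodic bounds and collapsed permutations\<close>

text \<open>
  The rank sequence \<open>\<rho>\<close> will be that of the positions \<open>n - i s\<close>, where both \<open>z\<^bsub>[l,n)\<^esub>\<close> and
  \<open>z\<^bsub>[r,n)\<^esub>\<close> are powers of one word of length \<open>s\<close>. For odd \<open>s\<close> it spirals in or out, and the
  neighbours of \<open>\<rho> 0\<close> can only be \<open>\<rho> 1\<close> and \<open>\<rho> 2\<close>.
\<close>

lemma spiral_neighbours: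
  fixes \<rho> :: "nat \<Rightarrow> int"
  assumes step: "\<And>i j. i \<in> {1..K} \<Longrightarrow> j \<in> {1..K} \<Longrightarrow> i \<noteq> j \<Longrightarrow>
      \<rho> i < \<rho> j \<longleftrightarrow> \<rho> (j - 1) < \<rho> (i - 1)"
    and inj: "inj_on \<rho> {0..K}"
    and ab: "a \<in> {1..K}" "b \<in> {1..K}" "\<rho> a = \<rho> 0 - 1" "\<rho> b = \<rho> 0 + 1"
    and up: "\<rho> 0 < \<rho> 1"
  shows "a = 2 \<and> b = 1"
proof -
  have a2: "a \<ge> 2"
    using ab up by (cases "a = 1") auto
  then have K2: "2 \<le> K"
    using ab by auto
  \<comment> \<open>If \<open>\<rho> 2\<close> were above \<open>\<rho> 0\<close>, no value could
    fall below \<open>\<rho> 0\<close>: going back twice from such an index \<open>i\<close> gives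
    one at \<open>i - 2\<close>. But \<open>\<rho> a\<close> is below.\<close>
  have "\<rho> 2 < \<rho> 0"
  proof (rule ccontr)
    assume "\<not> \<rho> 2 < \<rho> 0"
    then have r2: "\<rho> 0 < \<rho> 2"
      using inj K2 by (metis atLeastAtMost_iff inj_onD le0 linorder_neqE zero_neq_numeral)
    have "\<rho> 0 < \<rho> i" if "i \<in> {1..K}" for i
      using that
    proof (induction i rule: less_induct)
      case (less i)
      show ?case
      proof (rule ccontr)
        assume neg: "\<not> \<rho> 0 < \<rho> i"
        then have i3: "i \<ge> 3"
          using up r2 less.prems by (cases "i = 1"; cases "i = 2") auto
        have "\<rho> i < \<rho> 2"
          using neg r2 by simp
        then have "\<rho> 1 < \<rho> (i - 1)"
          using step[of i 2] i3 less.prems K2 by auto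
        moreover have "1 \<in> {1..K}" "i - 1 \<in> {1..K}" "1 \<noteq> i - 1" "i - 1 - 1 = i - 2"
          using i3 less.prems by auto
        ultimately have "\<rho> (i - 2) < \<rho> 0"
          using step[of 1 "i - 1"] by simp
        moreover have "i - 2 < i" "i - 2 \<in> {1..K}"
          using i3 less.prems by auto
        ultimately show False
          using less.IH[of "i - 2"] by simp
      qed
    qed
    then show False
      using ab by fastforce
  qed
  \<comment> \<open>From \<open>\<rho> 2 < \<rho> i < \<rho> 1\<close>, going back once puts
    \<open>\<rho> (i - 1)\<close> between \<open>\<rho> 0\<close> and \<open>\<rho> 1\<close> as
    well, so the descent never ends.\<close>
  have type2: "\<not> (\<rho> 0 < \<rho> i \<and> \<rho> i < \<rho> 1)" if "i \<in> {1..K}" for i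
    using that
  proof (induction i rule: less_induct)
    case (less i)
    show ?case
    proof
      assume bad: "\<rho> 0 < \<rho> i \<and> \<rho> i < \<rho> 1"
      then have i3: "i \<ge> 3"
        using \<open>\<rho> 2 < \<rho> 0\<close> less.prems by (cases "i = 1"; cases "i = 2") auto
      have "\<rho> 0 < \<rho> (i - 1)"
        using step[of i 1] bad i3 less.prems by auto
      moreover have "\<rho> 2 < \<rho> i"
        using bad \<open>\<rho> 2 < \<rho> 0\<close> by simp
      then have "\<rho> (i - 1) < \<rho> 1"
        using step[of 2 i] i3 less.prems K2 by auto
      moreover have "i - 1 < i" "i - 1 \<in> {1..K}"
        using i3 less.prems by auto
      ultimately show False
        using less.IH[of "i - 1"] by simp
    qed
  qed
  have "b = 1"
  proof (rule ccontr)
    assume "b \<noteq> 1"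
    then have "\<rho> b \<noteq> \<rho> 1"
      using inj_on_eq_iff[OF inj, of b 1] ab(2) by auto
    then show False
      using type2[OF ab(2)] ab(4) up by linarith
  qed
  moreover have "a = 2"
  proof (rule ccontr)
    assume "a \<noteq> 2"
    then have a3: "a \<ge> 3"
      using a2 by simp
    have "\<rho> a \<noteq> \<rho> 2"
      using inj_on_eq_iff[OF inj, of a 2] ab(1) K2 \<open>a \<noteq> 2\<close> by auto
    then have "\<rho> 2 < \<rho> a"
      using ab(3) \<open>\<rho> 2 < \<rho> 0\<close> by linarith
    then have "\<rho> (a - 1) < \<rho> 1"
      using step[of 2 a] a3 ab(1) K2 by auto
    moreover have "\<rho> 0 < \<rho> (a - 1)"
      using step[of a 1] a3 ab(1,3) up by auto
    moreover have "a - 1 \<in> {1..K}"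
      using a3 ab(1) by auto
    ultimately show False
      using type2[of "a - 1"] by simp
  qed
  ultimately show ?thesis
    by simp
qed

context perm_pattern
begin

text \<open>
  Compare the two periodic sequences while following the positions: \<open>A\<close> continues with \<open>l\<close>,
  and \<open>B\<close> with \<open>r\<close>, after position \<open>n\<close>. A wrong comparison is moved along until it contradicts
  the monotonicity of \<open>z\<close>; when both positions become equal, the difference is delayed instead.
\<close>

lemma cycle_l_not_greater_r:
  assumes n1: "\<pi> n \<noteq> 1" "\<pi> n \<noteq> n"
  shows "\<not> alt_less (cycle (seg z r n)) (cycle (seg z l n))"
proof
  define X where "X = cycle (seg z l n)"
  define Y where "Y = cycle (seg z r n)"
  assume "alt_less (cycle (seg z r n)) (cycle (seg z l n))"
  then have YX: "alt_less Y X"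
    by (simp add: X_def Y_def)
  obtain k0 where k0: "\<forall>i<k0. X !! i = Y !! i" "X !! k0 \<noteq> Y !! k0"
    using YX alt_less_irrefl first_diff_exists by metis
  note l = l_props[OF n1(1)]
  note r = r_props[OF n1(2)]
  define A where "A p = seg z p n @- X" for p
  define B where "B p = seg z p n @- Y" for p
  have A_n: "A n = X" "A l = X" and B_n: "B n = Y" "B r = Y"
    using l(1) r(1) cycle_unfold[OF seg_neq_Nil, of l n z] cycle_unfold[OF seg_neq_Nil, of r n z]
    by (simp_all add: A_def B_def X_def Y_def)
  have A_Cons: "A p = z p ## A (Suc p)" and B_Cons: "B p = z p ## B (Suc p)" if "p \<in> {1..<n}" for p
    using that by (simp_all add: A_def B_def seg_Cons)
  have same: "k0 \<le> k" if "A p !! k \<noteq> B p !! k" for p k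
  proof (rule ccontr)
    assume "\<not> k0 \<le> k"
    then have "A p !! k = B p !! k"
      using k0(1) by (cases "k < n - p") (auto simp: A_def B_def shift_snth_less shift_snth_ge)
    then show False
      using that by simp
  qed
  \<comment> \<open>Each common letter exchanges the roles of the branches \<open>A\<close> and
    \<open>B\<close>, so both kinds of comparison are treated together. The second kind is claimed
    only below \<open>k0\<close>, where the branches from one position still agree.\<close>
  have diff: "(k \<le> k0 \<longrightarrow> (\<forall>p\<in>{1..n}. \<forall>q\<in>{1..n}. \<pi> p < \<pi> q \<longrightarrow>
      (\<forall>i<k. A p !! i = B q !! i) \<longrightarrow> A p !! k \<noteq> B q !! k \<longrightarrow> \<not> alt_less (B q) (A p))) \<and>
    (k < k0 \<longrightarrow> (\<forall>p\<in>{1..n}. \<forall>q\<in>{1..n}. \<pi> p < \<pi> q \<longrightarrow>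
      (\<forall>i<k. B p !! i = A q !! i) \<longrightarrow> B p !! k \<noteq> A q !! k \<longrightarrow> \<not> alt_less (A q) (B p)))" for k
  proof (induction k rule: less_induct)
    case (less k)
    have 1: "\<not> alt_less (B q) (A p)"
      if pq: "p \<in> {1..n}" "q \<in> {1..n}" "\<pi> p < \<pi> q" "\<forall>i<k. A p !! i = B q !! i"
        "A p !! k \<noteq> B q !! k" "k \<le> k0" for p q
    proof
      assume wrong: "alt_less (B q) (A p)"
      define p' where "p' = (if p = n then l else p)"
      define q' where "q' = (if q = n then r else q)"
      have e: "A p = A p'" "B q = B q'" and p': "p' \<in> {1..<n}" "q' \<in> {1..<n}"
        using pq A_n B_n l(1) r(1) by (auto simp: p'_def q'_def)
      \<comment> \<open>Replacing \<open>n\<close> by \<open>l\<close> on the lower side or by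
        \<open>r\<close> on the upper side only widens the gap.\<close>
      have lt: "\<pi> p' < \<pi> q'"
        using pq(3) l(3) r(3) by (auto simp: p'_def q'_def)
      note C = A_Cons[OF p'(1)] B_Cons[OF p'(2)]
      have eq: "z p' = z q'" and swap: "alt_less (A (Suc p')) (B (Suc q'))"
        using wrong compatD(1)[OF compat_z p' lt] unfolding e C by (auto simp: alt_less_SCons)
      obtain j where k: "k = Suc j"
        using pq(5) eq unfolding e C by (cases k) auto
      have "\<forall>i<j. B (Suc q') !! i = A (Suc p') !! i"
        using pq(4) unfolding e C k by fastforce
      moreover have "B (Suc q') !! j \<noteq> A (Suc p') !! j"
        using pq(5) unfolding e C k by simp
      moreover have "\<pi> (Suc q') < \<pi> (Suc p')"
        using compatD(2)[OF compat_z p' lt eq] .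
      ultimately show False
        using less.IH[of j] swap pq(6) p' k by (auto dest!: bspec[of _ _ "Suc q'"] bspec[of _ _ "Suc p'"])
    qed
    have 2: "\<not> alt_less (A q) (B p)"
      if pq: "p \<in> {1..n}" "q \<in> {1..n}" "\<pi> p < \<pi> q" "\<forall>i<k. B p !! i = A q !! i"
        "B p !! k \<noteq> A q !! k" "k < k0" for p q
    proof
      assume wrong: "alt_less (A q) (B p)"
      define p' where "p' = (if p = n then r else p)"
      define q' where "q' = (if q = n then l else q)"
      have e: "B p = B p'" "A q = A q'" and p': "p' \<in> {1..<n}" "q' \<in> {1..<n}"
        using pq A_n B_n l(1) r(1) by (auto simp: p'_def q'_def)
      \<comment> \<open>Here the replacements narrow the gap. As they move by one rank, the
        positions can meet but not cross, and meeting is impossible because the branches from one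
        position do not differ before \<open>k0\<close>.\<close>
      have "p' \<noteq> q'"
        using same[of p' k] pq(5,6) e by auto
      then have "\<pi> p' \<noteq> \<pi> q'"
        by (simp only: pi_inj not_False_eq_True)
      then have lt: "\<pi> p' < \<pi> q'"
        using pq(3) l(2) r(2) by (auto simp: p'_def q'_def split: if_splits)
      note C = B_Cons[OF p'(1)] A_Cons[OF p'(2)]
      have eq: "z p' = z q'" and swap: "alt_less (B (Suc p')) (A (Suc q'))"
        using wrong compatD(1)[OF compat_z p' lt] unfolding e C by (auto simp: alt_less_SCons)
      obtain j where k: "k = Suc j"
        using pq(5) eq unfolding e C by (cases k) auto
      have "\<forall>i<j. A (Suc q') !! i = B (Suc p') !! i"
        using pq(4) unfolding e C k by fastforce
      moreover have "A (Suc q') !! j \<noteq> B (Suc p') !! j"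
        using pq(5) unfolding e C k by simp
      moreover have "\<pi> (Suc q') < \<pi> (Suc p')"
        using compatD(2)[OF compat_z p' lt eq] .
      ultimately show False
        using less.IH[of j] swap pq(6) p' k by (auto dest!: bspec[of _ _ "Suc q'"] bspec[of _ _ "Suc p'"])
    qed
    show ?case
      using 1 2 by blast
  qed
  have "\<not> alt_less (B r) (A l)"
    using diff[of k0, THEN conjunct1, rule_format, of l r] l r k0 by (simp add: A_n B_n)
  then show False
    using YX A_n B_n by simp
qed

lemma length_concat_replicate: "length (concat (replicate k xs)) = k * length xs"
  by (induction k) auto

text \<open>Commuting words are powers of a common word \<open>v\<close>. Stepping from
  \<open>n\<close> backwards by the length of \<open>v\<close> meets both \<open>l\<close> and
  \<open>r\<close>, the rank neighbours of \<open>n\<close>, after \<open>a\<close> and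
  \<open>b\<close> steps; the order along these positions leaves only the exponents 1 and 2.\<close>

lemma cycle_eq_imp_collapsed:
  assumes n1: "\<pi> n \<noteq> 1" "\<pi> n \<noteq> n" and eq: "cycle (seg z l n) = cycle (seg z r n)"
  shows "collapsed n \<pi>"
proof -
  note l = l_props[OF n1(1)]
  note r = r_props[OF n1(2)]
  define L where "L = seg z l n"
  define R where "R = seg z r n"
  have ne: "L \<noteq> []" "R \<noteq> []"
    using l(1) r(1) by (simp_all add: L_def R_def seg_neq_Nil)
  have len: "length L = n - l" "length R = n - r"
    by (simp_all add: L_def R_def)
  have eq': "cycle L = cycle R"
    using eq by (simp add: L_def R_def)
  have "(L @ R) @- cycle L = (R @ L) @- cycle L"
    using cycle_unfold[OF ne(1)] cycle_unfold[OF ne(2)] eq' by simp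
  then have "stake (length (L @ R)) ((L @ R) @- cycle L) = stake (length (L @ R)) ((R @ L) @- cycle L)"
    by simp
  then have "L @ R = R @ L"
    by (simp add: stake_shift)
  then obtain a b v where ab: "concat (replicate a v) = L" "concat (replicate b v) = R"
    using comm_append_are_replicate by blast
  define s where "s = length v"
  define K where "K = max a b"
  have as: "a * s = n - l" "b * s = n - r"
    using ab len length_concat_replicate by (metis s_def)+
  have "l \<noteq> r"
    using l(2) r(2) pi_n_mem by (metis add_diff_cancel_right' l(3) less_irrefl not_less_iff_gr_or_eq r(3))
  have s: "s \<ge> 1"
    using as(1) l(1) by (cases s) auto
  have a: "a \<ge> 1" "b \<ge> 1"
    using ab ne by (cases a; cases b; simp)+
  have lK: "a * s < n" "b * s < n"
    using as l(1) r(1) by auto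
  then have Ks: "K * s < n"
    by (simp add: K_def max_def)
  define p where "p i = n - i * s" for i
  have p_le: "i * s < n" if "i \<le> K" for i
    using that Ks by (meson le_less_trans mult_le_mono1)
  have p_ab: "p a = l" "p b = r"
    using as l(1) r(1) by (auto simp: p_def)
  have p_step: "p i + s = p (i - 1)" if "i \<in> {1..K}" for i
    using that p_le[of i] by (cases i) (auto simp: p_def)
  have pmem: "1 \<le> p i" "p i \<le> n" if "i \<le> K" for i
    using p_le[OF that] by (auto simp: p_def)
  have p_s: "p i + s \<le> n" if "i \<in> {1..K}" for i
  proof -
    have "i - 1 \<le> K"
      using that by auto
    then show ?thesis
      unfolding p_step[OF that] by (rule pmem(2))
  qed
  have block: "z (p i + x) = v ! x" if "i \<in> {1..K}" "x < s" for i x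
  proof -
    \<comment> \<open>The longer of the two words contains all \<open>K\<close> blocks.\<close>
    obtain W k where W: "concat (replicate k v) = W" "W = seg z (p k) n" "k = K" "k \<le> K"
      using ab p_ab unfolding K_def L_def R_def by (metis max_def le_refl)
    have i: "i \<le> k" "k = (k - i) + Suc (i - 1)"
      using that W(3) by auto
    have "W = concat (replicate (k - i) v) @ v @ concat (replicate (i - 1) v)"
      using W(1) i(2) by (metis concat.simps(2) concat_append replicate_Suc replicate_add)
    then have "W ! ((k - i) * s + x) = v ! x"
      using that(2) by (simp add: nth_append length_concat_replicate s_def)
    moreover have *: "p k + ((k - i) * s + x) = p i + x"
    proof -
      obtain d where d: "k = i + d"
        using i(1) le_Suc_ex by blast
      then have "i * s + d * s < n"
        using p_le[OF W(4)] by (simp add: add_mult_distrib)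
      then show ?thesis
        by (simp add: d p_def add_mult_distrib)
    qed
    moreover have "p i + x < n"
      using p_s[OF that(1)] that(2) by linarith
    ultimately show ?thesis
      using seg_nth[of "p k" "(k - i) * s + x" n z] unfolding W(2) by simp
  qed
  define \<rho> where "\<rho> i = int (\<pi> (p i))" for i
  have p_inj: "p i \<noteq> p j" if "i \<le> K" "j \<le> K" "i \<noteq> j" for i j
  proof
    assume "p i = p j"
    then have "i * s = j * s"
      using p_le[OF that(1)] p_le[OF that(2)] unfolding p_def by linarith
    then show False
      using that(3) s by simp
  qed
  have inj: "inj_on \<rho> {0..K}"
  proof (rule inj_onI)
    fix i j assume "i \<in> {0..K}" "j \<in> {0..K}" "\<rho> i = \<rho> j"
    then show "i = j"
      using p_inj[of i j] pi_inj[of "p i" "p j"] by (cases "i = j") (auto simp: \<rho>_def)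
  qed
  have run: "\<rho> i < \<rho> j \<longleftrightarrow> (if even s then \<rho> (i - 1) < \<rho> (j - 1) else \<rho> (j - 1) < \<rho> (i - 1))"
    if "i \<in> {1..K}" "j \<in> {1..K}" "i \<noteq> j" for i j
  proof -
    have "p i \<noteq> p j" "p i \<ge> 1" "p j \<ge> 1"
      using that p_inj[of i j] pmem(1)[of i] pmem(1)[of j] by auto
    moreover have "z (p i + x) = z (p j + x)" if "x < s" for x
      using block[OF _ that] \<open>i \<in> {1..K}\<close> \<open>j \<in> {1..K}\<close> by simp
    ultimately show ?thesis
      using z_run_order[of "p i" "p j" s] p_s[OF that(1)] p_s[OF that(2)]
      by (simp add: \<rho>_def p_step[OF that(1)] p_step[OF that(2)])
  qed
  have p0: "p 0 = n"
    by (simp add: p_def)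
  have \<rho>ab: "\<rho> a = \<rho> 0 - 1" "\<rho> b = \<rho> 0 + 1"
    unfolding \<rho>_def p_ab p0 using l(2,3) r(2) by linarith+
  have abK: "a \<in> {1..K}" "b \<in> {1..K}"
    using a by (auto simp: K_def)
  have "a \<noteq> b"
    using p_ab \<open>l \<noteq> r\<close> by auto
  \<comment> \<open>For even \<open>s\<close> the ranks would be monotone along the block starts,
    and \<open>l\<close> and \<open>r\<close> could not lie on different sides of
    \<open>n\<close>.\<close>
  have odd: "odd s"
  proof
    assume "even s"
    then have run: "\<rho> i < \<rho> j \<longleftrightarrow> \<rho> (i - 1) < \<rho> (j - 1)" if "i \<in> {1..K}" "j \<in> {1..K}" "i \<noteq> j" for i j
      using run[OF that] by simp
    have up: "(\<rho> i < \<rho> (Suc i)) = (\<rho> 0 < \<rho> 1) \<and> (\<rho> (Suc i) < \<rho> i) = (\<rho> 1 < \<rho> 0)" if "Suc i \<le> K" for i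
      using that
    proof (induction i)
      case (Suc i)
      then show ?case
        using run[of "Suc i" "Suc (Suc i)"] run[of "Suc (Suc i)" "Suc i"] by auto
    qed simp
    have "\<rho> 0 \<noteq> \<rho> 1"
      using inj_on_eq_iff[OF inj, of 0 1] abK by auto
    then consider "\<rho> 0 < \<rho> 1" | "\<rho> 1 < \<rho> 0"
      by linarith
    then show False
    proof cases
      case 1
      have "\<rho> 0 < \<rho> (Suc i)" if "Suc i \<le> K" for i
        using that
      proof (induction i)
        case (Suc i)
        then show ?case
          using up[of "Suc i"] 1 by auto
      qed (use 1 in simp)
      from this[of "a - 1"] show False
        using \<rho>ab abK by auto
    next
      case 2
      have "\<rho> (Suc i) < \<rho> 0" if "Suc i \<le> K" for i
        using that
      proof (induction i)
        case (Suc i)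
        then show ?case
          using up[of "Suc i"] 2 by auto
      qed (use 2 in simp)
      from this[of "b - 1"] show False
        using \<rho>ab abK by auto
    qed
  qed
  have step: "\<rho> i < \<rho> j \<longleftrightarrow> \<rho> (j - 1) < \<rho> (i - 1)" if "i \<in> {1..K}" "j \<in> {1..K}" "i \<noteq> j" for i j
    using run[OF that] odd by simp
  have "\<rho> 0 \<noteq> \<rho> 1"
    using inj_on_eq_iff[OF inj, of 0 1] abK by auto
  then consider "\<rho> 0 < \<rho> 1" | "\<rho> 1 < \<rho> 0"
    by linarith
  then have "L = R @ R \<or> R = L @ L"
  proof cases
    case 1
    have "a = 2 \<and> b = 1"
      by (rule spiral_neighbours[OF step inj abK \<rho>ab 1])
    then show ?thesis
      using ab by (auto simp: numeral_2_eq_2)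
  next
    case 2
    \<comment> \<open>The mirrored case: negating the ranks exchanges the roles of \<open>l\<close>
      and \<open>r\<close>.\<close>
    have "b = 2 \<and> a = 1"
      by (rule spiral_neighbours[where \<rho> = "\<lambda>i. - \<rho> i" and K = K])
        (use step inj abK \<rho>ab 2 in \<open>auto simp: inj_on_def\<close>)
    then show ?thesis
      using ab by (auto simp: numeral_2_eq_2)
  qed
  then show ?thesis
    using n1 by (simp add: collapsed_def L_def R_def)
qed

lemma collapsed_imp_cycle_eq:
  assumes "collapsed n \<pi>"
  shows "\<pi> n \<noteq> 1" "\<pi> n \<noteq> n" "cycle (seg z l n) = cycle (seg z r n)"
proof -
  show n1: "\<pi> n \<noteq> 1" "\<pi> n \<noteq> n"
    using assms by (auto simp: collapsed_def)
  have sq: "cycle (xs @ xs) = cycle xs" if "xs \<noteq> []" for xs :: "nat list"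
    using stream_shift_fixed_unique[of "xs @ xs" "cycle xs"] cycle_unfold[OF that] that by simp
  have "seg z l n \<noteq> []" "seg z r n \<noteq> []"
    using l_props(1)[OF n1(1)] r_props(1)[OF n1(2)] by (simp_all add: seg_neq_Nil)
  then show "cycle (seg z l n) = cycle (seg z r n)"
    using assms sq by (auto simp: collapsed_def Let_def)
qed

end

section \<open>Existence of continuations and the value of epsilon\<close>

lemma cycle2_swap_eq: "cycle [a, b] = cycle [b, a] \<longleftrightarrow> a = b"
  by (metis even_zero snth_cycle2)

lemma stream_zero_eq_cycle:
  assumes "\<And>i. s !! i \<le> (0::nat)"
  shows "s = cycle [0, 0]"
  using assms by (intro stream_eqI) (simp add: snth_cycle2)

lemma shift_eq_cycle2:
  assumes "xs @- s = cycle [a, b]"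
  shows "s = (if even (length xs) then cycle [a, b] else cycle [b, a])"
proof -
  have "s = sdrop (length xs) (xs @- s)"
    by (simp add: sdrop_shift)
  then show ?thesis
    unfolding assms sdrop_cycle2 .
qed

lemma cycle_eq_cycle2_odd:
  assumes "cycle xs = cycle [a, b]" "xs \<noteq> []" "odd (length xs)"
  shows "a = b"
proof -
  have "cycle [a, b] = cycle [b, a]"
    using sdrop_length_cycle[OF assms(2)] assms(1,3) sdrop_cycle2[of "length xs" a b] by simp
  then show ?thesis
    by (simp add: cycle2_swap_eq)
qed

context perm_pattern
begin

lemma seg_shift_le:
  assumes "\<And>j. j \<in> {1..<n} \<Longrightarrow> y j \<le> k" "\<And>i. t !! i \<le> k"
  shows "(seg y 1 n @- t) !! i \<le> (k::nat)"
proof (cases "i < n - 1")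
  case True
  then show ?thesis
    using assms(1)[of "Suc i"] seg_nth[of 1 i n y] by (simp add: shift_snth_less)
next
  case False
  then show ?thesis
    using assms(2) by (simp add: shift_snth_ge)
qed

lemma extendable_imp_pattern:
  assumes "extendable k" "c \<le> k"
  obtains w where "is_shift_pat w n \<pi>" "\<And>i. w !! i \<le> k"
proof -
  obtain t where t: "\<forall>i. t !! i \<le> k" "\<pi> n \<noteq> 1 \<Longrightarrow> alt_less (cycle (seg z l n)) t"
    "\<pi> n \<noteq> n \<Longrightarrow> alt_less t (cycle (seg z r n))"
    using assms(1) unfolding extendable_def by blast
  show ?thesis
  proof
    show "is_shift_pat (seg z 1 n @- t) n \<pi>"
      by (rule is_shift_pat_cycle[OF compat_z]) (use t in auto)
    show "(seg z 1 n @- t) !! i \<le> k" for i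
      using t(1) z_le_c assms(2) by (intro seg_shift_le) (auto intro: le_trans)
  qed
qed

lemma extendable_middle:
  assumes n1: "\<pi> n \<noteq> 1" "\<pi> n \<noteq> n" and "\<not> collapsed n \<pi>"
  shows "alt_less (cycle (seg z l n)) (cycle (seg z r n))" "extendable c"
proof -
  show lt: "alt_less (cycle (seg z l n)) (cycle (seg z r n))"
    using cycle_l_not_greater_r[OF n1] cycle_eq_imp_collapsed[OF n1] assms(3) alt_less_linear by blast
  obtain t where "alt_less (cycle (seg z l n)) t" "alt_less t (cycle (seg z r n))" "\<And>i. t !! i \<le> c"
    using exists_between_cycle[OF seg_neq_Nil lt snth_cycle_z_le snth_cycle_z_le] l_props(1)[OF n1(1)] r_props(1)[OF n1(2)]
    by auto
  then show "extendable c"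
    unfolding extendable_def by blast
qed

text \<open>In the collapsed case, raising all letters of rank above \<open>\<pi> n\<close> by one
  separates the first letters at \<open>l\<close> and \<open>r\<close> and thus opens the interval
  for the continuation. Otherwise \<open>z\<close> is kept, and if \<open>n\<close> has an extreme
  rank, the new letter is used in the continuation.\<close>

lemma pattern_with_one_more_letter:
  obtains w where "is_shift_pat w n \<pi>" "\<And>i. w !! i \<le> Suc c"
proof (cases "collapsed n \<pi>")
  case True
  note n1 = collapsed_imp_cycle_eq(1,2)[OF True]
  note l = l_props[OF n1(1)] and r = r_props[OF n1(2)]
  define y where "y j = (if \<pi> j > \<pi> n then Suc (z j) else z j)" for j
  have y: "compat y"
    unfolding compat_def
  proof (intro ballI impI)
    fix p q assume "p \<in> {1..<n}" "q \<in> {1..<n}" "\<pi> p < \<pi> q"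
    then show "y p \<le> y q \<and> (y p = y q \<longrightarrow> \<pi> (Suc q) < \<pi> (Suc p))"
      using compatD[OF compat_z, of p q] by (auto simp: y_def)
  qed
  have y_le: "y j \<le> Suc c" if "j \<in> {1..<n}" for j
    using z_le_c[OF that] by (simp add: y_def)
  have ne: "seg y l n \<noteq> []" "seg y r n \<noteq> []"
    using l(1) r(1) by (simp_all add: seg_neq_Nil)
  have "z l \<le> z r"
    using compatD(1)[OF compat_z l(1) r(1)] l(3) r(3) by simp
  then have "y l < y r"
    using l(3) r(3) by (simp add: y_def)
  moreover have "cycle (seg y l n) !! 0 = y l" "cycle (seg y r n) !! 0 = y r"
    using l(1) r(1) by (simp_all add: seg_Cons)
  ultimately have lt: "alt_less (cycle (seg y l n)) (cycle (seg y r n))"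
    by (intro alt_lessI[of 0]) auto
  have bound: "cycle (seg y p n) !! i \<le> Suc c" if "p \<in> {1..<n}" for p i
    by (rule snth_cycle_le) (use that y_le in \<open>auto simp: seg_neq_Nil seg_def\<close>)
  obtain t where t: "alt_less (cycle (seg y l n)) t" "alt_less t (cycle (seg y r n))" "\<And>i. t !! i \<le> Suc c"
    using exists_between_cycle[OF ne(1) lt bound[OF l(1)] bound[OF r(1)]] by auto
  show ?thesis
  proof
    show "is_shift_pat (seg y 1 n @- t) n \<pi>"
      by (rule is_shift_pat_cycle[OF y]) (use t in auto)
    show "(seg y 1 n @- t) !! i \<le> Suc c" for i
      using t(3) y_le by (intro seg_shift_le) auto
  qed
next
  case False
  have "extendable (Suc c)"
  proof -
    consider "\<pi> n = n" | "\<pi> n = 1" | "\<pi> n \<noteq> 1" "\<pi> n \<noteq> n"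
      by blast
    then show ?thesis
    proof cases
      case 1
      then have "\<pi> n \<noteq> 1"
        using n_ge by simp
      then have "alt_less (cycle (seg z l n)) (cycle [Suc c, 0])"
        using snth_cycle_z_le[OF l_props(1), of 0] by (intro alt_lessI[of 0]) auto
      then show ?thesis
        unfolding extendable_def using 1 by (intro exI[of _ "cycle [Suc c, 0]"]) (auto simp: snth_cycle2)
    next
      case 2
      then have r: "r \<in> {1..<n}"
        using r_props(1) n_ge by simp
      have "\<not> alt_less (cycle (seg z r n)) (cycle [0, Suc c])"
        using snth_cycle_z_le[OF r] by (intro not_less_cycle_min) (simp add: le_Suc_eq)
      moreover have "cycle (seg z r n) !! 1 \<noteq> cycle [0, Suc c] !! 1"
        using snth_cycle_z_le[OF r, of 1] unfolding snth_cycle2 by simp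
      ultimately have "alt_less (cycle [0, Suc c]) (cycle (seg z r n))"
        using alt_less_linear by metis
      then show ?thesis
        unfolding extendable_def using 2 by (intro exI[of _ "cycle [0, Suc c]"]) (auto simp: snth_cycle2)
    next
      case 3
      then show ?thesis
        using extendable_middle(2)[OF 3 False] unfolding extendable_def by (meson le_SucI)
    qed
  qed
  then show ?thesis
    using extendable_imp_pattern that by (metis le_SucI order_refl)
qed

lemma N_minus_pattern:
  obtains w where "is_shift_pat w n \<pi>" "\<And>i. w !! i < N_minus n \<pi>"
proof -
  obtain w where "is_shift_pat w n \<pi>" "\<And>i. w !! i \<le> Suc c"
    using pattern_with_one_more_letter by blast
  then show ?thesis
    using N_minus_witness[of w "Suc (Suc c)"] that by (auto simp: less_Suc_eq_le)
qed

lemma N_minus_extendable: "N_minus n \<pi> = (if extendable c then c + 1 else c + 2)"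
proof -
  obtain w where w: "is_shift_pat w n \<pi>" "\<And>i. w !! i < N_minus n \<pi>"
    using N_minus_pattern by blast
  have "c < N_minus n \<pi>"
    using c_less_letters[OF w] .
  moreover have "N_minus n \<pi> \<le> c + 1" if ext: "extendable c"
  proof -
    obtain v where "is_shift_pat v n \<pi>" "\<And>i. v !! i \<le> c"
      using extendable_imp_pattern[OF ext order_refl] by blast
    then show ?thesis
      using N_minus_le[of v "c + 1"] by (simp add: less_Suc_eq_le)
  qed
  moreover have "N_minus n \<pi> \<le> c + 2"
  proof -
    obtain v where "is_shift_pat v n \<pi>" "\<And>i. v !! i \<le> Suc c"
      using pattern_with_one_more_letter by blast
    then show ?thesis
      using N_minus_le[of v "c + 2"] by (simp add: less_Suc_eq_le)
  qed
  moreover have "extendable c" if "N_minus n \<pi> \<le> c + 1"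
  proof (rule is_shift_pat_minimal_letters[OF w(1)])
    show "w !! i \<le> c" for i
      using w(2)[of i] that by simp
  qed
  ultimately show ?thesis
    by (cases "N_minus n \<pi> \<le> c + 1") auto
qed

lemma extendable_top:
  assumes "\<pi> n = n"
  shows "extendable c \<longleftrightarrow> cycle (seg z l n) \<noteq> cycle [c, 0]"
proof -
  have "\<pi> n \<noteq> 1"
    using assms n_ge by simp
  note l = l_props(1)[OF this]
  have "\<not> alt_less (cycle [c, 0]) s" if "\<forall>i. s !! i \<le> c" for s
    using that by (intro cycle_max_not_less) blast
  moreover have "alt_less (cycle (seg z l n)) (cycle [c, 0]) \<or> cycle (seg z l n) = cycle [c, 0]"
    using cycle_max_not_less[OF snth_cycle_z_le[OF l]] alt_less_linear by blast
  moreover have "\<forall>i. cycle [c, 0] !! i \<le> c"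
    by (simp add: snth_cycle2)
  ultimately show ?thesis
    unfolding extendable_def using assms n_ge by auto
qed

lemma extendable_bottom:
  assumes "\<pi> n = 1"
  shows "extendable c \<longleftrightarrow> cycle (seg z r n) \<noteq> cycle [0, c]"
proof -
  have "\<pi> n \<noteq> n"
    using assms n_ge by simp
  note r = r_props(1)[OF this]
  have "\<not> alt_less s (cycle [0, c])" if "\<forall>i. s !! i \<le> c" for s
    using that by (intro not_less_cycle_min) blast
  moreover have "alt_less (cycle [0, c]) (cycle (seg z r n)) \<or> cycle (seg z r n) = cycle [0, c]"
    using not_less_cycle_min[OF snth_cycle_z_le[OF r]] alt_less_linear by blast
  moreover have "\<forall>i. cycle [0, c] !! i \<le> c"
    by (simp add: snth_cycle2)
  ultimately show ?thesis
    unfolding extendable_def using assms n_ge by auto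
qed

text \<open>
  The position \<open>r + 1\<close> then carries the largest sequence \<open>c 0 c 0 \<dots>\<close>; the position \<open>m\<close> of the
  maximal rank can only follow it, and reaches \<open>n\<close>, of rank 1, after an odd number of steps.
\<close>

lemma alternating_from_m:
  assumes n1: "\<pi> n = 1" and c1: "c \<ge> 1" and eq: "cycle (seg z r n) = cycle [0, c]"
  shows "odd (n - m) \<and> (\<forall>j<n - m. z (m + j) = (if even j then c else 0))"
proof -
  have nn: "\<pi> n \<noteq> n"
    using n1 n_ge by simp
  note r = r_props[OF nn]
  have mn: "m < n"
    using m_props nn by (cases "m = n") auto
  have ev: "even (n - r)"
    using cycle_eq_cycle2_odd[OF eq seg_neq_Nil] r(1) c1 by auto
  have zr: "z (r + i) = (if even i then 0 else c)" if "r + i < n" for i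
  proof -
    have "cycle (seg z r n) !! i = z (r + i)"
      using that r(1) cycle_unfold[OF seg_neq_Nil, of r n z] seg_nth[OF that, of z]
      by (metis add.commute atLeastLessThan_iff length_seg less_diff_conv shift_snth_less)
    then show ?thesis
      unfolding eq snth_cycle2 by simp
  qed
  show ?thesis
  proof (cases "m = Suc r")
    case True
    have "z (m + j) = (if even j then c else 0)" if "j < n - m" for j
      using zr[of "Suc j"] that True by simp
    moreover have "odd (n - m)"
      using ev True mn by (metis Suc_diff_Suc Suc_lessD even_Suc)
    ultimately show ?thesis
      by blast
  next
    case False
    \<comment> \<open>The letters from \<open>r + 1\<close> on are alternately the largest and the
      smallest. A position of higher rank must also carry \<open>c\<close>, one of lower rank also
      0; so \<open>m + i\<close> copies these letters, and each common letter reverses the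
      comparison.\<close>
    have track: "(even i \<longrightarrow> \<pi> (Suc r + i) < \<pi> (m + i)) \<and> (odd i \<longrightarrow> \<pi> (m + i) < \<pi> (Suc r + i)) \<and>
      (\<forall>j<i. z (m + j) = (if even j then c else 0))" if "m + i \<le> n" "Suc r + i \<le> n" for i
      using that
    proof (induction i)
      case 0
      have "\<pi> (Suc r) \<le> n" "\<pi> (Suc r) \<noteq> \<pi> m"
        using pi_mem[of "Suc r"] r(1) False pi_inj[of "Suc r" m] by auto
      then show ?case
        using m_props by simp
    next
      case (Suc i)
      have mem: "m + i \<in> {1..<n}" "Suc r + i \<in> {1..<n}"
        using Suc.prems m_props(1) by auto
      have ne: "m + i \<noteq> Suc r + i"
        using False by simp
      have zri: "z (Suc r + i) = (if even i then c else 0)"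
        using zr[of "Suc i"] mem by simp
      have IH: "even i \<Longrightarrow> \<pi> (Suc r + i) < \<pi> (m + i)" "odd i \<Longrightarrow> \<pi> (m + i) < \<pi> (Suc r + i)"
        "\<forall>j<i. z (m + j) = (if even j then c else 0)"
        using Suc by auto
      have zmi: "z (m + i) = (if even i then c else 0)"
      proof (cases "even i")
        case True
        then have "c \<le> z (m + i)"
          using compatD(1)[OF compat_z mem(2,1) IH(1)] zri by simp
        then show ?thesis
          using z_le_c[OF mem(1)] True by simp
      next
        case False
        then have "z (m + i) \<le> 0"
          using compatD(1)[OF compat_z mem IH(2)] zri by simp
        then show ?thesis
          using False by simp
      qed
      have "\<forall>j<Suc i. z (m + j) = (if even j then c else 0)"
        using IH(3) zmi by (auto simp: less_Suc_eq)
      moreover have "z (m + i) = z (Suc r + i)"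
        using zmi zri by simp
      ultimately show ?case
        using IH(1,2) z_eq_order[OF mem(1,2) ne] z_eq_order[OF mem(2,1) ne[symmetric]] by auto
    qed
    have low: "\<not> \<pi> p < \<pi> n" if "p \<in> {1..n}" for p
      using n1 pi_mem[OF that] by auto
    \<comment> \<open>If the run from \<open>r + 1\<close> reached \<open>n\<close> no later than
      the run from \<open>m\<close>, this would happen after an odd number of steps, and
      \<open>m + i\<close> would have smaller rank than \<open>n\<close>.\<close>
    have less: "n - m < n - Suc r"
    proof (rule ccontr)
      assume neg: "\<not> n - m < n - Suc r"
      define i where "i = n - Suc r"
      have i: "m + i \<le> n" "Suc r + i = n" "odd i"
        using neg mn r(1) ev unfolding i_def by (auto simp: Suc_diff_Suc)
      then have "\<pi> (m + i) < \<pi> n"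
        using track[of i] by simp
      then show False
        using low[of "m + i"] i m_props by auto
    qed
    have *: "m + (n - m) = n" "Suc r + (n - m) \<le> n"
      using mn less by auto
    have "odd (n - m)"
    proof
      assume "even (n - m)"
      then have "\<pi> (Suc r + (n - m)) < \<pi> n"
        using track[of "n - m"] * by simp
      then show False
        using low[of "Suc r + (n - m)"] * by auto
    qed
    moreover have "\<forall>j<n - m. z (m + j) = (if even j then c else 0)"
      using track[of "n - m"] * by simp
    ultimately show ?thesis
      by blast
  qed
qed

lemma a_seq_not_collapsed:
  assumes "\<not> collapsed n \<pi>"
  shows "a_seq n \<pi> = (if even (n - m) then
      if \<pi> n = 1 then cycle (seg z m n @ [0]) else seg z m n @- cycle (seg z l n)
    else seg z m n @- cycle (seg z r n))"
  using assms by (simp add: a_seq_def Let_def)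

text \<open>For even \<open>n - m\<close> the sequence has an odd period, which excludes
  \<open>c 0 c 0 ...\<close> unless \<open>c = 0\<close>. For odd \<open>n - m\<close>, removing a
  prefix of odd length turns \<open>c 0 c 0 ...\<close> into \<open>0 c 0 c ...\<close>; the
  converse is \<open>alternating_from_m\<close>. If \<open>c = 0\<close>, both sides hold.\<close>

lemma a_seq_bottom:
  assumes n1: "\<pi> n = 1"
  shows "a_seq n \<pi> = cycle [c, 0] \<longleftrightarrow> cycle (seg z r n) = cycle [0, c]"
proof -
  have nc: "\<not> collapsed n \<pi>"
    using n1 by (simp add: collapsed_def)
  have nn: "\<pi> n \<noteq> n"
    using n1 n_ge by simp
  note r = r_props(1)[OF nn]
  show ?thesis
  proof (cases "c = 0")
    case True
    have z0: "z j = 0" if "j \<in> {1..<n}" for j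
      using z_le_c[OF that] True by simp
    have cyc: "cycle (seg z r n) = cycle [0, 0]"
      using snth_cycle_z_le[OF r] True by (intro stream_zero_eq_cycle) simp
    have "a_seq n \<pi> !! i \<le> 0" for i
    proof -
      have "cycle (seg z m n @ [0]) !! i \<le> 0"
        by (rule snth_cycle_le) (use z0 m_props(1) in \<open>auto simp: seg_def\<close>)
      moreover have "(seg z m n @- cycle (seg z r n)) !! i \<le> 0"
        unfolding cyc using z0[of "m + i"] m_props(1) seg_nth[of m i n z]
        by (cases "i < n - m") (auto simp: shift_snth_less shift_snth_ge snth_cycle2)
      ultimately show ?thesis
        using n1 by (simp add: a_seq_not_collapsed[OF nc])
    qed
    then show ?thesis
      using stream_zero_eq_cycle[of "a_seq n \<pi>"] cyc True by simp
  next
    case False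
    show ?thesis
    proof
      assume a: "a_seq n \<pi> = cycle [c, 0]"
      have odd: "odd (n - m)"
      proof
        assume "even (n - m)"
        then have "cycle (seg z m n @ [0]) = cycle [c, 0]" "odd (length (seg z m n @ [0]))"
          using a n1 by (simp_all add: a_seq_not_collapsed[OF nc])
        then show False
          using cycle_eq_cycle2_odd[of "seg z m n @ [0]" c 0] False by simp
      qed
      then show "cycle (seg z r n) = cycle [0, c]"
        using a shift_eq_cycle2[of "seg z m n" "cycle (seg z r n)" c 0] by (simp add: a_seq_not_collapsed[OF nc])
    next
      assume eq: "cycle (seg z r n) = cycle [0, c]"
      note alt = alternating_from_m[OF n1 _ eq]
      have "(seg z m n @- cycle [0, c]) !! i = cycle [c, 0] !! i" for i
      proof (cases "i < n - m")
        case True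
        then show ?thesis
          using alt False seg_nth[of m i n z] by (simp add: shift_snth_less snth_cycle2)
      next
        case False': False
        then show ?thesis
          using alt False by (auto simp: shift_snth_ge snth_cycle2)
      qed
      then show "a_seq n \<pi> = cycle [c, 0]"
        using alt False eq by (auto simp: a_seq_not_collapsed[OF nc] intro: stream_eqI)
    qed
  qed
qed

text \<open>With both rank neighbours present and no collapse, \<open>a = c 0 c 0 ...\<close> would
  make the lower bound the largest sequence or the upper bound the smallest one, although the lower
  bound is strictly below the upper one.\<close>

lemma epsilon_eq: "epsilon n \<pi> = (if extendable c then 0 else 1)"
proof (cases "collapsed n \<pi>")
  case True
  have "\<not> extendable c"
  proof
    assume "extendable c"
    then obtain t where "alt_less (cycle (seg z l n)) t" "alt_less t (cycle (seg z r n))"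
      using collapsed_imp_cycle_eq[OF True] unfolding extendable_def by blast
    then show False
      using alt_less_asym collapsed_imp_cycle_eq(3)[OF True] by auto
  qed
  then show ?thesis
    using True by (simp add: epsilon_def)
next
  case False
  have "extendable c \<longleftrightarrow> a_seq n \<pi> \<noteq> cycle [c, 0]"
  proof -
    consider "\<pi> n = n" | "\<pi> n = 1" | "\<pi> n \<noteq> 1" "\<pi> n \<noteq> n"
      by blast
    then show ?thesis
    proof cases
      case 1
      then have "m = n"
        by (metis m_props(2) pi_inj)
      then have "a_seq n \<pi> = cycle (seg z l n)"
        using a_seq_not_collapsed[OF False] 1 n_ge by simp
      then show ?thesis
        using extendable_top[OF 1] by simp
    next
      case 2
      then show ?thesis
        using extendable_bottom a_seq_bottom by simp
    next
      case 3
      note lt = extendable_middle(1)[OF 3 False]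
      have l: "l \<in> {1..<n}" and r: "r \<in> {1..<n}"
        using l_props(1) r_props(1) 3 by blast+
      have "a_seq n \<pi> \<noteq> cycle [c, 0]"
      proof
        assume a: "a_seq n \<pi> = cycle [c, 0]"
        show False
        proof (cases "even (n - m)")
          case True
          then have "cycle (seg z l n) = cycle [c, 0]"
            using a shift_eq_cycle2[of "seg z m n" "cycle (seg z l n)" c 0] a_seq_not_collapsed[OF False] 3 by simp
          then show False
            using lt cycle_max_not_less[OF snth_cycle_z_le[OF r]] by simp
        next
          case odd: False
          then have "cycle (seg z r n) = cycle [0, c]"
            using a shift_eq_cycle2[of "seg z m n" "cycle (seg z r n)" c 0] a_seq_not_collapsed[OF False] by simp
          then show False
            using lt not_less_cycle_min[OF snth_cycle_z_le[OF l]] by simp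
        qed
      qed
      then show ?thesis
        using extendable_middle(2)[OF 3 False] by simp
    qed
  qed
  then show ?thesis
    using False by (simp add: epsilon_def c_def)
qed

lemma N_minus_eq: "N_minus n \<pi> = c + 1 + epsilon n \<pi>"
  by (simp add: N_minus_extendable epsilon_eq)

end

section \<open>Expansions in negative base\<close>

text \<open>The number with \<open>(-\<beta>)\<close>-expansion \<open>xs\<close> followed by \<open>d d d \<dots>\<close>.\<close>

primrec neg_val :: "real \<Rightarrow> nat \<Rightarrow> nat list \<Rightarrow> real" where
  "neg_val \<beta> d [] = (real d + 1) / (\<beta> + 1)"
| "neg_val \<beta> d (x # xs) = (real x + 1 - neg_val \<beta> d xs) / \<beta>"

text \<open>All suffixes have value below 1, with the denominators cleared; positivity then follows.
  The strict inequalities exclude the endpoint 1 and make the condition open in \<beta>.\<close>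

primrec admissible :: "real \<Rightarrow> nat \<Rightarrow> nat list \<Rightarrow> bool" where
  "admissible \<beta> d [] \<longleftrightarrow> real d < \<beta>"
| "admissible \<beta> d (x # xs) \<longleftrightarrow> admissible \<beta> d xs \<and> real x + 1 - neg_val \<beta> d xs < \<beta>"

lemma admissible_val:
  assumes "\<beta> > 1" "admissible \<beta> d xs"
  shows "0 < neg_val \<beta> d xs \<and> neg_val \<beta> d xs < 1"
  using assms by (induction xs) (auto simp: field_simps intro: add_pos_nonneg)

lemma admissible_drop: "admissible \<beta> d xs \<Longrightarrow> admissible \<beta> d (drop i xs)"
  by (induction xs arbitrary: i) (auto simp: drop_Cons split: nat.split)

text \<open>A digit with \<open>real x + 1 \<le> \<beta>\<close> may precede anything, because the
  value that follows it is positive.\<close>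

lemma admissible_small_digits:
  assumes "\<beta> > 1" "\<forall>x\<in>set ys. real x + 1 \<le> \<beta>" "admissible \<beta> d xs"
  shows "admissible \<beta> d (ys @ xs)"
  using assms(2)
proof (induction ys)
  case (Cons y ys)
  then have "admissible \<beta> d (ys @ xs)"
    by simp
  then show ?case
    using Cons.prems admissible_val[OF assms(1), of d "ys @ xs"] by simp
qed (use assms in simp)

lemma isCont_neg_val: "\<beta>0 > 0 \<Longrightarrow> isCont (\<lambda>\<beta>. neg_val \<beta> d xs) \<beta>0"
  by (induction xs) auto

text \<open>Finitely many strict inequalities between continuous functions of \<beta>. The left
  neighbourhood is what an infimum of bases calls for.\<close>

lemma eventually_admissible:
  assumes "\<beta>0 > 0" "admissible \<beta>0 d xs"
  shows "\<forall>\<^sub>F \<beta> in at_left \<beta>0. admissible \<beta> d xs"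
  using assms(2)
proof (induction xs)
  case Nil
  have "((\<lambda>\<beta>. \<beta>) \<longlongrightarrow> \<beta>0) (at_left \<beta>0)"
    by simp
  then have "\<forall>\<^sub>F \<beta> in at_left \<beta>0. real d < \<beta>"
    using Nil by (intro order_tendstoD(1)[of _ \<beta>0]) auto
  then show ?case
    by simp
next
  case (Cons x xs)
  have "isCont (\<lambda>\<beta>. \<beta> + neg_val \<beta> d xs) \<beta>0"
    using isCont_neg_val[OF assms(1)] by (intro continuous_intros) auto
  then have "((\<lambda>\<beta>. \<beta> + neg_val \<beta> d xs) \<longlongrightarrow> \<beta>0 + neg_val \<beta>0 d xs) (at_left \<beta>0)"
    using filterlim_at_split isCont_def by blast
  then have "\<forall>\<^sub>F \<beta> in at_left \<beta>0. real x + 1 < \<beta> + neg_val \<beta> d xs"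
    using Cons.prems by (intro order_tendstoD(1)[of _ "\<beta>0 + neg_val \<beta>0 d xs"]) auto
  moreover have "\<forall>\<^sub>F \<beta> in at_left \<beta>0. admissible \<beta> d xs"
    using Cons by simp
  ultimately show ?case
    by eventually_elim auto
qed

section \<open>Digits of orbits and allowed patterns\<close>

definition expansion :: "real \<Rightarrow> real \<Rightarrow> nat stream" where
  "expansion \<beta> x = smap (\<lambda>i. nat \<lfloor>\<beta> * (T_minus \<beta> ^^ i) x\<rfloor>) nats"

lemma expansion_snth: "expansion \<beta> x !! i = nat \<lfloor>\<beta> * (T_minus \<beta> ^^ i) x\<rfloor>"
  by (simp add: expansion_def)

lemma sdrop_expansion: "sdrop k (expansion \<beta> x) = expansion \<beta> ((T_minus \<beta> ^^ k) x)"
proof (rule stream_eqI)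
  show "sdrop k (expansion \<beta> x) !! i = expansion \<beta> ((T_minus \<beta> ^^ k) x) !! i" for i
    unfolding sdrop_snth expansion_snth by (simp add: funpow_add add.commute[of k i])
qed

lemma T_minus_range: "0 < T_minus \<beta> x \<and> T_minus \<beta> x \<le> 1"
  unfolding T_minus_def by linarith

lemma T_minus_iterate_range:
  assumes "x \<in> {0<..1}"
  shows "(T_minus \<beta> ^^ i) x \<in> {0<..1}"
  using assms T_minus_range by (cases i) auto

lemma T_minus_digit:
  assumes "\<beta> > 1" "x \<in> {0<..1}"
  shows "T_minus \<beta> x = real (nat \<lfloor>\<beta> * x\<rfloor>) + 1 - \<beta> * x"
proof -
  have "0 \<le> \<lfloor>\<beta> * x\<rfloor>"
    using assms by simp
  then show ?thesis
    by (simp add: T_minus_def)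
qed

text \<open>While the digits agree, the difference of the two orbits is multiplied by
  \<open>- \<beta>\<close>. It stays bounded, so the digits must differ at some point, and there its
  sign is given by the parity of the index.\<close>

lemma expansion_less:
  assumes "\<beta> > 1" "x \<in> {0<..1}" "y \<in> {0<..1}" "x < y"
  shows "alt_less (expansion \<beta> x) (expansion \<beta> y)"
proof -
  let ?X = "\<lambda>i. (T_minus \<beta> ^^ i) x"
  let ?Y = "\<lambda>i. (T_minus \<beta> ^^ i) y"
  have range: "?X i \<in> {0<..1}" "?Y i \<in> {0<..1}" for i
    using assms(2,3) T_minus_iterate_range by blast+
  have pow: "?Y k - ?X k = (- \<beta>) ^ k * (y - x)"
    if "\<forall>i<k. expansion \<beta> x !! i = expansion \<beta> y !! i" for k
    using that
  proof (induction k)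
    case (Suc k)
    have "?Y (Suc k) - ?X (Suc k) = - \<beta> * (?Y k - ?X k)"
      using Suc.prems T_minus_digit[OF assms(1) range(1)[of k]] T_minus_digit[OF assms(1) range(2)[of k]]
      by (simp add: expansion_snth algebra_simps)
    also have "\<dots> = (- \<beta>) ^ Suc k * (y - x)"
      using Suc by simp
    finally show ?case .
  qed simp
  have "expansion \<beta> x \<noteq> expansion \<beta> y"
  proof
    assume eq: "expansion \<beta> x = expansion \<beta> y"
    obtain k where k: "1 / (y - x) < \<beta> ^ k"
      using real_arch_pow[OF assms(1)] by blast
    have "1 < \<beta> ^ k * (y - x)"
      using k assms(4) by (simp add: field_simps)
    also have "\<dots> = \<bar>(- \<beta>) ^ k * (y - x)\<bar>"
      using assms(1,4) by (simp add: abs_mult power_abs)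
    also have "\<dots> = \<bar>?Y k - ?X k\<bar>"
      using pow eq by simp
    also have "\<dots> \<le> 1"
      using range(1)[of k] range(2)[of k] by auto
    finally show False
      by simp
  qed
  then obtain k where k: "\<forall>i<k. expansion \<beta> x !! i = expansion \<beta> y !! i"
    "expansion \<beta> x !! k \<noteq> expansion \<beta> y !! k"
    by (rule first_diff_exists)
  have mono: "nat \<lfloor>\<beta> * s\<rfloor> \<le> nat \<lfloor>\<beta> * t\<rfloor>" if "s \<le> t" for s t
    using that assms(1) by (intro nat_mono floor_mono) simp
  have "(- \<beta>) ^ k * (y - x) > 0 \<longleftrightarrow> even k" "(- \<beta>) ^ k * (y - x) < 0 \<longleftrightarrow> odd k"
    using assms(1,4) by (cases "even k"; simp add: zero_less_mult_iff mult_less_0_iff)+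
  then have "?X k < ?Y k \<longleftrightarrow> even k" "?Y k < ?X k \<longleftrightarrow> odd k"
    using pow[OF k(1)] by auto
  then have "if even k then expansion \<beta> x !! k \<le> expansion \<beta> y !! k
      else expansion \<beta> y !! k \<le> expansion \<beta> x !! k"
    unfolding expansion_snth using mono[of "?X k" "?Y k"] mono[of "?Y k" "?X k"] by auto
  then show ?thesis
    using k by (intro alt_lessI[of k]) (auto split: if_splits)
qed

context perm_pattern
begin

lemma allowed_imp_shift_pat:
  assumes "\<beta> > 1" "\<pi> \<in> allowed_pats {0<..1} (T_minus \<beta>) n"
  obtains x where "x \<in> {0<..1}" "is_pat x (T_minus \<beta>) n \<pi>" "is_shift_pat (expansion \<beta> x) n \<pi>"
proof -
  obtain x where x: "x \<in> {0<..1}" "is_pat x (T_minus \<beta>) n \<pi>"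
    using assms(2) by (auto simp: allowed_pats_def)
  have "is_shift_pat (expansion \<beta> x) n \<pi>"
    using x assms(1)
    by (intro is_shift_patI) (auto simp: sdrop_expansion is_pat_def simp del: greaterThanAtMost_iff
        intro!: expansion_less T_minus_iterate_range)
  then show ?thesis
    using that x by blast
qed

text \<open>The suffix values \<open>V i\<close> form an orbit: the equation in \<open>step\<close>
  together with \<open>0 < V (Suc i) < 1\<close> makes the letter the floor of
  \<open>\<beta> * V i\<close>. Beyond \<open>xs\<close> the value is constant, in accordance with
  the tail \<open>cycle [d]\<close>.\<close>

lemma admissible_imp_allowed:
  assumes \<beta>: "\<beta> > 1" and w: "is_shift_pat (xs @- cycle [d]) n \<pi>" and adm: "admissible \<beta> d xs"
  shows "\<pi> \<in> allowed_pats {0<..1} (T_minus \<beta>) n"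
proof -
  let ?w = "xs @- cycle [d]"
  define V where "V i = neg_val \<beta> d (drop i xs)" for i
  have V: "0 < V i" "V i < 1" for i
    using admissible_val[OF \<beta> admissible_drop[OF adm]] by (auto simp: V_def)
  have step: "\<beta> * V i = real (?w !! i) + 1 - V (Suc i)" for i
  proof (cases "i < length xs")
    case True
    then have "drop i xs = xs ! i # drop (Suc i) xs"
      by (simp add: Cons_nth_drop_Suc)
    then show ?thesis
      using \<beta> True by (simp add: V_def shift_snth_less)
  next
    case False
    then show ?thesis
      using \<beta> by (simp add: V_def shift_snth_ge snth_cycle1 field_simps)
  qed
  have floor: "\<lfloor>\<beta> * V i\<rfloor> = int (?w !! i)" for i
    unfolding step using V[of "Suc i"] by linarith
  have T: "T_minus \<beta> (V i) = V (Suc i)" for i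
    unfolding T_minus_def floor using step[of i] by simp
  have iter: "(T_minus \<beta> ^^ k) (V i) = V (i + k)" for i k
    by (induction k) (simp_all add: T)
  have exp: "expansion \<beta> (V i) = sdrop i ?w" for i
    by (rule stream_eqI) (simp add: expansion_snth iter floor sdrop_snth)
  have less: "V (p - 1) < V (q - 1)" if "p \<in> {1..n}" "q \<in> {1..n}" "\<pi> p < \<pi> q" for p q
  proof (rule ccontr)
    assume "\<not> ?thesis"
    then consider "V (p - 1) = V (q - 1)" | "V (q - 1) < V (p - 1)"
      by linarith
    then have "tail ?w p = tail ?w q \<or> alt_less (tail ?w q) (tail ?w p)"
      using expansion_less[OF \<beta>, of "V (q - 1)" "V (p - 1)"] V by cases (auto simp flip: exp intro: less_imp_le)
    then show False
      using is_shift_patD[OF w that] alt_less_irrefl alt_less_asym by metis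
  qed
  have "is_pat (V 0) (T_minus \<beta>) n \<pi>"
    unfolding is_pat_def iter add_0
  proof (intro conjI ballI)
    show "inj_on (\<lambda>i. V (i - 1)) {1..n}"
    proof (rule inj_onI, rule ccontr)
      fix p q assume "p \<in> {1..n}" "q \<in> {1..n}" "V (p - 1) = V (q - 1)" "p \<noteq> q"
      then show False
        using less[of p q] less[of q p] pi_inj[of p q] by (metis linorder_neqE_nat less_irrefl)
    qed
    show "(\<pi> i < \<pi> j) = (V (i - 1) < V (j - 1))" if "i \<in> {1..n}" "j \<in> {1..n}" for i j
      using less[of i j] less[of j i] that pi_inj[of i j] by (metis linorder_neqE_nat less_asym less_irrefl)
  qed (rule perm)
  then show ?thesis
    unfolding allowed_pats_def using V[of 0] by (auto intro!: bexI[of _ "V 0"])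
qed

abbreviation bases :: "real set" where
  "bases \<equiv> {\<beta>. \<beta> > 1 \<and> \<pi> \<in> allowed_pats {0<..1} (T_minus \<beta>) n}"

lemma bdd_below_bases: "bdd_below bases"
  by (rule bdd_belowI[of _ 1]) auto

lemma B_minus_le:
  assumes "\<beta> > 1" "is_shift_pat (xs @- cycle [d]) n \<pi>" "admissible \<beta> d xs"
  shows "B_minus n \<pi> \<le> \<beta>"
  unfolding B_minus_def using assms admissible_imp_allowed by (intro cInf_lower bdd_below_bases) auto

lemma B_minus_less:
  assumes "\<beta> > 1" "is_shift_pat (xs @- cycle [d]) n \<pi>" "admissible \<beta> d xs"
  shows "B_minus n \<pi> < \<beta>"
proof -
  have "\<forall>\<^sub>F \<gamma> in at_left \<beta>. admissible \<gamma> d xs"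
    using assms by (intro eventually_admissible) auto
  moreover have "\<forall>\<^sub>F \<gamma> in at_left \<beta>. \<gamma> \<in> {1<..<\<beta>}"
    using assms(1) by (rule eventually_at_left_real)
  ultimately have "\<forall>\<^sub>F \<gamma> in at_left \<beta>. admissible \<gamma> d xs \<and> \<gamma> \<in> {1<..<\<beta>}"
    by (rule eventually_conj)
  then obtain \<gamma> where "admissible \<gamma> d xs" "1 < \<gamma>" "\<gamma> < \<beta>"
    using eventually_happens[of _ "at_left \<beta>"] trivial_limit_at_left_real by fastforce
  then show ?thesis
    using B_minus_le[of \<gamma> xs d] assms(2) by simp
qed

text \<open>Each of the finitely many comparisons is decided at a finite index, so everything behind
  a common bound can be replaced.\<close>

lemma pattern_eventually_constant:
  assumes "is_shift_pat w n \<pi>"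
  obtains k where "\<And>s. is_shift_pat (stake k w @- s) n \<pi>"
proof -
  have "\<exists>j. (\<forall>i<j. tail w p !! i = tail w q !! i) \<and> tail w p !! j \<noteq> tail w q !! j"
    if "p \<in> {1..n}" "q \<in> {1..n}" "\<pi> p < \<pi> q" for p q
    using is_shift_patD[OF assms that] alt_less_irrefl first_diff_exists by metis
  then obtain D where D: "\<forall>i<D p q. tail w p !! i = tail w q !! i" "tail w p !! D p q \<noteq> tail w q !! D p q"
    if "p \<in> {1..n}" "q \<in> {1..n}" "\<pi> p < \<pi> q" for p q
    by metis
  \<comment> \<open>Pairs not in increasing rank contribute unspecified values; they can only
    enlarge the bound.\<close>
  define M where "M = Max ((\<lambda>(p, q). D p q) ` ({1..n} \<times> {1..n}))"
  have M: "D p q \<le> M" if "p \<in> {1..n}" "q \<in> {1..n}" for p q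
    unfolding M_def using that by (intro Max_ge) auto
  define k where "k = n + Suc M"
  have "is_shift_pat (stake k w @- s) n \<pi>" for s
  proof (rule is_shift_patI)
    fix p q assume pq: "p \<in> {1..n}" "q \<in> {1..n}" "\<pi> p < \<pi> q"
    have agree: "tail (stake k w @- s) p !! i = tail w p !! i"
      if "i \<le> D p' q'" "p \<in> {1..n}" "p' \<in> {1..n}" "q' \<in> {1..n}" for p i p' q'
    proof -
      have "p - 1 + i < k"
        using that M[of p' q'] unfolding k_def atLeastAtMost_iff by linarith
      then show ?thesis
        by (simp add: sdrop_snth shift_snth_less stake_nth)
    qed
    show "alt_less (tail (stake k w @- s) p) (tail (stake k w @- s) q)"
      using alt_less_cong_prefix[OF is_shift_patD[OF assms pq] D[OF pq]] agree pq by blast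
  qed
  then show ?thesis
    using that by blast
qed

text \<open>With a single letter all tails coincide. The bound makes \<open>N_minus n \<pi>\<close>
  a legitimate base, greater than 1.\<close>

lemma N_minus_ge_2: "N_minus n \<pi> \<ge> 2"
proof (rule ccontr)
  assume less: "\<not> ?thesis"
  obtain w where w: "is_shift_pat w n \<pi>" "\<And>i. w !! i < N_minus n \<pi>"
    using N_minus_pattern by blast
  have "w !! i \<le> 0" for i
    using w(2)[of i] less by simp
  then have "compat (\<lambda>_. 0)" "is_shift_pat (cycle [0, 0]) n \<pi>"
    using is_shift_pat_compat[OF w(1)] stream_zero_eq_cycle[of w] w(1) by auto
  moreover obtain p q where "p \<in> {1..n}" "q \<in> {1..n}" "\<pi> p < \<pi> q"
    using n_ge inv_mem[of 1] inv_mem[of 2] by (metis One_nat_def Suc_leD atLeastAtMost_iff le_refl lessI numeral_2_eq_2 one_le_numeral pi_inv)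
  ultimately have "alt_less (tail (cycle [0, 0]) p) (tail (cycle [0, 0]) q)"
    using is_shift_patD by blast
  then show False
    by (simp add: sdrop_cycle2 alt_less_irrefl)
qed

lemma B_minus_less_N: "bases \<noteq> {}" "B_minus n \<pi> < real (N_minus n \<pi>)"
proof -
  obtain w where w: "is_shift_pat w n \<pi>" "\<And>i. w !! i < N_minus n \<pi>"
    using N_minus_pattern by blast
  obtain k where k: "is_shift_pat (stake k w @- cycle [0]) n \<pi>"
    using pattern_eventually_constant[OF w(1)] by blast
  have N: "real (N_minus n \<pi>) > 1"
    using N_minus_ge_2 by simp
  have "real x + 1 \<le> real (N_minus n \<pi>)" if "x \<in> set (stake k w)" for x
  proof -
    have "x < N_minus n \<pi>"
      using that w(2) by (auto simp: in_set_conv_nth)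
    then show ?thesis
      by linarith
  qed
  then have adm: "admissible (real (N_minus n \<pi>)) 0 (stake k w)"
    using admissible_small_digits[OF N, of "stake k w" 0 "[]"] N by simp
  show "B_minus n \<pi> < real (N_minus n \<pi>)"
    by (rule B_minus_less[OF N k adm])
  show "bases \<noteq> {}"
    using admissible_imp_allowed[OF N k adm] N by blast
qed

lemma N_minus_floor: "int (N_minus n \<pi>) = \<lfloor>B_minus n \<pi>\<rfloor> + 1"
proof -
  \<comment> \<open>The infimum need not be attained; a base below the next integer has the same
    floor.\<close>
  have "B_minus n \<pi> < of_int (\<lfloor>B_minus n \<pi>\<rfloor> + 1)"
    by linarith
  then obtain \<beta> where \<beta>: "\<beta> \<in> bases" "\<beta> < of_int (\<lfloor>B_minus n \<pi>\<rfloor> + 1)"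
    unfolding B_minus_def using cInf_lessD[OF B_minus_less_N(1)] by blast
  then obtain x where x: "x \<in> {0<..1}" "is_shift_pat (expansion \<beta> x) n \<pi>"
    using allowed_imp_shift_pat[of \<beta>] by blast
  have "expansion \<beta> x !! i < nat (\<lfloor>\<beta>\<rfloor> + 1)" for i
  proof -
    have "\<beta> * (T_minus \<beta> ^^ i) x \<le> \<beta> * 1"
      using \<beta>(1) T_minus_iterate_range[OF x(1), where \<beta> = \<beta> and i = i] by (intro mult_left_mono) auto
    then have "\<lfloor>\<beta> * (T_minus \<beta> ^^ i) x\<rfloor> \<le> \<lfloor>\<beta>\<rfloor>"
      by (intro floor_mono) simp
    moreover have "0 \<le> \<lfloor>\<beta>\<rfloor>"
      using \<beta>(1) by simp
    ultimately show ?thesis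
      unfolding expansion_snth by linarith
  qed
  then have "N_minus n \<pi> \<le> nat (\<lfloor>\<beta>\<rfloor> + 1)"
    by (rule N_minus_le[OF x(2)])
  moreover have "\<lfloor>\<beta>\<rfloor> \<le> \<lfloor>B_minus n \<pi>\<rfloor>" "0 \<le> \<lfloor>\<beta>\<rfloor>"
    using \<beta> by (simp_all add: floor_less_iff)  linarith
  ultimately have "int (N_minus n \<pi>) \<le> \<lfloor>B_minus n \<pi>\<rfloor> + 1"
    by linarith
  moreover have "\<lfloor>B_minus n \<pi>\<rfloor> < int (N_minus n \<pi>)"
    using B_minus_less_N(2) by (simp add: floor_less_iff)
  ultimately show ?thesis
    by linarith
qed

end

section \<open>The base of the extremal sequence\<close>

text \<open>Followed by zeros, this is the extremal sequence for \<open>n = k + 2\<close>.\<close>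

definition stair :: "nat \<Rightarrow> nat list" where
  "stair k = rev [1..<Suc k]"

lemma stair_0 [simp]: "stair 0 = []"
  by (simp add: stair_def)

lemma stair_Suc [simp]: "stair (Suc k) = Suc k # stair k"
  by (simp add: stair_def)

lemma length_stair [simp]: "length (stair k) = k"
  by (simp add: stair_def)

lemma set_stair: "x \<in> set (stair k) \<longleftrightarrow> 1 \<le> x \<and> x \<le> k"
  by (auto simp: stair_def)

text \<open>Each digit in front cancels in the difference and contributes a factor
  \<open>- 1 / \<beta>\<close>. Hence the parity of the length decides whether a change of the
  continuation raises or lowers the value.\<close>

lemma neg_val_append_diff:
  "neg_val \<beta> d (xs @ ys) - neg_val \<beta> e xs = (- 1 / \<beta>) ^ length xs * (neg_val \<beta> d ys - neg_val \<beta> e [])"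
proof (induction xs)
  case (Cons x xs)
  have "neg_val \<beta> d ((x # xs) @ ys) - neg_val \<beta> e (x # xs)
      = (- 1 / \<beta>) * (neg_val \<beta> d (xs @ ys) - neg_val \<beta> e xs)"
    by (simp add: diff_divide_distrib)
  then show ?case
    using Cons by simp
qed simp

lemma neg_val_replicate_same: "\<beta> > 1 \<Longrightarrow> neg_val \<beta> d (replicate q d) = neg_val \<beta> d []"
  by (induction q) (auto simp: field_simps)

lemma neg_val_stair_bounds:
  assumes "x \<ge> 1" "real k + 1 \<le> x"
  shows "0 < neg_val x 0 (stair k) \<and> neg_val x 0 (stair k) < 1"
  using assms(2)
proof (induction k)
  case 0
  then show ?case
    using assms(1) by simp
next
  case (Suc k)
  then have "0 < neg_val x 0 (stair k) \<and> neg_val x 0 (stair k) < 1"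
    by simp
  then show ?case
    using Suc.prems assms(1) by (simp add: divide_less_eq)
qed

text \<open>Makes \<open>x + neg_val x 0 (stair k)\<close> strictly increasing, so that the
  staircase has value below 1 exactly beyond a threshold. In the induction, \<open>x\<close> times
  the new difference is less than \<open>2 * \<bar>x - y\<bar>\<close>, and
  \<open>2 \<le> x\<close>.\<close>

lemma neg_val_stair_lipschitz:
  assumes "x \<noteq> y" "real k + 1 \<le> x" "real k + 1 \<le> y"
  shows "\<bar>neg_val x 0 (stair k) - neg_val y 0 (stair k)\<bar> < \<bar>x - y\<bar>"
  using assms(2,3)
proof (induction k)
  case 0
  define P where "P = (x + 1) * (y + 1)"
  have "(x + 1) * (y + 1) > 1 * 1"
    using 0 by (intro mult_strict_mono) auto
  then have P: "P > 1"
    by (simp add: P_def)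
  have "neg_val x 0 [] - neg_val y 0 [] = (y - x) / P"
    using 0 by (simp add: P_def field_simps)
  moreover have "\<bar>(y - x) / P\<bar> = \<bar>x - y\<bar> / P"
    using P by (simp add: abs_divide abs_minus_commute)
  moreover have "\<bar>x - y\<bar> * 1 < \<bar>x - y\<bar> * P"
    using P assms(1) by (intro mult_strict_left_mono) auto
  ultimately show ?case
    using P by (simp add: divide_less_eq)
next
  case (Suc k)
  let ?u = "\<lambda>x. neg_val x 0 (stair k)" and ?v = "\<lambda>x. neg_val x 0 (stair (Suc k))"
  have IH: "\<bar>?u x - ?u y\<bar> < \<bar>x - y\<bar>"
    using Suc by simp
  have x: "x * ?v x = real k + 2 - ?u x" and y: "y * ?v y = real k + 2 - ?u y"
    using Suc.prems by simp_all
  have v: "0 < ?v y" "?v y < 1"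
    using neg_val_stair_bounds[of y "Suc k"] Suc.prems by auto
  have "x * (?v x - ?v y) = - ((x - y) * ?v y + (?u x - ?u y))"
    using x y by (simp only: algebra_simps)
  then have "x * \<bar>?v x - ?v y\<bar> = \<bar>(x - y) * ?v y + (?u x - ?u y)\<bar>"
    using Suc.prems(1) by (metis abs_minus_cancel abs_mult abs_of_nonneg add_nonneg_nonneg of_nat_0_le_iff order_trans zero_le_one)
  also have "\<dots> \<le> \<bar>x - y\<bar> * ?v y + \<bar>?u x - ?u y\<bar>"
  proof -
    have "\<bar>(x - y) * ?v y\<bar> = \<bar>x - y\<bar> * ?v y"
      using v(1) by (simp only: abs_mult abs_of_pos)
    then show ?thesis
      using abs_triangle_ineq[of "(x - y) * ?v y" "?u x - ?u y"] by linarith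
  qed
  also have "\<dots> < \<bar>x - y\<bar> * 1 + \<bar>x - y\<bar>"
    using IH v by (intro add_le_less_mono mult_left_mono) auto
  also have "\<dots> \<le> x * \<bar>x - y\<bar>"
    using Suc.prems(1) mult_right_mono[of 2 x "\<bar>x - y\<bar>"] by simp
  finally show ?case
    using Suc.prems(1) by (simp only: mult_less_cancel_left)
qed

text \<open>The equation is the one that defines \<open>b_seq\<close> for the staircase sequence;
  the last clause excludes larger solutions and is the form in which the base is used in
  estimates.\<close>

definition is_stair_base :: "nat \<Rightarrow> real \<Rightarrow> bool" where
  "is_stair_base k b \<longleftrightarrow> real k < b \<and> b < real k + 1 \<and> neg_val b 0 (stair k) = 1 \<and>
     (\<forall>x\<ge>real k. neg_val x 0 (stair k) < 1 \<longleftrightarrow> b < x)"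

text \<open>Value 1 means \<open>h b = k + 1\<close>. As staircase values lie strictly between 0 and
  1, \<open>h\<close> is below \<open>k + 1\<close> at \<open>k\<close> and above it at
  \<open>k + 1\<close>.\<close>

lemma is_stair_base_exists:
  assumes "k \<ge> 1"
  obtains b where "is_stair_base k b"
proof -
  obtain j where k: "k = Suc j"
    using assms by (cases k) auto
  define h where "h x = x + neg_val x 0 (stair j)" for x
  have val: "neg_val x 0 (stair k) = (real k + 1 - neg_val x 0 (stair j)) / x" for x
    by (simp add: k)
  have mono: "h x < h y" if "real k \<le> x" "x < y" for x y
    using neg_val_stair_lipschitz[of x y j] that by (simp add: h_def k)
  have "h (real k) < real k + 1" "real k + 1 < h (real k + 1)"
    using neg_val_stair_bounds[of "real k" j] neg_val_stair_bounds[of "real k + 1" j] by (auto simp: h_def k)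
  moreover have "continuous_on {real k..real k + 1} h"
    unfolding h_def using isCont_neg_val assms
    by (intro continuous_at_imp_continuous_on ballI continuous_intros) auto
  ultimately obtain b where b: "real k \<le> b" "b \<le> real k + 1" "h b = real k + 1"
    using IVT'[of h "real k" "real k + 1" "real k + 1"] by auto
  have strict: "real k < b" "b < real k + 1"
    using b \<open>h (real k) < real k + 1\<close> \<open>real k + 1 < h (real k + 1)\<close> by (auto simp: less_le)
  have "neg_val b 0 (stair k) = 1"
    using b strict unfolding val h_def by (simp add: field_simps)
  moreover have "neg_val x 0 (stair k) < 1 \<longleftrightarrow> b < x" if "x \<ge> real k" for x
  proof -
    have "x > 0"
      using that assms by linarith
    then have "neg_val x 0 (stair k) < 1 \<longleftrightarrow> real k + 1 - neg_val x 0 (stair j) < x"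
      unfolding val by (simp add: divide_less_eq)
    also have "\<dots> \<longleftrightarrow> h b < h x"
      using b(3) by (auto simp: h_def)
    also have "\<dots> \<longleftrightarrow> b < x"
      using mono[of b x] mono[of x b] that b(1) by (metis less_asym less_irrefl linorder_neqE_linordered_idom)
    finally show ?thesis .
  qed
  ultimately show ?thesis
    using that[of b] strict by (simp add: is_stair_base_def)
qed

text \<open>Identifies the series in \<open>b_seq\<close>, whose defining equation thereby says that
  the sequence has value 1.\<close>

lemma neg_val_sums:
  assumes "x > 1"
  shows "(\<lambda>k. (real ((xs @- cycle [d]) !! k) + 1) / (- x) ^ (k + 1)) sums (- neg_val x d xs)"
proof (induction xs)
  case Nil
  have "norm (- 1 / x) < 1"
    using assms by simp
  then have "(\<lambda>k. (real d + 1) * (- 1 / x) * (- 1 / x) ^ k) sums ((real d + 1) * (- 1 / x) * (1 / (1 - (- 1 / x))))"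
    by (intro sums_mult geometric_sums)
  moreover have "1 - (- 1 / x) = (x + 1) / x"
    using assms by (simp add: field_simps)
  then have "(real d + 1) * (- 1 / x) * (1 / (1 - (- 1 / x))) = - neg_val x d []"
    using assms by (simp add: divide_simps)
  moreover have "(real d + 1) * (- 1 / x) * (- 1 / x) ^ k = (real d + 1) / (- x) ^ (k + 1)" for k
  proof -
    have "(- 1 / x) = 1 / (- x)"
      by simp
    then show ?thesis
      by (simp only: power_one_over) (simp add: field_simps)
  qed
  ultimately show ?case
    by (simp add: snth_cycle1)
next
  case (Cons a xs)
  let ?f = "\<lambda>k. (real ((xs @- cycle [d]) !! k) + 1) / (- x) ^ (k + 1)"
  let ?g = "\<lambda>k. (real (((a # xs) @- cycle [d]) !! k) + 1) / (- x) ^ (k + 1)"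
  have "(\<lambda>k. ?f k / (- x)) sums (- neg_val x d xs / (- x))"
    using Cons by (rule sums_divide)
  moreover have "?f k / (- x) = ?g (Suc k)" for k
    by simp
  moreover have "- neg_val x d xs / (- x) = neg_val x d xs / x"
    by simp
  ultimately have "(\<lambda>k. ?g (Suc k)) sums (neg_val x d xs / x)"
    by (simp only:)
  then have "?g sums (neg_val x d xs / x + ?g 0)"
    by (rule sums_Suc)
  moreover have "neg_val x d xs / x + ?g 0 = - neg_val x d (a # xs)"
    by (simp add: diff_divide_distrib)
  ultimately show ?case
    by simp
qed

text \<open>Four letters suffice: for \<open>n = 3\<close> the staircase sequence
  \<open>1 0 0 0 ...\<close> first differs from \<open>u_word\<close> at index 3, and for larger
  \<open>n\<close> already at index 0.\<close>

lemma u_word_prefix: "u_word !! 0 = 1" "u_word !! 1 = 0" "u_word !! 2 = 0" "u_word !! 3 = 1"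
proof -
  have ne: "phi x \<noteq> []" "hd (phi x) = 1" for x
    by (auto simp: phi_def)
  have hd: "flat (smap phi s) !! 0 = 1" for s
    by (simp add: ne)
  have fp: "u_word = flat (smap phi u_word)"
    by (simp add: u_word_fixed)
  show u0: "u_word !! 0 = 1"
    by (subst fp) (rule hd)
  have "u_word = phi (shd u_word) @- flat (smap phi (stl u_word))"
    by (subst fp, subst flat_unfold) (simp_all add: ne)
  also have "phi (shd u_word) = [1, 0, 0]"
    using u0 by (simp add: phi_def)
  finally have u: "u_word = [1, 0, 0] @- flat (smap phi (stl u_word))" .
  show "u_word !! 1 = 0" "u_word !! 2 = 0" "u_word !! 3 = 1"
    by (subst u; use hd[of "stl u_word"] in \<open>simp add: numeral_2_eq_2 numeral_3_eq_3\<close>)+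
qed

lemma b_seq_stair:
  assumes "n \<ge> 3" "is_stair_base (n - 2) b"
  shows "b_seq (rev [1..<n - 1] @- cycle [0]) = b"
proof -
  have "n - 1 = Suc (n - 2)"
    using assms(1) by simp
  then have st: "rev [1..<n - 1] = stair (n - 2)"
    by (simp only: stair_def)
  let ?w = "stair (n - 2) @- cycle [0]"
  have hat: "alt_hat ?w = ?w"
    using alt_hat_staircase[OF assms(1)] st by simp
  have "alt_less u_word ?w"
  proof (cases "n = 3")
    case True
    then have w: "?w = 1 ## cycle [0]"
      by simp
    have tl: "(1 ## cycle [0::nat]) !! Suc j = 0" for j
      by (simp add: snth_cycle1)
    have "u_word !! i = (1 ## cycle [0]) !! i" if i3: "i < 3" for i
    proof -
      consider "i = 0" | "i = 1" | "i = 2"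
        using i3 by linarith
      then show ?thesis
        using u_word_prefix tl[of 0] tl[of 1] by cases (simp_all add: numeral_2_eq_2)
    qed
    moreover have "(1 ## cycle [0::nat]) !! 3 < u_word !! 3"
      using u_word_prefix(4) tl[of 2] by (simp add: numeral_3_eq_3)
    ultimately show ?thesis
      unfolding w by (intro alt_lessI[of 3]) auto
  next
    case False
    then have "?w !! 0 > 1"
      using assms(1) by (cases "n - 2") auto
    then show ?thesis
      using u_word_prefix(1) by (intro alt_lessI[of 0]) auto
  qed
  moreover have "(GREATEST x. x > 1 \<and> 1 + (\<Sum>k. (real (?w !! k) + 1) / (- x) ^ (k + 1)) = 0) = b"
  proof (rule Greatest_equality)
    have sum: "(\<Sum>k. (real (?w !! k) + 1) / (- x) ^ (k + 1)) = - neg_val x 0 (stair (n - 2))" if "x > 1" for x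
      using neg_val_sums[OF that] by (simp add: sums_iff)
    have "b > 1"
      using assms by (simp add: is_stair_base_def)
    then show "b > 1 \<and> 1 + (\<Sum>k. (real (?w !! k) + 1) / (- b) ^ (k + 1)) = 0"
      using assms(2) unfolding sum[OF \<open>b > 1\<close>] by (simp add: is_stair_base_def)
    show "x \<le> b" if "x > 1 \<and> 1 + (\<Sum>k. (real (?w !! k) + 1) / (- x) ^ (k + 1)) = 0" for x
    proof (cases "x \<ge> real (n - 2)")
      case True
      then show ?thesis
        using that sum[of x] assms(2) unfolding is_stair_base_def by (metis add.right_inverse add_left_imp_eq less_irrefl minus_minus not_less)
    next
      case False
      then show ?thesis
        using assms(2) by (simp add: is_stair_base_def)
    qed
  qed
  ultimately show ?thesis
    unfolding st b_seq_def using hat by simp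
qed

section \<open>Digits along an orbit and admissible words at the staircase base\<close>

lemma digit_less:
  fixes \<beta> x y w :: real and c d :: nat
  assumes "\<beta> > 1" "\<beta> * x = real c + 1 - y" "\<beta> * y = real d + 1 - w" "x < y" "x < w"
  shows "c < d"
proof (rule ccontr)
  assume "\<not> c < d"
  \<comment> \<open>For consecutive orbit points \<open>x\<close>, \<open>y\<close>,
    \<open>w\<close>, a digit that does not increase would allow no expansion:
    \<open>y - w < y - x\<close> because \<open>x < w\<close>.\<close>
  then have "\<beta> * (y - x) \<le> y - w"
    using assms(2,3) by (simp add: right_diff_distrib)
  moreover have "1 * (y - x) < \<beta> * (y - x)"
    using assms(1,4) by (intro mult_strict_right_mono) auto
  ultimately have "y - x < y - w"
    by simp
  then show False
    using assms(5) by simp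
qed

lemma digit_greater:
  fixes \<beta> x y w :: real and c d :: nat
  assumes "\<beta> > 1" "\<beta> * x = real c + 1 - y" "\<beta> * y = real d + 1 - w" "y < x" "w < x"
  shows "d < c"
proof (rule ccontr)
  assume "\<not> d < c"
  then have "\<beta> * (x - y) \<le> w - y"
    using assms(2,3) by (simp add: right_diff_distrib)
  moreover have "1 * (x - y) < \<beta> * (x - y)"
    using assms(1,4) by (intro mult_strict_right_mono) auto
  ultimately have "x - y < w - y"
    by simp
  then show False
    using assms(5) by simp
qed

lemma admissible_append_zeros:
  assumes "\<beta> > 1" "admissible \<beta> d xs"
  shows "admissible \<beta> d (replicate q 0 @ xs)"
  using assms by (intro admissible_small_digits) auto

lemma admissible_stair_append:
  assumes "\<beta> > 1" "real k + 1 \<le> \<beta>" "admissible \<beta> d xs"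
  shows "admissible \<beta> d (stair k @ xs)"
  using assms by (intro admissible_small_digits) (auto simp: set_stair)

text \<open>The digit \<open>j + 1\<close> is admissible in base \<open>b\<close> in front of an
  admissible word exactly if the value of that word exceeds \<open>real j + 2 - b\<close>, which is
  thus the value of \<open>stair j\<close> followed by zeros.\<close>

lemma stair_base_eq:
  assumes "is_stair_base (Suc j) b"
  shows "neg_val b 0 (stair j) = real j + 2 - b"
  using assms by (auto simp: is_stair_base_def field_simps)

text \<open>Ending in \<open>1 1 1 ...\<close> instead of \<open>0 0 0 ...\<close> changes the value
  behind the first digit by \<open>(- 1 / b) ^ (j + q) / (b + 1)\<close>, and the parity assumption
  makes this positive.\<close>

lemma admissible_stair_zeros:
  assumes b: "is_stair_base k b" "k \<ge> 1" and "odd (k + q)"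
  shows "admissible b 1 (stair k @ replicate q 0)"
proof -
  obtain j where k: "k = Suc j"
    using assms(2) by (cases k) auto
  have b1: "b > 1" "real j + 1 \<le> b"
    using b by (auto simp: is_stair_base_def k)
  have base: "admissible b 1 (stair j @ replicate q 0)"
    using b1 admissible_append_zeros[of b 1 "[]" q] by (intro admissible_stair_append) auto
  have "neg_val b 1 (stair j @ replicate q 0) - neg_val b 0 (stair j)
      = neg_val b 1 ((stair j @ replicate q 0) @ []) - neg_val b 0 (stair j @ replicate q 0)"
    using neg_val_append_diff[of b 0 "stair j" "replicate q 0" 0] neg_val_replicate_same[OF b1(1), of 0 q] by simp
  also have "\<dots> = (- 1 / b) ^ (j + q) * (1 / (b + 1))"
    unfolding neg_val_append_diff by (simp add: diff_divide_distrib[symmetric])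
  also have "\<dots> > 0"
    using assms(3) b1 by (intro mult_pos_pos zero_less_power_eq[THEN iffD2]) (auto simp: k)
  finally have "neg_val b 0 (stair j) < neg_val b 1 (stair j @ replicate q 0)"
    by simp
  then show ?thesis
    using base stair_base_eq[of j b] b(1) by (simp add: k)
qed

text \<open>For a base above \<open>b\<close> the first inequality holds with a margin \<delta>. A
  digit 1 far behind the staircase changes the value by at most
  \<open>(1 / \<beta>) ^ (j + q)\<close>, whatever the sign.\<close>

lemma admissible_stair_perturbed:
  assumes b: "is_stair_base k b" "k \<ge> 1" and \<beta>: "b < \<beta>"
  obtains i where "\<And>q. q \<ge> i \<Longrightarrow> admissible \<beta> 0 (stair k @ replicate q 0 @ [1])"
proof -
  obtain j where k: "k = Suc j"
    using assms(2) by (cases k) auto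
  have b1: "\<beta> > 1" "real j + 1 \<le> \<beta>" "real k \<le> \<beta>"
    using b \<beta> by (auto simp: is_stair_base_def k)
  define \<delta> where "\<delta> = \<beta> - (real j + 2 - neg_val \<beta> 0 (stair j))"
  have "neg_val \<beta> 0 (stair k) < 1"
    using b(1) \<beta> b1(3) by (simp add: is_stair_base_def)
  then have \<delta>: "\<delta> > 0"
    using b1 by (simp add: \<delta>_def k divide_less_eq)
  obtain i where i: "(1 / \<beta>) ^ i < \<delta>"
    using real_arch_pow_inv[OF \<delta>, of "1 / \<beta>"] b1 by auto
  have "admissible \<beta> 0 (stair k @ replicate q 0 @ [1])" if "q \<ge> i" for q
  proof -
    let ?ys = "stair j @ replicate q 0"
    have one: "admissible \<beta> 0 [1]"
    proof (cases "j = 0")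
      case True
      then show ?thesis
        using \<delta> b1 by (simp add: \<delta>_def)
    next
      case False
      then have "\<beta> \<ge> 2"
        using b1(2) by linarith
      moreover have "1 / (\<beta> + 1) > 0"
        using b1 by simp
      ultimately have "2 - 1 / (\<beta> + 1) < \<beta>"
        by linarith
      then show ?thesis
        using b1 by simp
    qed
    have base: "admissible \<beta> 0 (?ys @ [1])"
      using admissible_stair_append[OF b1(1,2) admissible_append_zeros[OF b1(1) one]] by simp
    have diff: "neg_val \<beta> 0 (?ys @ [1]) - neg_val \<beta> 0 (stair j)
      = (- 1 / \<beta>) ^ (j + q) * (neg_val \<beta> 0 [1] - neg_val \<beta> 0 [])"
      using neg_val_append_diff[of \<beta> 0 "stair j" "replicate q 0" 0] neg_val_replicate_same[OF b1(1), of 0 q]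
        neg_val_append_diff[of \<beta> 0 ?ys "[1]" 0] by simp
    have "\<bar>neg_val \<beta> 0 [1] - neg_val \<beta> 0 []\<bar> \<le> 1"
    proof -
      have "0 < neg_val \<beta> 0 []" "neg_val \<beta> 0 [] < 1"
        using admissible_val[OF b1(1), of 0 "[]"] b1 by auto
      then show ?thesis
        using admissible_val[OF b1(1) one] by linarith
    qed
    then have "\<bar>neg_val \<beta> 0 (?ys @ [1]) - neg_val \<beta> 0 (stair j)\<bar> \<le> (1 / \<beta>) ^ (j + q) * 1"
      unfolding diff abs_mult using b1 by (intro mult_mono) (auto simp: power_abs)
    also have "\<dots> \<le> (1 / \<beta>) ^ i"
      using that b1 by (simp add: power_decreasing)
    finally have "neg_val \<beta> 0 (?ys @ [1]) > neg_val \<beta> 0 (stair j) - \<delta>"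
      using i by linarith
    then show ?thesis
      using base by (simp add: k \<delta>_def)
  qed
  then show ?thesis
    using that by blast
qed

text \<open>A value starting with the digit \<open>k = j + 1\<close> exceeds
  \<open>(j + 1) / b\<close>, which is at least the value of \<open>stair j\<close>; so another
  digit \<open>k\<close> fits in front.\<close>

lemma admissible_repeat_top:
  assumes b: "is_stair_base k b" "k \<ge> 1" and adm: "admissible b d (k # ys)"
  shows "admissible b d (k # k # ys)"
proof -
  obtain j where k: "k = Suc j"
    using assms(2) by (cases k) auto
  have b1: "b > 1" "real j + 1 < b"
    using b by (auto simp: is_stair_base_def k)
  have "neg_val b 0 (stair j) \<le> (real j + 1) / b"
  proof (cases j)
    case (Suc i)
    then have "0 < neg_val b 0 (stair i)"
      using neg_val_stair_bounds[of b i] b1 by auto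
    then show ?thesis
      using Suc b1 by (simp add: divide_right_mono)
  qed (use b1 in \<open>simp add: frac_le\<close>)
  moreover have "admissible b d ys"
    using adm by simp
  then have "(real j + 1) / b < neg_val b d (k # ys)"
    using admissible_val[OF b1(1), of d ys] b1 by (simp add: k divide_strict_right_mono)
  ultimately show ?thesis
    using adm stair_base_eq[of j b] b(1) by (simp add: k)
qed

text \<open>The value of \<open>0 1 1 1 ...\<close> is below that of \<open>0 0 0 ...\<close>, hence
  below every staircase value occurring here. One digit earlier the inequality reverses, so
  \<open>[j, 0]\<close> followed by ones exceeds \<open>stair j\<close> followed by zeros.\<close>

lemma admissible_top_start:
  assumes b: "is_stair_base k b" "k \<ge> 1"
  shows "admissible b 1 [k, k - 1, 0]"
proof -
  obtain j where k: "k = Suc j"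
    using assms(2) by (cases k) auto
  have b1: "b > 1" "real j + 1 < b"
    using b by (auto simp: is_stair_base_def k)
  have "1 - 2 / (b + 1) < b * (1 / (b + 1))"
    using b1 by (simp add: field_simps)
  then have v0: "neg_val b 1 [0] < 1 / (b + 1)"
    using b1 by (simp add: divide_less_eq mult.commute)
  have adm: "admissible b 1 [0]"
    using b1 admissible_append_zeros[of b 1 "[]" 1] by simp
  have "admissible b 1 [j, 0]"
    using b1 adm admissible_val[OF b1(1) adm] by (simp del: neg_val.simps)
  moreover have "neg_val b 0 (stair j) < neg_val b 1 [j, 0]"
  proof (cases j)
    case 0
    have "1 / (b + 1) = (1 - 1 / (b + 1)) / b"
      using neg_val_replicate_same[of b 0 1] b1 by simp
    also have "\<dots> < (1 - neg_val b 1 [0]) / b"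
      using v0 b1 by (intro divide_strict_right_mono) auto
    finally show ?thesis
      using 0 by simp
  next
    case (Suc i)
    have "1 / (b + 1) \<le> neg_val b 0 (stair i)"
    proof (cases i)
      case (Suc h)
      have "neg_val b 0 (stair h) < 1"
        using neg_val_stair_bounds[of b h] b1 \<open>j = Suc i\<close> Suc by auto
      have "1 / (b + 1) \<le> 1 / b"
        using b1 by (simp add: frac_le)
      also have "\<dots> \<le> (real h + 2 - neg_val b 0 (stair h)) / b"
        using \<open>neg_val b 0 (stair h) < 1\<close> b1 by (intro divide_right_mono) auto
      finally show ?thesis
        using Suc by (simp add: add.commute)
    qed simp
    then have "neg_val b 1 [0] < neg_val b 0 (stair i)"
      using v0 by linarith
    then have "(real j + 1 - neg_val b 0 (stair i)) / b < (real j + 1 - neg_val b 1 [0]) / b"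
      using b1 by (intro divide_strict_right_mono) auto
    then show ?thesis
      using Suc by simp
  qed
  ultimately show ?thesis
    using stair_base_eq[of j b] b(1) by (simp add: k)
qed

section \<open>Monotone permutations: bounds on the base and explicit realizations\<close>

context perm_pattern
begin

text \<open>The order of the last two positions stays open, so that this notion and the next one
  together describe the four exceptional permutations.\<close>

definition upward :: bool where
  "upward \<longleftrightarrow> (\<forall>p q. 1 \<le> p \<longrightarrow> p + 2 \<le> n \<longrightarrow> p < q \<longrightarrow> q \<le> n \<longrightarrow> \<pi> p < \<pi> q)"

definition downward :: bool where
  "downward \<longleftrightarrow> (\<forall>p q. 1 \<le> p \<longrightarrow> p + 2 \<le> n \<longrightarrow> p < q \<longrightarrow> q \<le> n \<longrightarrow> \<pi> q < \<pi> p)"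

lemma orbit:
  assumes "\<beta> \<in> bases"
  obtains e d where "\<beta> > 1" "\<And>i. 0 < e i" "\<And>i. e i \<le> (1::real)"
    "\<And>i. i \<ge> 1 \<Longrightarrow> \<beta> * e i = real (d i) + 1 - e (Suc i)"
    "\<And>p q. p \<in> {1..n} \<Longrightarrow> q \<in> {1..n} \<Longrightarrow> \<pi> p < \<pi> q \<longleftrightarrow> e p < e q"
proof -
  obtain x where x: "x \<in> {0<..1}" "is_pat x (T_minus \<beta>) n \<pi>"
    using assms allowed_imp_shift_pat[of \<beta>] by blast
  have \<beta>: "\<beta> > 1"
    using assms by simp
  define e where "e i = (T_minus \<beta> ^^ (i - 1)) x" for i
  define d where "d i = nat \<lfloor>\<beta> * e i\<rfloor>" for i
  have e: "e i \<in> {0<..1}" for i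
    unfolding e_def by (rule T_minus_iterate_range[OF x(1)])
  have "\<beta> * e i = real (d i) + 1 - e (Suc i)" if "i \<ge> 1" for i
  proof -
    have "e (Suc i) = T_minus \<beta> (e i)"
      using that by (cases i) (auto simp: e_def)
    then show ?thesis
      using T_minus_digit[OF \<beta> e[of i]] by (simp add: d_def)
  qed
  moreover have "\<pi> p < \<pi> q \<longleftrightarrow> e p < e q" if "p \<in> {1..n}" "q \<in> {1..n}" for p q
    using x(2) that unfolding is_pat_def e_def by blast
  ultimately show ?thesis
    using that[of e d] \<beta> e by auto
qed

lemma digit_le_base:
  fixes \<beta> x y :: real
  assumes "\<beta> > 1" "\<beta> * x = real d + 1 - y" "x \<le> 1" "y \<le> 1"
  shows "real d \<le> \<beta>"
proof -
  have "\<beta> * x \<le> \<beta> * 1"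
    using assms(1,3) by (intro mult_left_mono) auto
  then show ?thesis
    using assms(2,4) by linarith
qed

text \<open>The digits increase strictly along the first \<open>n - 1\<close> positions, and no
  digit exceeds the base.\<close>

lemma upward_base_ge:
  assumes "n \<ge> 3" upward "\<beta> \<in> bases"
  shows "real n - 2 \<le> \<beta>"
proof -
  obtain e d where e: "\<beta> > 1" "\<And>i. 0 < e i" "\<And>i. e i \<le> (1::real)"
    "\<And>i. i \<ge> 1 \<Longrightarrow> \<beta> * e i = real (d i) + 1 - e (Suc i)"
    "\<And>p q. p \<in> {1..n} \<Longrightarrow> q \<in> {1..n} \<Longrightarrow> \<pi> p < \<pi> q \<longleftrightarrow> e p < e q"
    using orbit[OF assms(3)] by blast
  have step: "d i < d (Suc i)" if "1 \<le> i" "i + 2 \<le> n" for i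
  proof (rule digit_less[OF e(1) e(4) e(4)])
    show "e i < e (Suc i)" "e i < e (Suc (Suc i))"
      using that assms(2) e(5)[of i "Suc i"] e(5)[of i "Suc (Suc i)"] by (auto simp: upward_def)
  qed (use that in auto)
  have "i \<le> d (Suc i)" if "i + 2 \<le> n" for i
    using that
  proof (induction i)
    case (Suc i)
    then show ?case
      using step[of "Suc i"] by auto
  qed simp
  from this[of "n - 2"] have "n - 2 \<le> d (n - 1)"
    using assms(1) by (simp add: Suc_diff_Suc numeral_2_eq_2)
  moreover have "real (d (n - 1)) \<le> \<beta>"
    using digit_le_base[OF e(1) e(4)[of "n - 1"] e(3) e(3)] assms(1) by simp
  ultimately show ?thesis
    by linarith
qed

lemma downward_digits:
  assumes "downward" "\<beta> > 1" "\<And>i. i \<ge> 1 \<Longrightarrow> \<beta> * e i = real (d i) + 1 - e (Suc i)"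
    "\<And>p q. p \<in> {1..n} \<Longrightarrow> q \<in> {1..n} \<Longrightarrow> \<pi> p < \<pi> q \<longleftrightarrow> e p < e q"
    and i: "1 \<le> i" "i + 2 \<le> n"
  shows "d (Suc i) < d i"
proof (rule digit_greater[OF assms(2) assms(3) assms(3)])
  show "e (Suc i) < e i" "e (Suc (Suc i)) < e i"
    using i assms(1) assms(4)[of "Suc i" i] assms(4)[of "Suc (Suc i)" i] by (auto simp: downward_def)
qed (use i in auto)

lemma downward_digits_ge:
  assumes "\<And>i. 1 \<le> i \<Longrightarrow> i + 2 \<le> n \<Longrightarrow> d (Suc i) < d i" "i + 2 \<le> n"
  shows "i \<le> d (n - 1 - i)"
  using assms(2)
proof (induction i)
  case (Suc i)
  have "Suc (n - 1 - Suc i) = n - 1 - i" "1 \<le> n - 1 - Suc i" "n - 1 - Suc i + 2 \<le> n"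
    using Suc.prems by auto
  then have "d (n - 1 - i) < d (n - 1 - Suc i)"
    using assms(1)[of "n - 1 - Suc i"] by simp
  then show ?case
    using Suc by linarith
qed simp

lemma downward_base_ge:
  assumes "n \<ge> 3" downward "\<beta> \<in> bases"
  shows "real n - 2 \<le> \<beta>"
proof -
  obtain e d where e: "\<beta> > 1" "\<And>i. 0 < e i" "\<And>i. e i \<le> (1::real)"
    "\<And>i. i \<ge> 1 \<Longrightarrow> \<beta> * e i = real (d i) + 1 - e (Suc i)"
    "\<And>p q. p \<in> {1..n} \<Longrightarrow> q \<in> {1..n} \<Longrightarrow> \<pi> p < \<pi> q \<longleftrightarrow> e p < e q"
    using orbit[OF assms(3)] by blast
  have dec: "d (Suc i) < d i" if "1 \<le> i" "i + 2 \<le> n" for i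
    by (rule downward_digits[OF assms(2) e(1,4,5) that])
  have "n - 2 \<le> d (n - 1 - (n - 2))"
    by (rule downward_digits_ge[of d, OF dec]) (use assms(1) in auto)
  moreover have "n - 1 - (n - 2) = 1"
    using assms(1) by simp
  moreover have "real (d 1) \<le> \<beta>"
    using digit_le_base[OF e(1) e(4)[of 1] e(3) e(3)] by simp
  ultimately show ?thesis
    by simp
qed

text \<open>
  With the digits \<open>n - 2, \<dots>, 1, 0\<close> forced on the first \<open>n - 1\<close> positions, the first orbit point
  lies beyond the value of \<open>(n-2) \<dots> 1 0 0 0 \<dots>\<close>, on the side given by the parity of \<open>n\<close>.
\<close>

lemma special_base_greater:
  assumes n3: "n \<ge> 3" and down: downward and b: "is_stair_base (n - 2) b"
    and last: "if even n then \<pi> n < \<pi> (n - 1) else \<pi> (n - 1) < \<pi> n"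
    and \<beta>: "\<beta> \<in> bases"
  shows "b < \<beta>"
proof -
  obtain e d where e: "\<beta> > 1" "\<And>i. 0 < e i" "\<And>i. e i \<le> (1::real)"
    "\<And>i. i \<ge> 1 \<Longrightarrow> \<beta> * e i = real (d i) + 1 - e (Suc i)"
    "\<And>p q. p \<in> {1..n} \<Longrightarrow> q \<in> {1..n} \<Longrightarrow> \<pi> p < \<pi> q \<longleftrightarrow> e p < e q"
    using orbit[OF \<beta>] by blast
  have dec: "d (Suc i) < d i" if "1 \<le> i" "i + 2 \<le> n" for i
    by (rule downward_digits[OF down e(1,4,5) that])
  have d1: "real (d 1) \<le> \<beta>"
    using digit_le_base[OF e(1) e(4)[of 1] e(3) e(3)] by simp
  show ?thesis
  proof (cases "n - 1 \<le> d 1")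
    case True
    then have "real n - 1 \<le> real (d 1)"
      by linarith
    then show ?thesis
      using d1 b n3 by (simp add: is_stair_base_def)
  next
    case False
    have up: "d (Suc i) + i \<le> d 1" if "i + 2 \<le> n" for i
      using that
    proof (induction i)
      case (Suc i)
      then show ?case
        using dec[of "Suc i"] by simp
    qed simp
    \<comment> \<open>Strictly decreasing naturals in \<open>n - 1\<close> positions, starting at
      most at \<open>n - 2\<close>, leave no choice.\<close>
    have digit: "d (n - 1 - i) = i" if "i + 2 \<le> n" for i
    proof -
      have eq: "n - 1 - i = Suc (n - 2 - i)" "n - 2 - i + 2 \<le> n"
        using that by auto
      then have "d (n - 1 - i) + (n - 2 - i) \<le> d 1"
        using up[of "n - 2 - i"] by simp
      then show ?thesis
        using downward_digits_ge[of d i, OF dec that] False that by simp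
    qed
    let ?u = "\<lambda>i. neg_val \<beta> 0 (stair i)"
    \<comment> \<open>The deviation of the orbit from the staircase values;
      \<open>1 / (\<beta> + 1)\<close> is the value of \<open>0 0 0 ...\<close>.\<close>
    have ediff: "e (n - 1 - i) - ?u i = (- 1 / \<beta>) ^ Suc i * (e n - 1 / (\<beta> + 1))" if "i + 2 \<le> n" for i
      using that
    proof (induction i)
      case 0
      have "\<beta> * e (n - 1) = 1 - e n"
        using e(4)[of "n - 1"] digit[of 0] n3 by simp
      moreover define u where "u = 1 / (\<beta> + 1)"
      then have "\<beta> * u = 1 - u"
        using e(1) by (simp add: field_simps)
      ultimately have "\<beta> * (e (n - 1) - u) = - (e n - u)"
        by (simp add: right_diff_distrib)
      then have "e (n - 1) - u = (- 1 / \<beta>) * (e n - u)"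
        using e(1) by (simp add: field_simps)
      then show ?case
        by (simp add: u_def)
    next
      case (Suc i)
      have "Suc (n - 1 - Suc i) = n - 1 - i" "1 \<le> n - 1 - Suc i"
        using Suc.prems by auto
      then have "\<beta> * e (n - 1 - Suc i) = real (Suc i) + 1 - e (n - 1 - i)"
        using e(4)[of "n - 1 - Suc i"] digit[OF Suc.prems] by simp
      then have "e (n - 1 - Suc i) = (real (Suc i) + 1 - e (n - 1 - i)) / \<beta>"
        using e(1) by (simp add: field_simps)
      then have "e (n - 1 - Suc i) - ?u (Suc i) = (- 1 / \<beta>) * (e (n - 1 - i) - ?u i)"
        by (simp add: diff_divide_distrib)
      then show ?case
        using Suc by simp
    qed
    have n1: "n - 1 - (n - 2) = 1" "Suc (n - 2) = n - 1"
      using n3 by auto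
    have bn: "\<beta> * e (n - 1) = 1 - e n"
      using e(4)[of "n - 1"] digit[of 0] n3 by simp
    \<comment> \<open>As \<open>\<beta> * e (n - 1) = 1 - e n\<close>, the order of the last two
      points tells on which side of \<open>1 / (\<beta> + 1)\<close> the point \<open>e n\<close>
      lies; \<open>last\<close> matches this sign with the parity of the exponent.\<close>
    have "(- 1 / \<beta>) ^ (n - 1) * (e n - 1 / (\<beta> + 1)) > 0"
    proof (cases "even n")
      case True
      then have "e n < e (n - 1)"
        using last e(5)[of n "n - 1"] n3 by simp
      then have "\<beta> * e n < 1 - e n"
        using e(1) bn by (metis less_trans mult_less_cancel_left_pos zero_less_one)
      then have "e n - 1 / (\<beta> + 1) < 0"
        using e(1) by (simp add: field_simps)
      moreover have "odd (n - 1)"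
        using True n3 by simp
      then have "(- 1 / \<beta>) ^ (n - 1) < 0"
        using e(1) by (simp add: power_less_zero_eq)
      ultimately show ?thesis
        by (rule mult_neg_neg[rotated])
    next
      case False
      then have "e (n - 1) < e n"
        using last e(5)[of "n - 1" n] n3 by simp
      then have "1 - e n < \<beta> * e n"
        using e(1) bn by (metis less_trans mult_less_cancel_left_pos zero_less_one)
      then have "e n - 1 / (\<beta> + 1) > 0"
        using e(1) by (simp add: field_simps)
      moreover have "even (n - 1)"
        using False n3 by simp
      then have "(- 1 / \<beta>) ^ (n - 1) > 0"
        using e(1) by (simp add: zero_less_power_eq)
      ultimately show ?thesis
        by simp
    qed
    then have "?u (n - 2) < e 1"
      using ediff[of "n - 2"] n1 n3 by simp
    then have "?u (n - 2) < 1"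
      using e(3)[of 1] by linarith
    moreover have "real (n - 2) \<le> \<beta>"
      using downward_base_ge[OF n3 down \<beta>] n3 by simp
    ultimately show ?thesis
      using b by (simp add: is_stair_base_def)
  qed
qed

lemma downward_seg: "seg (\<lambda>j. n - 1 - j) 1 n = stair (n - 2) @ [0]"
proof (rule nth_equalityI)
  show "length (seg (\<lambda>j. n - 1 - j) 1 n) = length (stair (n - 2) @ [0])"
    using n_ge by simp
  show "seg (\<lambda>j. n - 1 - j) 1 n ! i = (stair (n - 2) @ [0]) ! i"
    if "i < length (seg (\<lambda>j. n - 1 - j) 1 n)" for i
    using that n_ge by (cases "n = 2") (auto simp: seg_nth nth_append stair_def rev_nth)
qed

lemma upward_seg: "seg (\<lambda>j. j - 1) 1 n = [0..<n - 2] @ [n - 2]"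
proof (rule nth_equalityI)
  show "length (seg (\<lambda>j. j - 1) 1 n) = length ([0..<n - 2] @ [n - 2])"
    using n_ge by simp
  show "seg (\<lambda>j. j - 1) 1 n ! i = ([0..<n - 2] @ [n - 2]) ! i"
    if "i < length (seg (\<lambda>j. j - 1) 1 n)" for i
    using that n_ge by (cases "n = 2") (auto simp: seg_nth nth_append)
qed

text \<open>Letters decreasing to 0 at position \<open>n - 1\<close> are compatible with the order.
  The continuation starts with 0, hence below all letters except that at \<open>n - 1\<close>; the
  comparison with that tail depends on the parity of \<open>q\<close>.\<close>

lemma downward_pattern:
  assumes n3: "n \<ge> 3" and down: downward and q: "q \<ge> 1" "odd q \<longleftrightarrow> \<pi> n < \<pi> (n - 1)"
  shows "is_shift_pat (stair (n - 2) @- replicate (Suc q) 0 @- 1 ## s) n \<pi>"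
proof -
  let ?y = "\<lambda>j. n - 1 - j" and ?t = "replicate q 0 @- 1 ## s"
  have less: "\<pi> j < \<pi> i" if "1 \<le> i" "i < j" "j < n" for i j
    using down that unfolding downward_def by auto
  have less_n: "\<pi> n < \<pi> i" if "1 \<le> i" "i + 2 \<le> n" for i
    using down that unfolding downward_def by auto
  have y: "compat ?y"
    unfolding compat_def
  proof (intro ballI impI)
    fix i j assume ij: "i \<in> {1..<n}" "j \<in> {1..<n}" "\<pi> i < \<pi> j"
    then have "j < i"
      using less[of i j] by (metis atLeastLessThan_iff less_asym less_irrefl linorder_neqE_nat)
    then show "?y i \<le> ?y j \<and> (?y i = ?y j \<longrightarrow> \<pi> (Suc j) < \<pi> (Suc i))"
      using ij by auto
  qed
  have last: "seg ?y (n - 1) n = [0]"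
    using n3 seg_Cons[of "n - 1" n ?y] by simp
  obtain q' where q': "q = Suc q'"
    using q(1) by (cases q) auto
  have "is_shift_pat (seg ?y 1 n @- ?t) n \<pi>"
  proof (rule is_shift_pat_seg[OF y])
    fix p assume p: "p \<in> {1..<n}" "Suc (\<pi> p) = \<pi> n"
    then have "p = n - 1"
      using less_n[of p] by fastforce
    then show "alt_less (seg ?y p n @- ?t) ?t"
      using q(2) p last alt_less_SCons_zero(2)[of q s] by auto
  next
    fix p assume p: "p \<in> {1..<n}" "\<pi> p = Suc (\<pi> n)"
    show "alt_less ?t (seg ?y p n @- ?t)"
    proof (cases "p = n - 1")
      case True
      then show ?thesis
        using q(2) p last alt_less_SCons_zero(1)[of q s] by auto
    next
      case False
      then have "0 < n - 1 - p"
        using p by auto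
      then show ?thesis
        using p q' seg_Cons[of p n ?y] by (auto simp: alt_less_SCons)
    qed
  qed
  then show ?thesis
    unfolding downward_seg by simp
qed

text \<open>The continuation repeats the top letter \<open>n - 2\<close> and then drops to
  \<open>n - 3\<close>. It first differs from the tail at \<open>n - 1\<close> at this drop, so one
  or two repetitions put it above or below.\<close>

lemma upward_pattern:
  assumes n3: "n \<ge> 3" and up: upward
  shows "is_shift_pat ([0..<n - 2] @- [n - 2] @- (if \<pi> n < \<pi> (n - 1) then [n - 2, n - 2, n - 3] else [n - 2, n - 3]) @- s) n \<pi>"
proof -
  let ?y = "\<lambda>j. j - 1 :: nat"
  define t where "t = (if \<pi> n < \<pi> (n - 1) then [n - 2, n - 2, n - 3] else [n - 2, n - 3]) @- s"
  have less: "\<pi> i < \<pi> j" if "1 \<le> i" "i < j" "j < n" for i j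
    using up that unfolding upward_def by auto
  have less_n: "\<pi> i < \<pi> n" if "1 \<le> i" "i + 2 \<le> n" for i
    using up that unfolding upward_def by auto
  have y: "compat ?y"
    unfolding compat_def
  proof (intro ballI impI)
    fix i j assume ij: "i \<in> {1..<n}" "j \<in> {1..<n}" "\<pi> i < \<pi> j"
    then have "i < j"
      using less[of j i] by (metis atLeastLessThan_iff less_asym less_irrefl linorder_neqE_nat)
    then show "?y i \<le> ?y j \<and> (?y i = ?y j \<longrightarrow> \<pi> (Suc j) < \<pi> (Suc i))"
      using ij by auto
  qed
  have last: "seg ?y (n - 1) n = [n - 2]"
    using n3 seg_Cons[of "n - 1" n ?y] by simp
  have lt: "n - 3 < n - 2"
    using n3 by simp
  have "is_shift_pat (seg ?y 1 n @- t) n \<pi>"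
  proof (rule is_shift_pat_seg[OF y])
    fix p assume p: "p \<in> {1..<n}" "Suc (\<pi> p) = \<pi> n"
    show "alt_less (seg ?y p n @- t) t"
    proof (cases "p = n - 1")
      case True
      then show ?thesis
        using p last lt by (auto simp: t_def alt_less_SCons)
    next
      case False
      then have "p - 1 < n - 2"
        using p by auto
      then show ?thesis
        using p seg_Cons[of p n ?y] by (auto simp: t_def alt_less_SCons)
    qed
  next
    fix p assume p: "p \<in> {1..<n}" "\<pi> p = Suc (\<pi> n)"
    then have "p = n - 1"
      using less_n[of p] by fastforce
    then show "alt_less t (seg ?y p n @- t)"
      using p last lt by (auto simp: t_def alt_less_SCons)
  qed
  then show ?thesis
    unfolding upward_seg t_def by simp
qed

text \<open>The word \<open>[n - 2, n - 3, 0]\<close> followed by ones is admissible in base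
  \<open>b\<close>, and so are repetitions of its first digit. The digits before are at most
  \<open>n - 3\<close>, and \<open>n - 2 < b\<close>.\<close>

lemma upward_B_less:
  assumes n3: "n \<ge> 3" and up: upward and b: "is_stair_base (n - 2) b"
  shows "B_minus n \<pi> < b"
proof -
  have b1: "b > 1" "real (n - 2) < b"
    using b n3 by (auto simp: is_stair_base_def)
  have k: "n - 2 \<ge> 1"
    using n3 by simp
  define v where "v = (if \<pi> n < \<pi> (n - 1) then [n - 2, n - 2, n - 3] else [n - 2, n - 3])"
  have start: "admissible b 1 [n - 2, n - 3, 0]"
    using admissible_top_start[OF b k] by (simp add: numeral_3_eq_3 numeral_2_eq_2)
  have "admissible b 1 ((n - 2) # v @ [0])"
    using admissible_repeat_top[OF b k start] admissible_repeat_top[OF b k admissible_repeat_top[OF b k start]]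
    by (simp add: v_def)
  then have "admissible b 1 ([0..<n - 2] @ (n - 2) # v @ [0])"
    using b1 by (intro admissible_small_digits) auto
  moreover have "is_shift_pat (([0..<n - 2] @ (n - 2) # v @ [0]) @- cycle [1]) n \<pi>"
    using upward_pattern[OF n3 up, of "0 ## cycle [1]"] by (simp add: v_def)
  ultimately show ?thesis
    using B_minus_less[OF b1(1)] by blast
qed

lemma downward_B_less:
  assumes n3: "n \<ge> 3" and down: downward and b: "is_stair_base (n - 2) b"
    and last: "even n \<longleftrightarrow> \<pi> (n - 1) < \<pi> n"
  shows "B_minus n \<pi> < b"
proof -
  have b1: "b > 1"
    using b n3 by (auto simp: is_stair_base_def)
  have "\<pi> (n - 1) \<noteq> \<pi> n"
    using pi_inj[of "n - 1" n] n3 by auto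
  then have q: "even n \<longleftrightarrow> \<not> \<pi> n < \<pi> (n - 1)"
    using last by auto
  \<comment> \<open>The parity that the pattern prescribes is the one that makes the perturbed
    staircase admissible in base \<open>b\<close>; for the other order of the last two positions the
    two requirements conflict.\<close>
  define q where "q = (if even n then 2 else 1 :: nat)"
  have "is_shift_pat (stair (n - 2) @- replicate (Suc q) 0 @- 1 ## cycle [1]) n \<pi>"
    using q by (intro downward_pattern[OF n3 down]) (auto simp: q_def)
  moreover have "1 ## cycle [1] = cycle [1::nat]"
    using cycle_unfold[of "[1::nat]"] by simp
  ultimately have "is_shift_pat ((stair (n - 2) @ replicate (Suc q) 0) @- cycle [1]) n \<pi>"
    by simp
  moreover have "admissible b 1 (stair (n - 2) @ replicate (Suc q) 0)"
    using n3 by (intro admissible_stair_zeros[OF b]) (auto simp: q_def)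
  ultimately show ?thesis
    using B_minus_less[OF b1] by blast
qed

text \<open>Every base above \<open>b\<close> is reached by placing a digit 1 far behind the
  staircase, with the parity that the pattern demands. All allowed bases are strictly greater than
  \<open>b\<close>, so the infimum is not attained.\<close>

lemma special_B_eq:
  assumes n3: "n \<ge> 3" and down: downward and b: "is_stair_base (n - 2) b"
    and last: "even n \<longleftrightarrow> \<pi> n < \<pi> (n - 1)"
  shows "B_minus n \<pi> = b"
proof (rule antisym)
  have b1: "b > 1"
    using b n3 by (auto simp: is_stair_base_def)
  have ne: "\<pi> (n - 1) \<noteq> \<pi> n"
    using pi_inj[of "n - 1" n] n3 by auto
  have k: "n - 2 \<ge> 1"
    using n3 by simp
  show "B_minus n \<pi> \<le> b"
  proof (rule dense_ge)
    fix \<beta> assume \<beta>: "b < \<beta>"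
    obtain i where i: "\<And>q. q \<ge> i \<Longrightarrow> admissible \<beta> 0 (stair (n - 2) @ replicate q 0 @ [1])"
      using admissible_stair_perturbed[OF b k \<beta>] by blast
    define q where "q = (if even n then 2 * i + 1 else 2 * i + 2)"
    have "is_shift_pat (stair (n - 2) @- replicate (Suc q) 0 @- 1 ## cycle [0]) n \<pi>"
      using last by (intro downward_pattern[OF n3 down]) (auto simp: q_def)
    then have pat: "is_shift_pat ((stair (n - 2) @ replicate (Suc q) 0 @ [1]) @- cycle [0]) n \<pi>"
      by simp
    have "admissible \<beta> 0 (stair (n - 2) @ replicate (Suc q) 0 @ [1])"
      by (rule i) (simp add: q_def)
    then show "B_minus n \<pi> \<le> \<beta>"
      using B_minus_le[OF _ pat] b1 \<beta> by simp
  qed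
  show "b \<le> B_minus n \<pi>"
    unfolding B_minus_def
  proof (rule cInf_greatest[OF B_minus_less_N(1)])
    fix \<beta> assume "\<beta> \<in> bases"
    then show "b \<le> \<beta>"
      using special_base_greater[OF n3 down b] last ne by (intro less_imp_le) auto
  qed
qed

lemma monotone_N_ge:
  assumes "n \<ge> 3" "upward \<or> downward"
  shows "n - 1 \<le> N_minus n \<pi>"
proof -
  have "real n - 2 \<le> B_minus n \<pi>"
    unfolding B_minus_def
    using upward_base_ge[OF assms(1)] downward_base_ge[OF assms(1)] assms(2)
    by (intro cInf_greatest[OF B_minus_less_N(1)]) blast
  then have "int n - 2 \<le> \<lfloor>B_minus n \<pi>\<rfloor>"
    by (simp add: le_floor_iff)
  then show ?thesis
    using N_minus_floor by linarith
qed

text \<open>For \<open>n = 3\<close> a bound \<open>N \<le> n - 2\<close> is impossible, as at least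
  two letters occur. The remaining permutations 213 and 231 are realized by
  \<open>0 0 1 1 1 ...\<close> and \<open>1 1 0 0 1 1 1 ...\<close>.\<close>

lemma length_3_middle_B_less:
  assumes n3: "n = 3" and b: "is_stair_base 1 b" and "\<not> upward" "\<not> downward"
  shows "B_minus n \<pi> < b"
proof -
  have b1: "b > 1"
    using b by (auto simp: is_stair_base_def)
  have "\<pi> 1 \<noteq> \<pi> 2" "\<pi> 1 \<noteq> \<pi> 3" "\<pi> 2 \<noteq> \<pi> 3"
    using pi_inj by simp_all
  have 1: "p = 1 \<and> (q = 2 \<or> q = 3)" if "1 \<le> p" "p + 2 \<le> n" "p < q" "q \<le> n" for p q
    using that n3 by auto
  have nu: "\<not> (\<pi> 1 < \<pi> 2 \<and> \<pi> 1 < \<pi> 3)"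
    using assms(3) 1 unfolding upward_def by blast
  have nd: "\<not> (\<pi> 2 < \<pi> 1 \<and> \<pi> 3 < \<pi> 1)"
    using assms(4) 1 unfolding downward_def by blast
  have cases: "p = 1 \<or> p = 2" if "p \<in> {1..<n}" for p
    using that n3 by auto
  have seg3: "seg y 1 3 = [y 1, y 2]" "seg y 2 3 = [y 2]" for y :: "nat \<Rightarrow> nat"
    by (simp_all add: seg_def upt_rec numeral_2_eq_2 numeral_3_eq_3)
  have c1: "cycle [1::nat] = 1 ## cycle [1]"
    using cycle_unfold[of "[1::nat]"] by simp
  consider "\<pi> 2 < \<pi> 1" "\<pi> 1 < \<pi> 3" "\<pi> 2 < \<pi> 3" | "\<pi> 3 < \<pi> 1" "\<pi> 1 < \<pi> 2" "\<pi> 3 < \<pi> 2"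
    using nu nd \<open>\<pi> 1 \<noteq> \<pi> 2\<close> \<open>\<pi> 1 \<noteq> \<pi> 3\<close> by linarith
  then show ?thesis
  proof cases
    case 1
    have y: "compat (\<lambda>_. 0)"
      unfolding compat_def
    proof (intro ballI impI)
      fix p q assume "p \<in> {1..<n}" "q \<in> {1..<n}" "\<pi> p < \<pi> q"
      then have "p = 2" "q = 1"
        using cases[of p] cases[of q] 1 by auto
      then show "(0::nat) \<le> 0 \<and> ((0::nat) = 0 \<longrightarrow> \<pi> (Suc q) < \<pi> (Suc p))"
        using 1 by (simp add: numeral_2_eq_2 numeral_3_eq_3)
    qed
    have "is_shift_pat (seg (\<lambda>_. 0) 1 n @- cycle [1]) n \<pi>"
    proof (rule is_shift_pat_seg[OF y])
      show "alt_less (seg (\<lambda>_. 0) p n @- cycle [1]) (cycle [1])" if "p \<in> {1..<n}" for p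
        using that seg_Cons[of p n "\<lambda>_. 0"] by (subst (2) c1) (simp add: alt_less_SCons)
      show "alt_less (cycle [1]) (seg (\<lambda>_. 0) p n @- cycle [1])" if "p \<in> {1..<n}" "\<pi> p = Suc (\<pi> n)" for p
        using cases[OF that(1)] that(2) 1 n3 by auto
    qed
    then have "is_shift_pat ([0, 0] @- cycle [1]) n \<pi>"
      by (simp add: n3 seg3 del: One_nat_def)
    moreover have "admissible b 1 [0, 0]"
      using b1 admissible_append_zeros[of b 1 "[]" 2] by (simp add: numeral_2_eq_2)
    ultimately show ?thesis
      by (rule B_minus_less[OF b1])
  next
    case 2
    let ?t = "[0, 0] @- cycle [1::nat]"
    have y: "compat (\<lambda>_. 1)"
      unfolding compat_def
    proof (intro ballI impI)
      fix p q assume "p \<in> {1..<n}" "q \<in> {1..<n}" "\<pi> p < \<pi> q"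
      then have "p = 1" "q = 2"
        using cases[of p] cases[of q] 2 by auto
      then show "(1::nat) \<le> 1 \<and> ((1::nat) = 1 \<longrightarrow> \<pi> (Suc q) < \<pi> (Suc p))"
        using 2 by (simp add: numeral_2_eq_2 numeral_3_eq_3)
    qed
    have "is_shift_pat (seg (\<lambda>_. 1) 1 n @- ?t) n \<pi>"
    proof (rule is_shift_pat_seg[OF y])
      show "alt_less ?t (seg (\<lambda>_. 1) p n @- ?t)" if "p \<in> {1..<n}" for p
        using that seg_Cons[of p n "\<lambda>_. 1"] by (simp add: alt_less_SCons)
      show "alt_less (seg (\<lambda>_. 1) p n @- ?t) ?t" if "p \<in> {1..<n}" "Suc (\<pi> p) = \<pi> n" for p
        using cases[OF that(1)] that(2) 2 n3 by auto
    qed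
    then have "is_shift_pat ([1, 1, 0, 0] @- cycle [1]) n \<pi>"
      by (simp add: n3 seg3 del: One_nat_def)
    moreover have "stair 1 @ replicate 2 0 = [1, 0, 0]"
      by (simp add: numeral_2_eq_2)
    then have "admissible b 1 [1, 0, 0]"
      using admissible_stair_zeros[OF b le_refl, of 2] by (metis odd_numeral one_plus_numeral semiring_norm(3))
    then have "admissible b 1 [1, 1, 0, 0]"
      by (rule admissible_repeat_top[OF b le_refl])
    ultimately show ?thesis
      by (rule B_minus_less[OF b1])
  qed
qed

end

section \<open>Permutations needing n - 1 letters\<close>

lemma chain_nat:
  assumes "transp R" "\<And>i. a \<le> i \<Longrightarrow> i < b \<Longrightarrow> R (f i) (f (Suc i))" "a \<le> p" "p < q" "q \<le> (b::nat)"
  shows "R (f p) (f q)"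
  using assms(4,5)
proof (induction q)
  case (Suc q)
  then show ?case
    using assms(2)[of p] assms(2)[of q] assms(3) transpD[OF assms(1), of "f p" "f q" "f (Suc q)"]
    by (cases "p = q") auto
qed simp

context perm_pattern
begin

text \<open>Without equal letters between the ranks of \<open>p\<close> and \<open>q\<close>,
  \<open>z\<close> jumps at every step, so the successors increase at every step.\<close>

lemma inc_order:
  assumes p: "p \<in> {1..<n}" and q: "q \<in> {1..<n}" "\<pi> p < \<pi> q"
    and inj: "\<And>i j. i \<in> {1..<n} \<Longrightarrow> j \<in> {1..<n} \<Longrightarrow> \<pi> p \<le> \<pi> i \<Longrightarrow> \<pi> i < \<pi> j \<Longrightarrow> \<pi> j \<le> \<pi> q \<Longrightarrow> z i \<noteq> z j"
  shows "\<pi> (Suc p) < \<pi> (Suc q)"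
  using q inj
proof (induction "\<pi> q" arbitrary: q rule: less_induct)
  case less
  obtain q' where q': "q' \<in> {1..<n}" "\<pi> p \<le> \<pi> q'" "\<pi> q' < \<pi> q"
    "z q = z q' + (if \<pi> (Suc q') < \<pi> (Suc q) then 1 else 0)"
    using z_step p less.prems(1,2) by metis
  have "z q' \<noteq> z q"
    by (rule less.prems(3)) (use q' less.prems(1) in auto)
  then have lt: "\<pi> (Suc q') < \<pi> (Suc q)"
    using q'(4) by (auto split: if_splits)
  show ?case
  proof (cases "p = q'")
    case False
    then have "\<pi> p < \<pi> q'"
      using q'(2) pi_inj[of p q'] by simp
    then have "\<pi> (Suc p) < \<pi> (Suc q')"
      using q'(3) by (intro less.hyps[OF q'(3) q'(1)] less.prems(3)) auto
    then show ?thesis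
      using lt by simp
  qed (use lt in simp)
qed

lemma upwardI:
  assumes "\<And>p. 1 \<le> p \<Longrightarrow> p + 2 < n \<Longrightarrow> \<pi> p < \<pi> (Suc p)" "\<And>p. 1 \<le> p \<Longrightarrow> p + 2 \<le> n \<Longrightarrow> \<pi> p < \<pi> (n - 1) \<and> \<pi> p < \<pi> n"
  shows upward
  unfolding upward_def
proof (intro allI impI)
  fix p q assume pq: "1 \<le> p" "p + 2 \<le> n" "p < q" "q \<le> n"
  have chain: "\<pi> p < \<pi> q" if "q + 2 \<le> n"
    using chain_nat[of "(<)" 1 "n - 2" \<pi> p q] assms(1) pq(1,3) that by (auto intro: transp_on_less transp_on_greater)
  have "q = n - 1 \<or> q = n \<or> q + 2 \<le> n"
    using pq by linarith
  then show "\<pi> p < \<pi> q"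
    using chain assms(2)[OF pq(1,2)] by auto
qed

lemma downwardI:
  assumes "\<And>p. 1 \<le> p \<Longrightarrow> p + 2 < n \<Longrightarrow> \<pi> (Suc p) < \<pi> p" "\<And>p. 1 \<le> p \<Longrightarrow> p + 2 \<le> n \<Longrightarrow> \<pi> (n - 1) < \<pi> p \<and> \<pi> n < \<pi> p"
  shows downward
  unfolding downward_def
proof (intro allI impI)
  fix p q assume pq: "1 \<le> p" "p + 2 \<le> n" "p < q" "q \<le> n"
  have chain: "\<pi> q < \<pi> p" if "q + 2 \<le> n"
    using chain_nat[of "(>)" 1 "n - 2" \<pi> p q] assms(1) pq(1,3) that by (auto intro: transp_on_less transp_on_greater)
  have "q = n - 1 \<or> q = n \<or> q + 2 \<le> n"
    using pq by linarith
  then show "\<pi> q < \<pi> p"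
    using chain assms(2)[OF pq(1,2)] by auto
qed

text \<open>Then \<open>z\<close> is injective, and passing to successors preserves the order; the
  comparison of the first two positions propagates to all later ones.\<close>

lemma c_max_imp_monotone:
  assumes "c = n - 2"
  shows "upward \<or> downward"
proof -
  have "card (z ` {1..<n}) = card {1..<n}"
    using assms n_ge unfolding z_surj by simp
  then have inj: "inj_on z {1..<n}"
    by (intro eq_card_imp_inj_on) auto
  have step: "\<pi> (Suc p) < \<pi> (Suc q)" if "p \<in> {1..<n}" "q \<in> {1..<n}" "\<pi> p < \<pi> q" for p q
    using inj by (intro inc_order[OF that]) (auto dest: inj_onD)
  have "\<pi> 1 \<noteq> \<pi> 2"
    using pi_inj by simp
  then consider "\<pi> 1 < \<pi> 2" | "\<pi> 2 < \<pi> 1"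
    by linarith
  then show ?thesis
  proof cases
    case 1
    have "\<pi> (Suc i) < \<pi> (Suc (Suc i))" if "Suc (Suc i) \<le> n" for i
      using that
    proof (induction i)
      case (Suc i)
      then show ?case
        using step[of "Suc i" "Suc (Suc i)"] by simp
    qed (use 1 in \<open>simp add: numeral_2_eq_2\<close>)
    then have suc: "\<pi> p < \<pi> (Suc p)" if "1 \<le> p" "p < n" for p
      using that by (cases p) auto
    have "upward"
      unfolding upward_def using chain_nat[of "(<)" 1 n \<pi>] suc by (auto intro: transp_on_less transp_on_greater)
    then show ?thesis ..
  next
    case 2
    have "\<pi> (Suc (Suc i)) < \<pi> (Suc i)" if "Suc (Suc i) \<le> n" for i
      using that
    proof (induction i)
      case (Suc i)
      then show ?case
        using step[of "Suc (Suc i)" "Suc i"] by simp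
    qed (use 2 in \<open>simp add: numeral_2_eq_2\<close>)
    then have suc: "\<pi> (Suc p) < \<pi> p" if "1 \<le> p" "p < n" for p
      using that by (cases p) auto
    have "downward"
      unfolding downward_def using chain_nat[of "(>)" 1 n \<pi>] suc by (auto intro: transp_on_less transp_on_greater)
    then show ?thesis ..
  qed
qed

text \<open>The \<open>n - 1\<close> positions carry all \<open>n - 2\<close> values from 0 to
  \<open>c\<close>, so removing either member of a pair with equal letters leaves an injective
  word.\<close>

lemma unique_coincidence:
  assumes "n \<ge> 3" "c = n - 3"
    and p: "p \<in> {1..<n}" "p' \<in> {1..<n}" "p \<noteq> p'" "z p = z p'"
    and q: "q \<in> {1..<n}" "q' \<in> {1..<n}" "q \<noteq> q'" "z q = z q'"
  shows "{p, p'} = {q, q'}"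
proof -
  have inj: "inj_on z ({1..<n} - {a})"
    if "a \<in> {1..<n}" "b \<in> {1..<n}" "a \<noteq> b" "z a = z b" for a b
  proof (rule eq_card_imp_inj_on)
    have "z a \<in> z ` ({1..<n} - {a})"
      using that by auto
    then have "z ` {1..<n} \<subseteq> z ` ({1..<n} - {a})"
      by auto
    then have "z ` ({1..<n} - {a}) = z ` {1..<n}"
      by blast
    then show "card (z ` ({1..<n} - {a})) = card ({1..<n} - {a})"
      unfolding z_surj using that(1) assms(1,2) by simp
  qed simp
  have "p \<in> {q, q'}"
    using inj[OF p] q unfolding inj_on_def by blast
  moreover have "p' \<in> {q, q'}"
    using inj[OF p(2,1)] p(3,4) q unfolding inj_on_def by (metis Diff_iff insert_iff singletonD)
  ultimately show ?thesis
    using p(3) by auto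
qed

text \<open>A square of a word of length \<open>s\<close> contains \<open>s\<close> pairs of equal
  letters, and only one pair is available.\<close>

lemma square_seg:
  assumes "n \<ge> 3" "c = n - 3" "1 \<le> i" "1 \<le> j" "i < n" "j < n" "seg z i n = seg z j n @ seg z j n"
  shows "Suc j = n \<and> i + 2 = n \<and> z i = z j"
proof -
  have "length (seg z i n) = length (seg z j n @ seg z j n)"
    using assms(7) by simp
  then have len: "n - i = (n - j) + (n - j)"
    by simp
  define s where "s = n - j"
  have s: "n = i + 2 * s" "j = i + s" "s \<ge> 1"
    using len assms(3-6) by (auto simp: s_def)
  have eq: "z (i + k) = z (j + k)" if "k < s" for k
  proof -
    have "seg z i n ! k = (seg z j n @ seg z j n) ! k"
      by (simp add: assms(7))
    then show ?thesis
      using that s seg_nth[of i k n z] seg_nth[of j k n z] by (simp add: nth_append)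
  qed
  have "s = 1"
  proof (rule ccontr)
    assume "s \<noteq> 1"
    then have "{i, j} = {Suc i, Suc j}"
      using s assms(3) eq[of 0] eq[of 1] by (intro unique_coincidence[OF assms(1,2)]) auto
    then show False
      using s by (auto simp: doubleton_eq_iff)
  qed
  then show ?thesis
    using s eq[of 0] by simp
qed

text \<open>The only equal letters are at \<open>n - 2\<close> and \<open>n - 1\<close>, the rank
  neighbours of \<open>n\<close>. Passing to successors hence preserves the order of any two
  positions before \<open>n\<close> not separated by the rank of \<open>n\<close>, and the order can
  be traced backwards.\<close>

lemma collapsed_imp_monotone:
  assumes n4: "n \<ge> 4" and c: "c = n - 3" and "collapsed n \<pi>"
  shows "upward \<or> downward"
proof -
  have n1: "\<pi> n \<noteq> 1" "\<pi> n \<noteq> n"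
    using assms(3) by (auto simp: collapsed_def)
  note l = l_props[OF n1(1)] and r = r_props[OF n1(2)]
  have n3: "n \<ge> 3"
    using n4 by simp
  have nj: "\<pi> j \<noteq> \<pi> n" if "j < n" for j
    using that pi_inj[of j n] by simp
  have order: "\<pi> (Suc p) < \<pi> (Suc q)"
    if "{l, r} = {n - 2, n - 1}" "z l = z r" "p \<in> {1..<n}" "q \<in> {1..<n}" "\<pi> p < \<pi> q" "\<not> (\<pi> p < \<pi> n \<and> \<pi> n < \<pi> q)" for p q
  proof (rule inc_order[OF that(3,4,5)])
    fix i j assume ij: "i \<in> {1..<n}" "j \<in> {1..<n}" "\<pi> p \<le> \<pi> i" "\<pi> i < \<pi> j" "\<pi> j \<le> \<pi> q"
    show "z i \<noteq> z j"
    proof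
      assume "z i = z j"
      then have "{i, j} = {l, r}"
        using ij l r that(2) by (intro unique_coincidence[OF n3 c]) auto
      then have "i = l" "j = r"
        using ij(4) l r by (auto simp: doubleton_eq_iff)
      then show False
        using ij that(6) l(3) r(3) by auto
    qed
  qed
  consider "seg z l n = seg z r n @ seg z r n" | "seg z r n = seg z l n @ seg z l n"
    using assms(3) by (auto simp: collapsed_def Let_def)
  then show ?thesis
  proof cases
    case 1
    then have s: "Suc r = n" "l + 2 = n" "z l = z r"
      using square_seg[OF n3 c _ _ _ _ 1] l r by auto
    have lr: "{l, r} = {n - 2, n - 1}" "r = n - 1" "l = n - 2"
      using s by auto
    \<comment> \<open>Going backwards, an offending \<open>j\<close> would be above
      \<open>r = n - 1\<close> in rank; then \<open>\<pi> n < \<pi> (Suc j)\<close>, against the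
      previous step.\<close>
    have below: "\<pi> p < \<pi> n" if "1 \<le> p" "p + 2 \<le> n" for p
    proof -
      have claim: "\<pi> (n - 2 - i) < \<pi> n" if "i + 3 \<le> n" for i
        using that
      proof (induction i)
        case 0
        then show ?case
          using l lr by simp
      next
        case (Suc i)
        define j where "j = n - 2 - Suc i"
        have j: "Suc j = n - 2 - i" "1 \<le> j" "j + 2 < n"
          using Suc.prems by (auto simp: j_def)
        show ?case
        proof (rule ccontr)
          assume "\<not> ?case"
          then have "\<pi> n < \<pi> j"
            using nj[of j] j unfolding j_def[symmetric] by simp
          moreover have "\<pi> r \<noteq> \<pi> j"
            unfolding pi_inj using lr(2) j(3) by linarith
          ultimately have "\<pi> r < \<pi> j"
            using r(2) by linarith
          moreover have "j \<in> {1..<n}" "\<not> (\<pi> r < \<pi> n \<and> \<pi> n < \<pi> j)"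
            using j r(3) by auto
          ultimately have "\<pi> (Suc r) < \<pi> (Suc j)"
            by (intro order[OF lr(1) s(3) r(1)])
          moreover have "\<pi> (Suc j) < \<pi> n"
            unfolding j(1) using Suc by simp
          ultimately show False
            unfolding s(1) by simp
        qed
      qed
      have "n - 2 - (n - 2 - p) = p" "n - 2 - p + 3 \<le> n"
        using that by auto
      then show ?thesis
        using claim[of "n - 2 - p"] by (simp only:)
    qed
    \<comment> \<open>Position \<open>n - 3\<close> lies below \<open>l = n - 2\<close>, whose rank
      is the next one below \<open>n\<close>. A reversed order further back would be carried forward
      to a pair already settled.\<close>
    have upto: "\<pi> (n - 3 - i) < \<pi> (n - 2 - i)" if "i + 4 \<le> n" for i
      using that
    proof (induction i)
      case 0
      have "\<pi> (n - 3) < \<pi> n" "\<pi> (n - 3) \<noteq> \<pi> l"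
        using below[of "n - 3"] 0 pi_inj[of "n - 3" l] lr by auto
      then have "\<pi> (n - 3) < \<pi> l"
        using l(2) by arith
      then show ?case
        using lr by simp
    next
      case (Suc i)
      define j where "j = n - 3 - Suc i"
      have j: "Suc j = n - 3 - i" "Suc j = n - 2 - Suc i" "Suc (Suc j) = n - 2 - i" "1 \<le> j" "j + 3 < n"
        using Suc.prems by (auto simp: j_def)
      have IH: "\<pi> (Suc j) < \<pi> (Suc (Suc j))"
        using Suc j by simp
      have "\<pi> j < \<pi> (Suc j)"
      proof (rule ccontr)
        assume "\<not> ?thesis"
        then have "\<pi> (Suc j) < \<pi> j"
          using pi_inj[of j "Suc j"] by simp
        then have "\<pi> (Suc (Suc j)) < \<pi> (Suc j)"
          using below[of j] j by (intro order[OF lr(1) s(3)]) auto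
        then show False
          using IH by simp
      qed
      then show ?case
        using j j_def by simp
    qed
    have "upward"
    proof (rule upwardI)
      show "\<pi> p < \<pi> (Suc p)" if "1 \<le> p" "p + 2 < n" for p
      proof -
        have "n - 3 - (n - 3 - p) = p" "n - 2 - (n - 3 - p) = Suc p" "n - 3 - p + 4 \<le> n"
          using that by auto
        then show ?thesis
          using upto[of "n - 3 - p"] by simp
      qed
      show "\<pi> p < \<pi> (n - 1) \<and> \<pi> p < \<pi> n" if "1 \<le> p" "p + 2 \<le> n" for p
        using below[OF that] r lr by simp
    qed
    then show ?thesis ..
  next
    case 2
    then have s: "Suc l = n" "r + 2 = n" "z l = z r"
      using square_seg[OF n3 c _ _ _ _ 2] l r by auto
    have lr: "{l, r} = {n - 2, n - 1}" "l = n - 1" "r = n - 2"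
      using s by auto
    have above: "\<pi> n < \<pi> p" if "1 \<le> p" "p + 2 \<le> n" for p
    proof -
      have claim: "\<pi> n < \<pi> (n - 2 - i)" if "i + 3 \<le> n" for i
        using that
      proof (induction i)
        case 0
        then show ?case
          using r lr by simp
      next
        case (Suc i)
        define j where "j = n - 2 - Suc i"
        have j: "Suc j = n - 2 - i" "1 \<le> j" "j + 2 < n"
          using Suc.prems by (auto simp: j_def)
        show ?case
        proof (rule ccontr)
          assume "\<not> ?case"
          then have "\<pi> j < \<pi> n"
            using nj[of j] j unfolding j_def[symmetric] by simp
          moreover have "\<pi> l \<noteq> \<pi> j"
            unfolding pi_inj using lr(2) j(3) by linarith
          ultimately have "\<pi> j < \<pi> l"
            using l(2) by linarith
          moreover have "j \<in> {1..<n}" "\<not> (\<pi> j < \<pi> n \<and> \<pi> n < \<pi> l)"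
            using j l(3) by auto
          ultimately have "\<pi> (Suc j) < \<pi> (Suc l)"
            by (intro order[OF lr(1) s(3) _ l(1)])
          moreover have "\<pi> n < \<pi> (Suc j)"
            unfolding j(1) using Suc by simp
          ultimately show False
            unfolding s(1) by simp
        qed
      qed
      have "n - 2 - (n - 2 - p) = p" "n - 2 - p + 3 \<le> n"
        using that by auto
      then show ?thesis
        using claim[of "n - 2 - p"] by (simp only:)
    qed
    have downto: "\<pi> (n - 2 - i) < \<pi> (n - 3 - i)" if "i + 4 \<le> n" for i
      using that
    proof (induction i)
      case 0
      have "\<pi> n < \<pi> (n - 3)" "\<pi> (n - 3) \<noteq> \<pi> r"
        using above[of "n - 3"] 0 pi_inj[of "n - 3" r] lr by auto
      then have "\<pi> r < \<pi> (n - 3)"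
        using r(2) by arith
      then show ?case
        using lr by simp
    next
      case (Suc i)
      define j where "j = n - 3 - Suc i"
      have j: "Suc j = n - 3 - i" "Suc j = n - 2 - Suc i" "Suc (Suc j) = n - 2 - i" "1 \<le> j" "j + 3 < n"
        using Suc.prems by (auto simp: j_def)
      have IH: "\<pi> (Suc (Suc j)) < \<pi> (Suc j)"
        using Suc j by simp
      have "\<pi> (Suc j) < \<pi> j"
      proof (rule ccontr)
        assume "\<not> ?thesis"
        then have "\<pi> j < \<pi> (Suc j)"
          using pi_inj[of j "Suc j"] by simp
        then have "\<pi> (Suc j) < \<pi> (Suc (Suc j))"
          using above[of j] j by (intro order[OF lr(1) s(3)]) auto
        then show False
          using IH by simp
      qed
      then show ?case
        using j j_def by simp
    qed
    have "downward"
    proof (rule downwardI)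
      show "\<pi> (Suc p) < \<pi> p" if "1 \<le> p" "p + 2 < n" for p
      proof -
        have "n - 3 - (n - 3 - p) = p" "n - 2 - (n - 3 - p) = Suc p" "n - 3 - p + 4 \<le> n"
          using that by auto
        then show ?thesis
          using downto[of "n - 3 - p"] by simp
      qed
      show "\<pi> (n - 1) < \<pi> p \<and> \<pi> n < \<pi> p" if "1 \<le> p" "p + 2 \<le> n" for p
        using above[OF that] l lr by simp
    qed
    then show ?thesis ..
  qed
qed

text \<open>Four alternating letters would already contain two pairs of equal letters.\<close>

lemma alternating_cycle_short:
  assumes n4: "n \<ge> 4" and c: "c = n - 3" and p: "p \<in> {1..<n}"
    and eq: "cycle (seg z p n) = cycle [a, b]" and "a \<noteq> b"
  shows "p = n - 2 \<and> z (n - 2) = a \<and> z (n - 1) = b"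
proof -
  have ev: "even (n - p)"
    using cycle_eq_cycle2_odd[OF eq seg_neq_Nil] p assms(5) by auto
  have z: "z (p + i) = (if even i then a else b)" if "p + i < n" for i
  proof -
    have "cycle (seg z p n) !! i = seg z p n ! i"
      using that p cycle_unfold[OF seg_neq_Nil, of p n z]
      by (metis add.commute atLeastLessThan_iff length_seg less_diff_conv shift_snth_less)
    then have "cycle (seg z p n) !! i = z (p + i)"
      using seg_nth[OF that] by simp
    then show ?thesis
      unfolding eq snth_cycle2 by simp
  qed
  have "\<not> p + 4 \<le> n"
  proof
    assume "p + 4 \<le> n"
    then have "{p, p + 2} = {p + 1, p + 3}"
      using n4 p z[of 0] z[of 1] z[of 2] z[of 3] by (intro unique_coincidence[OF _ c]) auto
    then show False
      by (auto simp: doubleton_eq_iff)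
  qed
  moreover obtain j where "n - p = 2 * j"
    using ev by blast
  ultimately have "n = p + 2"
    using p unfolding atLeastLessThan_iff by presburger
  then show ?thesis
    using z[of 0] z[of 1] by simp
qed

text \<open>As \<open>n\<close> has the top rank, \<open>n - 1\<close> cannot be the lower end of a
  jump from 0 to 1, so another \<open>p\<close> above it also has letter 0. This is the only
  coincidence; the order from \<open>p\<close> to \<open>n - 2\<close> then passes to the successors
  and gives \<open>p + 1\<close> the letter 0 as well.\<close>

lemma not_max_alternating_top:
  assumes n4: "n \<ge> 4" and c: "c = n - 3" and n1: "\<pi> n = n"
  shows "cycle (seg z l n) \<noteq> cycle [c, 0]"
proof
  assume eq: "cycle (seg z l n) = cycle [c, 0]"
  have c1: "c \<ge> 1"
    using n4 c by simp
  have nn: "\<pi> n \<noteq> 1"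
    using n1 n4 by simp
  note l = l_props[OF nn]
  have s: "l = n - 2" "z (n - 2) = c" "z (n - 1) = 0"
    using alternating_cycle_short[OF n4 c l(1) eq] c1 by auto
  have mem: "n - 1 \<in> {1..<n}" "n - 2 \<in> {1..<n}"
    using n4 by auto
  obtain p q where pq: "p \<in> {1..<n}" "q \<in> {1..<n}" "z p = 0" "\<pi> (n - 1) \<le> \<pi> p" "\<pi> (Suc p) < \<pi> (Suc q)"
    using z_level[OF mem] s c1 by (metis less_le_trans less_one zero_less_one)
  have "\<pi> (Suc q) \<le> n"
    using pi_mem[of "Suc q"] pq(2) by auto
  then have p1: "p \<noteq> n - 1"
    using pq(5) n1 n4 by auto
  then have lt1: "\<pi> (n - 1) < \<pi> p"
    using pq(4) pi_inj[of "n - 1" p] by auto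
  have p2: "p \<noteq> n - 2"
    using s(2) pq(3) c1 by auto
  have lt2: "\<pi> p < \<pi> (n - 2)"
  proof -
    have "\<pi> p \<noteq> \<pi> n" "\<pi> p \<noteq> \<pi> (n - 2)" "\<pi> p \<le> n"
      using pq(1) p2 pi_inj[of p n] pi_inj[of p "n - 2"] pi_mem_lt[OF pq(1)] by auto
    then show ?thesis
      using l(2) s(1) n1 by simp
  qed
  have "\<pi> (Suc p) < \<pi> (Suc (n - 2))"
  proof (rule inc_order[OF pq(1) mem(2) lt2])
    fix i j assume ij: "i \<in> {1..<n}" "j \<in> {1..<n}" "\<pi> p \<le> \<pi> i" "\<pi> i < \<pi> j" "\<pi> j \<le> \<pi> (n - 2)"
    show "z i \<noteq> z j"
    proof
      assume "z i = z j"
      then have "{i, j} = {p, n - 1}"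
        using ij pq(1,3) s(3) p1 mem(1) n4 by (intro unique_coincidence[OF _ c]) auto
      then have "i = n - 1 \<or> j = n - 1"
        by (auto simp: doubleton_eq_iff)
      then show False
        using ij lt1 by auto
    qed
  qed
  moreover have "Suc (n - 2) = n - 1"
    using n4 by simp
  ultimately have lt3: "\<pi> (Suc p) < \<pi> (n - 1)"
    by simp
  have mem3: "Suc p \<in> {1..<n}"
    using pq(1) p1 by auto
  then have "z (Suc p) = 0"
    using compatD(1)[OF compat_z mem3 mem(1) lt3] s(3) by simp
  then have "{Suc p, n - 1} = {p, n - 1}"
    using mem3 mem(1) lt3 pq(1,3) p1 s(3) n4 by (intro unique_coincidence[OF _ c]) auto
  then show False
    by (auto simp: doubleton_eq_iff)
qed

text \<open>The mirrored argument, with the upper end of the jump from \<open>c - 1\<close> to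
  \<open>c\<close>.\<close>

lemma not_max_alternating_bottom:
  assumes n4: "n \<ge> 4" and c: "c = n - 3" and n1: "\<pi> n = 1"
  shows "cycle (seg z r n) \<noteq> cycle [0, c]"
proof
  assume eq: "cycle (seg z r n) = cycle [0, c]"
  have c1: "c \<ge> 1"
    using n4 c by simp
  have nn: "\<pi> n \<noteq> n"
    using n1 n4 by simp
  note r = r_props[OF nn]
  have s: "r = n - 2" "z (n - 2) = 0" "z (n - 1) = c"
    using alternating_cycle_short[OF n4 c r(1) eq] c1 by auto
  have mem: "n - 1 \<in> {1..<n}" "n - 2 \<in> {1..<n}"
    using n4 by auto
  have "c - 1 \<in> z ` {1..<n}"
    unfolding z_surj by simp
  then obtain p0 where p0: "p0 \<in> {1..<n}" "z p0 = c - 1"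
    by auto
  then have "z p0 < z (n - 1)"
    using s(3) c1 by simp
  then obtain p q where pq: "p \<in> {1..<n}" "q \<in> {1..<n}" "z q = c" "\<pi> q \<le> \<pi> (n - 1)" "\<pi> (Suc p) < \<pi> (Suc q)"
    using z_level[OF p0(1) mem(1)] p0(2) c1 by (metis Suc_pred' less_le_trans zero_less_one)
  have "1 \<le> \<pi> (Suc p)"
    using pi_mem[of "Suc p"] pq(1) by auto
  then have q1: "q \<noteq> n - 1"
    using pq(5) n1 n4 by auto
  then have lt1: "\<pi> q < \<pi> (n - 1)"
    using pq(4) pi_inj[of "n - 1" q] by auto
  have q2: "q \<noteq> n - 2"
    using s(2) pq(3) c1 by auto
  have lt2: "\<pi> (n - 2) < \<pi> q"
  proof -
    have "\<pi> q \<noteq> \<pi> n" "\<pi> q \<noteq> \<pi> (n - 2)" "1 \<le> \<pi> q"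
      using pq(2) q2 pi_inj[of q n] pi_inj[of q "n - 2"] pi_mem_lt[OF pq(2)] by auto
    then show ?thesis
      using r(2) s(1) n1 by simp
  qed
  have "\<pi> (Suc (n - 2)) < \<pi> (Suc q)"
  proof (rule inc_order[OF mem(2) pq(2) lt2])
    fix i j assume ij: "i \<in> {1..<n}" "j \<in> {1..<n}" "\<pi> (n - 2) \<le> \<pi> i" "\<pi> i < \<pi> j" "\<pi> j \<le> \<pi> q"
    show "z i \<noteq> z j"
    proof
      assume "z i = z j"
      then have "{i, j} = {q, n - 1}"
        using ij pq(2,3) s(3) q1 mem(1) n4 by (intro unique_coincidence[OF _ c]) auto
      then have "i = n - 1 \<or> j = n - 1"
        by (auto simp: doubleton_eq_iff)
      then show False
        using ij lt1 by auto
    qed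
  qed
  moreover have "Suc (n - 2) = n - 1"
    using n4 by simp
  ultimately have lt3: "\<pi> (n - 1) < \<pi> (Suc q)"
    by simp
  have mem3: "Suc q \<in> {1..<n}"
    using pq(2) q1 by auto
  then have "z (Suc q) = c"
    using compatD(1)[OF compat_z mem(1) mem3 lt3] s(3) z_le_c[OF mem3] by simp
  then have "{Suc q, n - 1} = {q, n - 1}"
    using mem3 mem(1) lt3 pq(2,3) q1 s(3) n4 by (intro unique_coincidence[OF _ c]) auto
  then show False
    by (auto simp: doubleton_eq_iff)
qed

text \<open>For \<open>c < n - 3\<close> an additional letter is affordable; for
  \<open>c = n - 3\<close> none is needed, because every obstruction forces too many equal letters
  or monotonicity.\<close>

lemma not_monotone_N_le:
  assumes n4: "n \<ge> 4" and nm: "\<not> upward" "\<not> downward"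
  shows "N_minus n \<pi> \<le> n - 2"
proof -
  have c: "c \<le> n - 3"
    using c_le c_max_imp_monotone nm by fastforce
  have "extendable c" if "c = n - 3"
  proof -
    have nc: "\<not> collapsed n \<pi>"
      using collapsed_imp_monotone[OF n4 that] nm by blast
    consider "\<pi> n = n" | "\<pi> n = 1" | "\<pi> n \<noteq> 1" "\<pi> n \<noteq> n"
      by blast
    then show ?thesis
    proof cases
      case 1
      then show ?thesis
        using extendable_top not_max_alternating_top[OF n4 that] by simp
    next
      case 2
      then show ?thesis
        using extendable_bottom not_max_alternating_bottom[OF n4 that] by simp
    next
      case 3
      then show ?thesis
        by (rule extendable_middle(2)[OF _ _ nc])
    qed
  qed
  then show ?thesis
    using c n4 by (cases "c = n - 3") (auto simp: N_minus_extendable)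
qed

lemma B_minus_cases:
  assumes n3: "n \<ge> 3" and b: "is_stair_base (n - 2) b"
  shows "if downward \<and> (even n \<longleftrightarrow> \<pi> n < \<pi> (n - 1)) then B_minus n \<pi> = b else B_minus n \<pi> < b"
proof -
  have ne: "\<pi> (n - 1) \<noteq> \<pi> n"
    using pi_inj[of "n - 1" n] n3 by auto
  consider "downward" | "upward" | "\<not> downward" "\<not> upward" "n = 3" | "\<not> downward" "\<not> upward" "n \<ge> 4"
    using n3 by linarith
  then show ?thesis
  proof cases
    case 1
    then show ?thesis
      using special_B_eq[OF n3 1 b] downward_B_less[OF n3 1 b] ne by (auto simp: not_less)
  next
    case 2
    have "\<not> downward"
    proof
      assume downward
      then have "\<pi> 2 < \<pi> 1" "\<pi> 1 < \<pi> 2"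
        using 2 n3 by (auto simp: downward_def upward_def)
      then show False
        by simp
    qed
    then show ?thesis
      using upward_B_less[OF n3 2 b] by simp
  next
    case 3
    then show ?thesis
      using length_3_middle_B_less[of b] b by simp
  next
    case 4
    have "B_minus n \<pi> < real (N_minus n \<pi>)"
      by (rule B_minus_less_N)
    also have "\<dots> \<le> real (n - 2)"
      using not_monotone_N_le[OF 4(3,2,1)] by simp
    also have "\<dots> < b"
      using b by (simp add: is_stair_base_def)
    finally show ?thesis
      using 4(1) by simp
  qed
qed

lemma B_minus_le_base:
  assumes "n \<ge> 3" "is_stair_base (n - 2) b"
  shows "B_minus n \<pi> \<le> b"
  using B_minus_cases[OF assms] by (auto split: if_splits)

text \<open>Read off from the base instead of from \<open>c\<close>, which covers
  \<open>n = 3\<close> as well: \<open>B_minus n \<pi> \<le> b < n - 1\<close>, and the number of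
  letters is the floor plus one.\<close>

lemma N_minus_le_n:
  assumes n3: "n \<ge> 3"
  shows "N_minus n \<pi> \<le> n - 1"
proof -
  have "n - 2 \<ge> 1"
    using n3 by simp
  then obtain b where b: "is_stair_base (n - 2) b"
    using is_stair_base_exists by blast
  then have "B_minus n \<pi> < real n - 1"
    using B_minus_le_base[OF n3 b] n3 by (simp add: is_stair_base_def)
  then have "\<lfloor>B_minus n \<pi>\<rfloor> < int n - 1"
    by (simp add: floor_less_iff)
  then show ?thesis
    using N_minus_floor n3 by linarith
qed

lemma N_minus_eq_iff_monotone:
  assumes "n \<ge> 4"
  shows "N_minus n \<pi> = n - 1 \<longleftrightarrow> upward \<or> downward"
  using not_monotone_N_le[OF assms] monotone_N_ge N_minus_le_n assms by fastforce

section \<open>From comparisons of ranks back to one-line notation\<close>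

lemma rank: "p \<in> {1..n} \<Longrightarrow> \<pi> p = Suc (card {q \<in> {1..n}. \<pi> q < \<pi> p})"
proof -
  assume p: "p \<in> {1..n}"
  have "\<pi> ` {q \<in> {1..n}. \<pi> q < \<pi> p} = {1..<\<pi> p}"
  proof
    show "\<pi> ` {q \<in> {1..n}. \<pi> q < \<pi> p} \<subseteq> {1..<\<pi> p}"
      using pi_mem by fastforce
    show "{1..<\<pi> p} \<subseteq> \<pi> ` {q \<in> {1..n}. \<pi> q < \<pi> p}"
    proof
      fix i assume i: "i \<in> {1..<\<pi> p}"
      then have "inv \<pi> i \<in> {1..n}"
        using pi_mem[OF p] by (intro inv_mem) auto
      then show "i \<in> \<pi> ` {q \<in> {1..n}. \<pi> q < \<pi> p}"
        using i by (intro image_eqI[of _ _ "inv \<pi> i"]) auto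
    qed
  qed
  moreover have "inj_on \<pi> {q \<in> {1..n}. \<pi> q < \<pi> p}"
    using pi_inj by (auto intro: inj_onI)
  ultimately have "card {q \<in> {1..n}. \<pi> q < \<pi> p} = \<pi> p - 1"
    using card_image by fastforce
  then show ?thesis
    using pi_mem[OF p] by simp
qed

lemma one_line_iff: "length xs = n \<Longrightarrow> one_line n \<pi> = xs \<longleftrightarrow> (\<forall>p\<in>{1..n}. \<pi> p = xs ! (p - 1))"
proof -
  assume len: "length xs = n"
  have "one_line n \<pi> = xs \<longleftrightarrow> (\<forall>i<n. \<pi> (Suc i) = xs ! i)"
    using len by (auto simp: list_eq_iff_nth_eq one_line_def simp del: upt_Suc)
  also have "\<dots> \<longleftrightarrow> (\<forall>p\<in>{1..n}. \<pi> p = xs ! (p - 1))"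
  proof
    assume *: "\<forall>i<n. \<pi> (Suc i) = xs ! i"
    show "\<forall>p\<in>{1..n}. \<pi> p = xs ! (p - 1)"
    proof
      fix p assume p: "p \<in> {1..n}"
      then have "p - 1 < n"
        by auto
      then show "\<pi> p = xs ! (p - 1)"
        using *[rule_format, of "p - 1"] p by simp
    qed
  next
    assume *: "\<forall>p\<in>{1..n}. \<pi> p = xs ! (p - 1)"
    show "\<forall>i<n. \<pi> (Suc i) = xs ! i"
      using * by auto
  qed
  finally show ?thesis .
qed

lemma upward_initial:
  assumes upward "1 \<le> p" "p + 2 \<le> n"
  shows "\<pi> p = p"
proof -
  have "{q \<in> {1..n}. \<pi> q < \<pi> p} = {1..<p}"
  proof (intro equalityI subsetI)
    fix q assume q: "q \<in> {q \<in> {1..n}. \<pi> q < \<pi> p}"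
    then have "\<not> p < q" "p \<noteq> q"
      using assms by (auto simp: upward_def dest: less_asym)
    then show "q \<in> {1..<p}"
      using q by auto
  next
    fix q assume "q \<in> {1..<p}"
    then show "q \<in> {q \<in> {1..n}. \<pi> q < \<pi> p}"
      using assms by (auto simp: upward_def)
  qed
  then show ?thesis
    using rank[of p] assms(2,3) by simp
qed

lemma downward_initial:
  assumes downward "1 \<le> p" "p + 2 \<le> n"
  shows "\<pi> p = n + 1 - p"
proof -
  have "{q \<in> {1..n}. \<pi> q < \<pi> p} = {p<..n}"
  proof (intro equalityI subsetI)
    fix q assume q: "q \<in> {q \<in> {1..n}. \<pi> q < \<pi> p}"
    have "\<not> q < p"
    proof
      assume "q < p"
      then have "\<pi> p < \<pi> q"
        using assms q by (auto simp: downward_def)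
      then show False
        using q by simp
    qed
    moreover have "q \<noteq> p"
      using q by auto
    ultimately show "q \<in> {p<..n}"
      using q by auto
  next
    fix q assume "q \<in> {p<..n}"
    then show "q \<in> {q \<in> {1..n}. \<pi> q < \<pi> p}"
      using assms by (auto simp: downward_def)
  qed
  then show ?thesis
    using rank[of p] assms(2,3) by simp
qed

lemma upward_last:
  assumes upward "n \<ge> 3"
  shows "\<pi> (n - 1) < \<pi> n \<Longrightarrow> \<pi> (n - 1) = n - 1 \<and> \<pi> n = n"
    and "\<pi> n < \<pi> (n - 1) \<Longrightarrow> \<pi> (n - 1) = n \<and> \<pi> n = n - 1"
proof -
  have small: "\<pi> q < \<pi> (n - 1)" "\<pi> q < \<pi> n" if "q \<in> {1..n}" "q \<noteq> n - 1" "q \<noteq> n" for q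
    using assms that by (auto simp: upward_def)
  have mem: "n - 1 \<in> {1..n}" "n \<in> {1..n}"
    using assms(2) by auto
  {
    assume lt: "\<pi> (n - 1) < \<pi> n"
    have "\<pi> q < \<pi> n" if "q \<in> {1..n}" "q \<noteq> n" for q
      using small(2)[OF that(1) _ that(2)] lt by (cases "q = n - 1") auto
    then have "{q \<in> {1..n}. \<pi> q < \<pi> (n - 1)} = {1..n} - {n - 1, n}" "{q \<in> {1..n}. \<pi> q < \<pi> n} = {1..n} - {n}"
      using small lt by auto
    then show "\<pi> (n - 1) = n - 1 \<and> \<pi> n = n"
      using rank[OF mem(1)] rank[OF mem(2)] assms(2) by (simp add: card_Diff_subset)
  }
  {
    assume lt: "\<pi> n < \<pi> (n - 1)"
    have "\<pi> q < \<pi> (n - 1)" if "q \<in> {1..n}" "q \<noteq> n - 1" for q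
      using small(1)[OF that] lt by (cases "q = n") auto
    then have "{q \<in> {1..n}. \<pi> q < \<pi> n} = {1..n} - {n - 1, n}" "{q \<in> {1..n}. \<pi> q < \<pi> (n - 1)} = {1..n} - {n - 1}"
      using small lt by auto
    then show "\<pi> (n - 1) = n \<and> \<pi> n = n - 1"
      using rank[OF mem(1)] rank[OF mem(2)] assms(2) by (simp add: card_Diff_subset)
  }
qed

lemma downward_last:
  assumes downward "n \<ge> 3"
  shows "\<pi> (n - 1) < \<pi> n \<Longrightarrow> \<pi> (n - 1) = 1 \<and> \<pi> n = 2"
    and "\<pi> n < \<pi> (n - 1) \<Longrightarrow> \<pi> (n - 1) = 2 \<and> \<pi> n = 1"
proof -
  have large: "\<pi> (n - 1) < \<pi> q" "\<pi> n < \<pi> q" if "q \<in> {1..n}" "q \<noteq> n - 1" "q \<noteq> n" for q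
    using assms that by (auto simp: downward_def)
  have sub: "{q \<in> {1..n}. \<pi> q < \<pi> (n - 1)} = (if \<pi> n < \<pi> (n - 1) then {n} else {})"
    "{q \<in> {1..n}. \<pi> q < \<pi> n} = (if \<pi> (n - 1) < \<pi> n then {n - 1} else {})"
    using large assms(2) by (auto dest: less_asym)
  have mem: "n - 1 \<in> {1..n}" "n \<in> {1..n}"
    using assms(2) by auto
  show "\<pi> (n - 1) < \<pi> n \<Longrightarrow> \<pi> (n - 1) = 1 \<and> \<pi> n = 2"
    "\<pi> n < \<pi> (n - 1) \<Longrightarrow> \<pi> (n - 1) = 2 \<and> \<pi> n = 1"
    using rank[OF mem(1)] rank[OF mem(2)] unfolding sub by (simp_all split: if_splits)
qed

lemma one_line_monotone:
  assumes n3: "n \<ge> 3"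
  shows "one_line n \<pi> = [1..<n + 1] \<longleftrightarrow> upward \<and> \<pi> (n - 1) < \<pi> n"
    and "one_line n \<pi> = [1..<n - 1] @ [n, n - 1] \<longleftrightarrow> upward \<and> \<pi> n < \<pi> (n - 1)"
    and "one_line n \<pi> = rev [1..<n + 1] \<longleftrightarrow> downward \<and> \<pi> n < \<pi> (n - 1)"
    and "one_line n \<pi> = rev [3..<n + 1] @ [1, 2] \<longleftrightarrow> downward \<and> \<pi> (n - 1) < \<pi> n"
proof -
  have split: "q = n - 1 \<or> q = n \<or> q + 2 \<le> n" if "q \<in> {1..n}" for q
    using that by auto
  have "one_line n \<pi> = [1..<n + 1] \<longleftrightarrow> (\<forall>p\<in>{1..n}. \<pi> p = p)"
    using one_line_iff[of "[1..<n + 1]"] by (auto simp del: upt_Suc)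
  also have "\<dots> \<longleftrightarrow> upward \<and> \<pi> (n - 1) < \<pi> n"
  proof
    assume "\<forall>p\<in>{1..n}. \<pi> p = p"
    then show "upward \<and> \<pi> (n - 1) < \<pi> n"
      using n3 by (auto simp: upward_def)
  next
    assume *: "upward \<and> \<pi> (n - 1) < \<pi> n"
    show "\<forall>p\<in>{1..n}. \<pi> p = p"
    proof
      fix p assume "p \<in> {1..n}"
      then show "\<pi> p = p"
        using split[of p] upward_initial[of p] upward_last(1)[OF _ n3] * by auto
    qed
  qed
  finally show "one_line n \<pi> = [1..<n + 1] \<longleftrightarrow> upward \<and> \<pi> (n - 1) < \<pi> n" .
  let ?f = "\<lambda>p. if p = n - 1 then n else if p = n then n - 1 else p"
  have "([1..<n - 1] @ [n, n - 1]) ! (p - 1) = ?f p" if "p \<in> {1..n}" for p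
    using split[OF that] that n3 by (auto simp: nth_append nth_Cons split: nat.split)
  then have "one_line n \<pi> = [1..<n - 1] @ [n, n - 1] \<longleftrightarrow> (\<forall>p\<in>{1..n}. \<pi> p = ?f p)"
    using one_line_iff[of "[1..<n - 1] @ [n, n - 1]"] n3 by (simp del: One_nat_def)
  also have "\<dots> \<longleftrightarrow> upward \<and> \<pi> n < \<pi> (n - 1)"
  proof
    assume *: "\<forall>p\<in>{1..n}. \<pi> p = ?f p"
    then show "upward \<and> \<pi> n < \<pi> (n - 1)"
      using * n3 by (auto simp: upward_def)
  next
    assume *: "upward \<and> \<pi> n < \<pi> (n - 1)"
    show "\<forall>p\<in>{1..n}. \<pi> p = ?f p"
    proof
      fix p assume "p \<in> {1..n}"
      then show "\<pi> p = ?f p"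
        using split[of p] upward_initial[of p] upward_last(2)[OF _ n3] * n3 by auto
    qed
  qed
  finally show "one_line n \<pi> = [1..<n - 1] @ [n, n - 1] \<longleftrightarrow> upward \<and> \<pi> n < \<pi> (n - 1)" .
  have "rev [1..<n + 1] ! (p - 1) = n + 1 - p" if "p \<in> {1..n}" for p
    using that by (auto simp: rev_nth simp del: upt_Suc)
  then have "one_line n \<pi> = rev [1..<n + 1] \<longleftrightarrow> (\<forall>p\<in>{1..n}. \<pi> p = n + 1 - p)"
    using one_line_iff[of "rev [1..<n + 1]"] by (simp del: One_nat_def upt_Suc)
  also have "\<dots> \<longleftrightarrow> downward \<and> \<pi> n < \<pi> (n - 1)"
  proof
    assume *: "\<forall>p\<in>{1..n}. \<pi> p = n + 1 - p"
    then show "downward \<and> \<pi> n < \<pi> (n - 1)"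
      using * n3 by (auto simp: downward_def)
  next
    assume *: "downward \<and> \<pi> n < \<pi> (n - 1)"
    show "\<forall>p\<in>{1..n}. \<pi> p = n + 1 - p"
    proof
      fix p assume "p \<in> {1..n}"
      then show "\<pi> p = n + 1 - p"
        using split[of p] downward_initial[of p] downward_last(2)[OF _ n3] * n3 by auto
    qed
  qed
  finally show "one_line n \<pi> = rev [1..<n + 1] \<longleftrightarrow> downward \<and> \<pi> n < \<pi> (n - 1)" .
  let ?g = "\<lambda>p. if p = n - 1 then 1 else if p = n then 2 else n + 1 - p"
  have "(rev [3..<n + 1] @ [1, 2]) ! (p - 1) = ?g p" if "p \<in> {1..n}" for p
    using split[OF that] that n3 by (auto simp: nth_append nth_Cons rev_nth split: nat.split simp del: upt_Suc)
  then have "one_line n \<pi> = rev [3..<n + 1] @ [1, 2] \<longleftrightarrow> (\<forall>p\<in>{1..n}. \<pi> p = ?g p)"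
    using one_line_iff[of "rev [3..<n + 1] @ [1, 2]"] n3 by (simp del: One_nat_def upt_Suc)
  also have "\<dots> \<longleftrightarrow> downward \<and> \<pi> (n - 1) < \<pi> n"
  proof
    assume *: "\<forall>p\<in>{1..n}. \<pi> p = ?g p"
    then show "downward \<and> \<pi> (n - 1) < \<pi> n"
      using * n3 by (auto simp: downward_def)
  next
    assume *: "downward \<and> \<pi> (n - 1) < \<pi> n"
    show "\<forall>p\<in>{1..n}. \<pi> p = ?g p"
    proof
      fix p assume "p \<in> {1..n}"
      then show "\<pi> p = ?g p"
        using split[of p] downward_initial[of p] downward_last(1)[OF _ n3] * n3 by auto
    qed
  qed
  finally show "one_line n \<pi> = rev [3..<n + 1] @ [1, 2] \<longleftrightarrow> downward \<and> \<pi> (n - 1) < \<pi> n" .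
qed

lemma B_minus_eq_base_iff:
  assumes n3: "n \<ge> 3" and b: "is_stair_base (n - 2) b"
  shows "B_minus n \<pi> = b \<longleftrightarrow>
    one_line n \<pi> = (if even n then rev [1..<n + 1] else rev [3..<n + 1] @ [1, 2])"
proof -
  have "\<pi> (n - 1) \<noteq> \<pi> n"
    using pi_inj[of "n - 1" n] n3 by auto
  then have "downward \<and> (even n \<longleftrightarrow> \<pi> n < \<pi> (n - 1)) \<longleftrightarrow>
      one_line n \<pi> = (if even n then rev [1..<n + 1] else rev [3..<n + 1] @ [1, 2])"
    using one_line_monotone(3,4)[OF n3] by auto
  then show ?thesis
    using B_minus_cases[OF n3 b] by (auto split: if_splits)
qed

end

section \<open>The maximum over all permutations\<close>

lemma list_permutes:
  assumes "length xs = n" "set xs = {1..n}"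
  obtains \<pi> where "\<pi> permutes {1..n}" "one_line n \<pi> = xs"
proof
  define \<pi> where "\<pi> p = (if p \<in> {1..n} then xs ! (p - 1) else p)" for p
  have img: "\<pi> ` {1..n} = {1..n}"
  proof -
    have "{1..n} = Suc ` {0..<n}"
      by (simp add: image_Suc_atLeastLessThan atLeastLessThanSuc_atLeastAtMost)
    then have "\<pi> ` {1..n} = (\<lambda>i. \<pi> (Suc i)) ` {0..<n}"
      by (simp only: image_image)
    also have "\<dots> = (\<lambda>i. xs ! i) ` {0..<n}"
      by (intro image_cong) (auto simp: \<pi>_def)
    finally have "\<pi> ` {1..n} = (\<lambda>i. xs ! i) ` {0..<n}" .
    then show ?thesis
      using assms by (metis list.set_map map_nth set_upt)
  qed
  show "\<pi> permutes {1..n}"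
  proof (rule bij_imp_permutes)
    show "bij_betw \<pi> {1..n} {1..n}"
      unfolding bij_betw_def using img by (simp add: eq_card_imp_inj_on)
  qed (auto simp: \<pi>_def)
  show "one_line n \<pi> = xs"
    using assms(1) by (intro nth_equalityI) (auto simp: one_line_def \<pi>_def simp del: upt_Suc)
qed

lemma Max_B_minus:
  assumes n3: "n \<ge> 3" and b: "is_stair_base (n - 2) b"
  shows "Max (B_minus n ` {\<pi>. \<pi> permutes {1..n}}) = b"
proof (rule Max_eqI)
  show "finite (B_minus n ` {\<pi>. \<pi> permutes {1..n}})"
    by (simp add: finite_permutations)
  show "y \<le> b" if "y \<in> B_minus n ` {\<pi>. \<pi> permutes {1..n}}" for y
    using that perm_pattern.B_minus_le_base[OF _ n3 b] n3 by (auto simp: perm_pattern_def)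
  let ?xs = "if even n then rev [1..<n + 1] else rev [3..<n + 1] @ [1, 2]"
  have "length ?xs = n" "set ?xs = {1..n}"
    using n3 by (auto simp del: upt_Suc)
  then obtain \<pi> where \<pi>: "\<pi> permutes {1..n}" "one_line n \<pi> = ?xs"
    by (rule list_permutes)
  then have "B_minus n \<pi> = b"
    using perm_pattern.B_minus_eq_base_iff[OF _ n3 b, of \<pi>] n3 by (simp add: perm_pattern_def)
  then show "b \<in> B_minus n ` {\<pi>. \<pi> permutes {1..n}}"
    using \<pi>(1) by auto
qed

theorem theorem3:
  fixes n :: nat
  assumes "n \<ge> 2"
  shows
    "(\<forall>\<pi>. \<pi> permutes {1..n} \<longrightarrow>
        int (N_minus n \<pi>) = \<lfloor>B_minus n \<pi>\<rfloor> + 1 \<and>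
        N_minus n \<pi> = Max (z_seq n \<pi> ` {1..<n}) + 1 + epsilon n \<pi>) \<and>
     (n \<ge> 3 \<longrightarrow> (\<forall>\<pi>. \<pi> permutes {1..n} \<longrightarrow> N_minus n \<pi> \<le> n - 1)) \<and>
     (n \<ge> 4 \<longrightarrow> (\<forall>\<pi>. \<pi> permutes {1..n} \<longrightarrow>
        (N_minus n \<pi> = n - 1 \<longleftrightarrow>
         one_line n \<pi> \<in> {[1..<n + 1], [1..<n - 1] @ [n, n - 1],
                        rev [1..<n + 1], rev [3..<n + 1] @ [1, 2]}))) \<and>
     (n \<ge> 3 \<longrightarrow>
        (let M = Max (B_minus n ` {\<pi>. \<pi> permutes {1..n}}) in
         M = b_seq (rev [1..<n - 1] @- cycle [0]) \<and>
         real n - 2 < M \<and> M < real n - 1 \<and>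
         (\<forall>\<pi>. \<pi> permutes {1..n} \<longrightarrow>
            (B_minus n \<pi> = M \<longleftrightarrow>
             one_line n \<pi> = (if even n then rev [1..<n + 1] else rev [3..<n + 1] @ [1, 2])))))"
proof -
  have loc: "perm_pattern n \<pi>" if "\<pi> permutes {1..n}" for \<pi>
    using that assms by (simp add: perm_pattern_def)
  have 1: "int (N_minus n \<pi>) = \<lfloor>B_minus n \<pi>\<rfloor> + 1" "N_minus n \<pi> = Max (z_seq n \<pi> ` {1..<n}) + 1 + epsilon n \<pi>"
    "n \<ge> 3 \<longrightarrow> N_minus n \<pi> \<le> n - 1" if "\<pi> permutes {1..n}" for \<pi>
  proof -
    interpret perm_pattern n \<pi>
      by (rule loc[OF that])
    show "int (N_minus n \<pi>) = \<lfloor>B_minus n \<pi>\<rfloor> + 1" "n \<ge> 3 \<longrightarrow> N_minus n \<pi> \<le> n - 1"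
      using N_minus_floor N_minus_le_n by blast+
    show "N_minus n \<pi> = Max (z_seq n \<pi> ` {1..<n}) + 1 + epsilon n \<pi>"
      using N_minus_eq unfolding c_def .
  qed
  have 2: "N_minus n \<pi> = n - 1 \<longleftrightarrow>
      one_line n \<pi> \<in> {[1..<n + 1], [1..<n - 1] @ [n, n - 1], rev [1..<n + 1], rev [3..<n + 1] @ [1, 2]}"
    if n4: "n \<ge> 4" and \<pi>: "\<pi> permutes {1..n}" for \<pi>
  proof -
    interpret perm_pattern n \<pi>
      by (rule loc[OF \<pi>])
    have "\<pi> (n - 1) < \<pi> n \<or> \<pi> n < \<pi> (n - 1)"
      using pi_inj[of "n - 1" n] n4 by (metis diff_less linorder_neqE_nat less_irrefl less_le_trans zero_less_numeral zero_less_one)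
    moreover have "n \<ge> 3"
      using n4 by simp
    note one_line_monotone[OF this]
    ultimately show ?thesis
      unfolding N_minus_eq_iff_monotone[OF n4] insert_iff empty_iff by blast
  qed
  have 3: "let M = Max (B_minus n ` {\<pi>. \<pi> permutes {1..n}}) in
      M = b_seq (rev [1..<n - 1] @- cycle [0]) \<and> real n - 2 < M \<and> M < real n - 1 \<and>
      (\<forall>\<pi>. \<pi> permutes {1..n} \<longrightarrow> (B_minus n \<pi> = M \<longleftrightarrow>
        one_line n \<pi> = (if even n then rev [1..<n + 1] else rev [3..<n + 1] @ [1, 2])))"
    if n3: "n \<ge> 3"
  proof -
    have "n - 2 \<ge> 1"
      using n3 by simp
    then obtain b where b: "is_stair_base (n - 2) b"
      by (rule is_stair_base_exists)
    have "real n - 2 < b" "b < real n - 1"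
      using b n3 by (auto simp: is_stair_base_def)
    then show ?thesis
      unfolding Max_B_minus[OF n3 b] Let_def
      using b_seq_stair[OF n3 b] perm_pattern.B_minus_eq_base_iff[OF loc n3 b] by auto
  qed
  show ?thesis
    using 1 2 3 by blast
qed

end
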